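(* Let $\xi(t)=\beta^{2}\sum_{p\geq2}\beta_{p}^{2}t^{p}$, not identically zero, satisfy $\xi(1+\epsilon)<\infty$ for some $\epsilon>0$, let $h\ge 0$, and set $\mathfrak{d}=\left(\frac{1}{\sqrt{\xi''}}\right)''$. Let $\mu$ be the minimizer of $P_{\xi,h}$ over $\Pr([0,1])$, let $\eta$ be the maximizer of $D_{\xi,h}$ over $\Lambda_{\xi,h}$, and write $\{\eta=\xi\}=\{s\in[0,1):\eta(s)=\xi(s)\}$. If $\mathfrak{d}$ is not identically zero, then the elements of $\{\eta=\xi\}\setminus\operatorname{supp}\mu$ are isolated points of $\{\eta=\xi\}$. If $\mathfrak{d}$ is identically zero, then $\mu=m\delta_{r_{1}}+(1-m)\delta_{r_{2}}$ for some $m\in[0,1]$ and $r_{1},r_{2}\in[0,1]$, and $\{\eta=\xi\}=[r_{1},r_{2}]$.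
   Context: Here $\beta$ and $\beta_p$ ($p\ge2$) are real numbers. $\Pr([0,1])$ is the set of Borel probability measures on $[0,1]$. For $\mu\in\Pr([0,1])$, let $\phi_{\mu}(t)=\int_{t}^{1}\mu([0,s])\,ds$ for $t\in[0,1]$; note $0\le\phi_\mu(s)\le 1-s$. The Crisanti-Sommers functional is $$P_{\xi,h}(\mu)=\frac{1}{2}\left(\int_{0}^{1}\xi''\phi_{\mu}\,ds+\int_{0}^{1}\left(\frac{1}{\phi_{\mu}}-\frac{1}{1-s}\right)ds+h^{2}\phi_{\mu}(0)\right)\in(-\infty,+\infty],$$ where the second integrand is non-negative (with $1/0=+\infty$). Let $X=\{\eta:\eta\in C^{1}([0,1)),\ \eta'\in Lip_{\mathrm{loc}}([0,1))\}$, where $\eta$ is real-valued and may blow up at $1$ and $Lip_{\mathrm{loc}}$ denotes locally Lipschitz functions. For $\eta\in X$, the second distributional derivative $\eta''$ is identified with an a.e. unique measurable function, essentially bounded on each $[0,1-\delta]$, $\delta>0$. Let $$\Lambda_{\xi,h}=\left\{ \eta\in X:\ \eta\geq\xi \text{ on } [0,1),\ \eta'(0)=-h^{2},\ \eta''\geq0\ \text{Lebesgue-a.e.}\right\}$$ and define $D_{\xi,h}:\Lambda_{\xi,h}\to[-\infty,\infty)$ by $$D_{\xi,h}(\eta)=\frac{1}{2}\left(\int_{0}^{1}\left(2\sqrt{\eta''(s)}-\eta''(s)(1-s)-\frac{1}{1-s}\right)ds-\eta(0)+h^{2}+\xi(1)\right),$$ where the integrand is non-positive by the arithmetic-geometric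 mean inequality. The minimizer $\mu$ of $P_{\xi,h}$ and the maximizer $\eta$ of $D_{\xi,h}$ exist and are unique. The function $\mathfrak d$ is defined at the points of $[0,1]$ where $\xi''>0$, i.e. on $(0,1]$, and also at $0$ when $\xi''(0)>0$. $\delta_x$ denotes the Dirac mass at $x$. *)

theory Defs
  imports "HOL-Probability.Probability"
begin

(* The coefficients b 0 and b 1 are ignored.  When the radius of convergence exceeds 1, the two-sided
   derivatives below make sense at the end points 0 and 1 too. *)
definition model :: "real \<Rightarrow> (nat \<Rightarrow> real) \<Rightarrow> real \<Rightarrow> real" where
  "model \<beta> b t = \<beta>\<^sup>2 * (\<Sum>p. (if 2 \<le> p then (b p)\<^sup>2 else 0) * t ^ p)"

definition frakd :: "(real \<Rightarrow> real) \<Rightarrow> real \<Rightarrow> real" where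
  "frakd \<xi> = deriv (deriv (\<lambda>s. 1 / sqrt (deriv (deriv \<xi>) s)))"

definition frakd_dom :: "(real \<Rightarrow> real) \<Rightarrow> real set" where
  "frakd_dom \<xi> = {t \<in> {0..1}. deriv (deriv \<xi>) t > 0}"

abbreviation borel01 :: "real measure" where
  "borel01 \<equiv> restrict_space borel {0..1}"

definition Pr01 :: "real measure set" where
  "Pr01 = {\<mu>. prob_space \<mu> \<and> sets \<mu> = sets borel01}"

definition supp :: "real measure \<Rightarrow> real set" where
  "supp \<mu> = {x \<in> space \<mu>. \<forall>U. open U \<and> x \<in> U \<longrightarrow> emeasure \<mu> (U \<inter> space \<mu>) > 0}"

definition phi :: "real measure \<Rightarrow> real \<Rightarrow> real" where
  "phi \<mu> t = (LBINT s:{t..1}. measure \<mu> {0..s})"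

(* The second integrand is computed in ennreal, where 1 / 0 is infinite; the truncated
   subtraction is harmless there because phi \<mu> s is at most 1 - s. *)
definition crisanti_sommers :: "(real \<Rightarrow> real) \<Rightarrow> real \<Rightarrow> real measure \<Rightarrow> ereal" where
  "crisanti_sommers \<xi> h \<mu> = ereal (1/2) *
     (ereal (LBINT s:{0..1}. deriv (deriv \<xi>) s * phi \<mu> s)
      + enn2ereal (\<integral>\<^sup>+s\<in>{0..<1}. (1 / ennreal (phi \<mu> s) - 1 / ennreal (1 - s)) \<partial>lborel)
      + ereal (h\<^sup>2 * phi \<mu> 0))"

(* Functions on [0,1) are total functions whose values outside [0,1) are never used;
   at 0 the first derivative is the right derivative. *)
definition deriv1 :: "(real \<Rightarrow> real) \<Rightarrow> real \<Rightarrow> real" where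
  "deriv1 \<eta> s = vector_derivative \<eta> (at s within {0..<1})"

(* The singleton {0} is a dummy parameter set of the library's local_lipschitz. *)
definition X_space :: "(real \<Rightarrow> real) set" where
  "X_space = {\<eta>. (\<forall>s\<in>{0..<1}. (\<eta> has_real_derivative deriv1 \<eta> s) (at s within {0..<1}))
                 \<and> continuous_on {0..<1} (deriv1 \<eta>)
                 \<and> local_lipschitz {0::real} {0..<1} (\<lambda>_. deriv1 \<eta>)}"

definition test_functions :: "(real \<Rightarrow> real) set" where
  "test_functions = {\<psi>. (\<forall>k x. (deriv ^^ k) \<psi> field_differentiable at x)
                       \<and> (\<exists>K. compact K \<and> K \<subseteq> {0<..<1} \<and> (\<forall>x. x \<notin> K \<longrightarrow> \<psi> x = 0))}"

definition is_distr_deriv2 :: "(real \<Rightarrow> real) \<Rightarrow> (real \<Rightarrow> real) \<Rightarrow> bool" where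
  "is_distr_deriv2 \<eta> g \<longleftrightarrow>
     g \<in> borel_measurable borel
     \<and> (\<forall>\<delta>>0. \<exists>C. AE s in lborel. s \<in> {0..1 - \<delta>} \<longrightarrow> \<bar>g s\<bar> \<le> C)
     \<and> (\<forall>\<psi>\<in>test_functions.
          (LBINT s:{0<..<1}. \<eta> s * deriv (deriv \<psi>) s) = (LBINT s:{0<..<1}. g s * \<psi> s))"

(* For \<eta> in X_space such a function exists and is unique up to null sets of [0,1); all uses
   below are independent of the representative. *)
definition distr_deriv2 :: "(real \<Rightarrow> real) \<Rightarrow> real \<Rightarrow> real" where
  "distr_deriv2 \<eta> = (SOME g. is_distr_deriv2 \<eta> g)"

definition Lambda :: "(real \<Rightarrow> real) \<Rightarrow> real \<Rightarrow> (real \<Rightarrow> real) set" where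
  "Lambda \<xi> h = {\<eta> \<in> X_space. (\<forall>s\<in>{0..<1}. \<xi> s \<le> \<eta> s)
                   \<and> deriv1 \<eta> 0 = - h\<^sup>2
                   \<and> (AE s in lborel. s \<in> {0..<1} \<longrightarrow> distr_deriv2 \<eta> s \<ge> 0)}"

(* The integrand is non-positive for \<eta> in Lambda, so its integral, which may be -\<infinity>, is minus the
   integral of its negative in ennreal. *)
definition dual_functional :: "(real \<Rightarrow> real) \<Rightarrow> real \<Rightarrow> (real \<Rightarrow> real) \<Rightarrow> ereal" where
  "dual_functional \<xi> h \<eta> = ereal (1/2) *
     (- enn2ereal (\<integral>\<^sup>+s\<in>{0..<1}.
          ennreal (- (2 * sqrt (distr_deriv2 \<eta> s) - distr_deriv2 \<eta> s * (1 - s) - 1 / (1 - s)))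
          \<partial>lborel)
      + ereal (- \<eta> 0 + h\<^sup>2 + \<xi> 1))"

definition contact_set :: "(real \<Rightarrow> real) \<Rightarrow> (real \<Rightarrow> real) \<Rightarrow> real set" where
  "contact_set \<xi> \<eta> = {s \<in> {0..<1}. \<eta> s = \<xi> s}"

end

theory Submission
  imports Defs "HOL-Complex_Analysis.Complex_Analysis"
begin

text \<open>
  Write $\phi$ for the function $\phi_\mu$ of the minimizer and $g = \eta - \xi$ for the maximizer.
  Completing a square shows, for every $\eta$ in $\Lambda$ and every $\mu$ carried by some
  $[0,q]$ with $q < 1$,
  \[ 2 P(\mu) - 2 D(\eta) = \int_0^1 \phi (\sqrt{\eta''} - 1/\phi)^2 ds + \int (\eta - \xi) d\mu ; \]
  this is \<open>duality_gap\<close>.  Both terms on the right are non-negative.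

  The gap vanishes at the optimum.  Let $\eta_0$ solve $\eta_0'' = 1/\phi^2$, $\eta_0'(0) = -h^2$.
  Moving the mass of $\mu$ in $[0,q]$ to a point $x$ must not decrease $P$, and the first order
  term of this perturbation says that the integral of $\eta_0 - \xi$ over $[0,q]$
  against $\mu$ is at most $\mu([0,q])$ times its value at $x$
  (\<open>variation_moving_mass_to_point\<close>).  Since $\eta_0$ blows up at $1$ and an
  atom at $1$ would make $P$ infinite, $\mu$ is carried by a compact subset of $[0,1)$ on which
  $\eta_0 - \xi$ takes its minimal value $m$ (\<open>minimizer_support\<close>).  Hence $\eta_0 - m$ belongs to $\Lambda$ and has no gap
  with $\mu$, so the maximizer has none either: $\eta'' = 1/\phi^2$, and $\eta = \xi$
  holds $\mu$-almost everywhere (\<open>optimality_conditions\<close>).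

  The statement now concerns the zeros of $g \ge 0$ with $g'' = 1/\phi^2 - \xi''$, where $\phi$ is affine on every
  interval that $\mu$ does not charge.  At a zero, $g' = 0$ and $g'' \ge 0$.

  Suppose that a contact point outside the support is a limit of contact points.  By Rolle's theorem
  for $g'$, the roots of $\phi^2 \xi'' = 1$ accumulate there, with $\phi$ affine near that
  point.  By analytic continuation $\xi''$ is the reciprocal of the square of one affine function
  everywhere, so $\mathfrak{d} = 0$.

  Suppose conversely that $\mathfrak{d} = 0$.  Then $\xi'' = 1/\psi^2$ with $\psi$ affine and positive on $[0,1]$.
  On a gap between two contact points $\phi$ is affine, because $\mu$ charges only contact points, and
  $\phi \le \psi$ at the two ends because $g'' \ge 0$ there.  So $\phi \le \psi$ on the gap, $g$ is convex on it and vanishes at both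
  ends, and $g = 0$ throughout: there is no gap, and the contact set is an interval $[u,v]$.  On it $g'' = 0$,
  that is $\phi = \psi$ is affine, so $\mu$ does not charge $(u,v)$.

  Two pieces of measure theory support this.  A function in \<^const>\<open>X_space\<close> has a distributional second
  derivative by the Radon-Nikodym theorem (\<open>locally_lipschitz_density\<close>), and this derivative is unique
  because smooth bumps approximate indicators of intervals (\<open>distr_deriv2_unique\<close>).
\<close>

section \<open>Locally Lipschitz functions are integrals of locally bounded functions\<close>

lemma set_integrable_Icc_bounded:
  fixes g :: "real \<Rightarrow> real"
  assumes g: "g \<in> borel_measurable borel"
    and C: "AE s in lborel. s \<in> {a..b} \<longrightarrow> \<bar>g s\<bar> \<le> C"
  shows "set_integrable lborel {a..b} g"
proof (rule set_integrable_bound[where f="\<lambda>_. C"])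
  show "set_integrable lborel {a..b} (\<lambda>_. C)"
    by (rule borel_integrable_atLeastAtMost') simp
  show "set_borel_measurable lborel {a..b} g"
    unfolding set_borel_measurable_def using g by measurable
  show "AE x in lborel. x \<in> {a..b} \<longrightarrow> norm (g x) \<le> norm C"
    using C by (rule AE_mp) (auto intro!: AE_I2)
qed

text \<open>
  By Lebesgue's differentiation theorem, almost every value of an integrable function is a limit of
  averages over small intervals to the right of the point.
\<close>

lemma AE_zero_if_integrals_zero:
  fixes d :: "real \<Rightarrow> real"
  assumes d: "set_integrable lborel {a..b} d"
    and zero: "\<And>c e. a < c \<Longrightarrow> c < e \<Longrightarrow> e < b \<Longrightarrow> (LBINT s:{c..e}. d s) = 0"
  shows "AE s in lborel. s \<in> {a<..<b} \<longrightarrow> d s = 0"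
proof -
  define D where "D s = indicator {a..b} s *\<^sub>R d s" for s
  have D: "integrable lborel D" using d unfolding set_integrable_def D_def .
  then have "D integrable_on UNIV" by (rule integrable_on_lborel)
  then have "D integrable_on cbox c e" for c e
    by (rule integrable_on_subcbox) auto
  then obtain N where N: "negligible N"
    and lim: "\<And>x e. \<lbrakk>x \<notin> N; 0 < e\<rbrakk> \<Longrightarrow> \<exists>d>0. \<forall>h. 0 < h \<and> h < d \<longrightarrow>
               norm (integral (cbox x (x + h *\<^sub>R One)) D /\<^sub>R h ^ DIM(real) - D x) < e"
    by (rule integrable_ccontinuous_explicit) blast
  have *: "D x = 0" if x: "x \<notin> N" "a < x" "x < b" for x
  proof (rule ccontr)
    assume "D x \<noteq> 0"
    then obtain \<delta> where \<delta>: "\<delta> > 0" and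
      l: "\<And>h. 0 < h \<and> h < \<delta> \<Longrightarrow> norm (integral (cbox x (x + h *\<^sub>R One)) D /\<^sub>R h ^ DIM(real) - D x) < norm (D x)"
      using lim[OF x(1), of "norm (D x)"] by auto
    define h where "h = min (\<delta>/2) ((b-x)/2)"
    have h: "0 < h" "h < \<delta>" "x + h < b" using \<delta> x by (auto simp: h_def min_def field_simps)
    have "integral {x..x+h} D = (LBINT s:{x..x+h}. D s)"
      by (rule set_borel_integral_eq_integral(2)[symmetric], unfold set_integrable_def)
         (rule integrable_mult_indicator[OF _ D], simp)
    also have "\<dots> = (LBINT s:{x..x+h}. d s)"
      by (rule set_lebesgue_integral_cong) (use h x in \<open>auto simp: D_def\<close>)
    also have "\<dots> = 0" using zero[of x "x+h"] h x by auto
    finally show False using l[of h] h by simp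
  qed
  have "AE x in lebesgue. x \<notin> N" using N by (simp add: negligible_iff_null_sets AE_not_in)
  then have "AE x in lborel. x \<notin> N"
    using AE_completion_iff by blast
  then show ?thesis
    by (rule AE_mp) (auto intro!: AE_I2 dest: * simp: D_def)
qed

text \<open>
  If all slopes of \<open>f\<close> lie in $[0,1]$, then $x - f(x)$ is monotone too, and the two
  Stieltjes measures add up to Lebesgue measure because they do so on intervals.  This is
  how absolute continuity of the measure of \<open>f\<close> is obtained.
\<close>

lemma interval_measure_add_complement:
  fixes f :: "real \<Rightarrow> real"
  assumes mono: "\<And>x y. x \<le> y \<Longrightarrow> f x \<le> f y"
    and lip: "\<And>x y. x \<le> y \<Longrightarrow> f y - f x \<le> y - x"
    and A: "A \<in> sets borel"
  shows "emeasure (interval_measure f) A + emeasure (interval_measure (\<lambda>x. x - f x)) A = emeasure lborel A"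
proof -
  let ?N = "interval_measure f" and ?N' = "interval_measure (\<lambda>x. x - f x)"
  define M where "M = measure_of UNIV (sets borel) (\<lambda>A. emeasure ?N A + emeasure ?N' A)"
  have sM: "sets M = sets borel" unfolding M_def using sets.sigma_sets_eq[of "borel::real measure"]
    by (simp add: sets_measure_of_conv)
  have M: "emeasure M A = emeasure ?N A + emeasure ?N' A" if "A \<in> sets borel" for A
    unfolding M_def
  proof (rule emeasure_measure_of_sigma)
    show "sigma_algebra UNIV (sets (borel::real measure))"
      using sets.sigma_algebra_axioms[of "borel::real measure"] by simp
    show "positive (sets (borel::real measure)) (\<lambda>A. emeasure ?N A + emeasure ?N' A)"
      by (simp add: positive_def)
    show "countably_additive (sets (borel::real measure)) (\<lambda>A. emeasure ?N A + emeasure ?N' A)"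
    proof (rule countably_additiveI)
      fix B :: "nat \<Rightarrow> real set"
      assume B: "range B \<subseteq> sets borel" "disjoint_family B"
      show "(\<Sum>i. emeasure ?N (B i) + emeasure ?N' (B i)) = emeasure ?N (\<Union>(range B)) + emeasure ?N' (\<Union>(range B))"
        using suminf_emeasure[of B ?N] suminf_emeasure[of B ?N'] B
        by (subst suminf_add[symmetric]) auto
    qed
  qed (use that in auto)
  have lipf: "1-lipschitz_on UNIV f"
  proof (rule lipschitz_onI)
    fix x y :: real
    show "dist (f x) (f y) \<le> 1 * dist x y"
      using mono[of x y] lip[of x y] mono[of y x] lip[of y x] linear[of x y]
      unfolding dist_real_def by argo
  qed simp
  have cont: "continuous_on UNIV f" by (rule lipschitz_on_continuous_on[OF lipf])
  have "lborel = M"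
  proof (rule lborel_eqI)
    fix l u :: real
    assume "\<And>b. b \<in> Basis \<Longrightarrow> l \<bullet> b \<le> u \<bullet> b"
    then have lu: "l \<le> u" by simp
    have sub: "emeasure (interval_measure F) (box l u) = ennreal (F u - F l)"
      if F: "\<And>x y. x \<le> y \<Longrightarrow> F x \<le> F y" "continuous_on UNIV F" for F
    proof -
      have *: "emeasure (interval_measure F) {a..a} = 0" for a
        using emeasure_interval_measure_Icc[of a a F] F by simp
      then have "{l,u} \<in> null_sets (interval_measure F)"
        using null_sets.insert_in_sets by (metis (no_types) atLeastAtMost_singleton borel_singleton emeasure_insert_ne null_setsI null_sets.Un insert_is_Un sets.empty_sets sets_interval_measure)
      then have "emeasure (interval_measure F) (box l u \<union> {l,u}) = emeasure (interval_measure F) (box l u)"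
        by (intro emeasure_Un_null_set) auto
      moreover have "box l u \<union> {l,u} = {l..u}" using lu by auto
      ultimately show ?thesis using emeasure_interval_measure_Icc[of l u F] F lu by simp
    qed
    have "emeasure M (box l u) = ennreal (f u - f l) + ennreal ((u - f u) - (l - f l))"
    proof -
      have "emeasure ?N (box l u) = ennreal (f u - f l)"
        by (rule sub[OF mono cont])
      moreover have "emeasure ?N' (box l u) = ennreal ((u - f u) - (l - f l))"
      proof (rule sub)
        show "x - f x \<le> y - f y" if "x \<le> y" for x y using lip[OF that] by simp
        show "continuous_on UNIV (\<lambda>x. x - f x)" by (intro continuous_intros cont)
      qed
      ultimately show ?thesis by (subst M) simp_all
    qed
    also have "\<dots> = ennreal (u - l)"
      using mono[OF lu] lip[OF lu] by (subst ennreal_plus[symmetric]) auto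
    finally show "emeasure M (box l u) = ennreal (\<Prod>b\<in>Basis. (u - l) \<bullet> b)" by simp
  qed (simp add: sM)
  then show ?thesis using M[OF A] by simp
qed

text \<open>
  The density is the Radon-Nikodym derivative of the Stieltjes measure of \<open>f\<close>.  It is at most $1$
  because it and the density of the complementary measure sum to the density of Lebesgue measure.
\<close>

lemma slope_le_1_density:
  fixes f :: "real \<Rightarrow> real"
  assumes mono: "\<And>x y. x \<le> y \<Longrightarrow> f x \<le> f y"
    and lip: "\<And>x y. x \<le> y \<Longrightarrow> f y - f x \<le> y - x"
  shows "\<exists>g\<in>borel_measurable borel. (\<forall>x. 0 \<le> g x \<and> g x \<le> 1) \<and>
           (\<forall>a b. a \<le> b \<longrightarrow> f b - f a = (LBINT s:{a..b}. g s))"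
proof -
  let ?N = "interval_measure f" and ?N' = "interval_measure (\<lambda>x. x - f x)"
  note sum = interval_measure_add_complement[OF mono lip]
  have ac: "absolutely_continuous lborel ?N" "absolutely_continuous lborel ?N'"
    unfolding absolutely_continuous_def null_sets_def
    using sum by (auto simp: add_eq_0_iff_both_eq_0 simp del: add_is_0) (metis add_eq_0_iff_both_eq_0)+
  obtain u where u[measurable]: "u \<in> borel_measurable lborel" and Nu: "density lborel u = ?N"
    using sigma_finite_measure.Radon_Nikodym[OF sigma_finite_lborel ac(1)] by auto
  obtain v where v[measurable]: "v \<in> borel_measurable lborel" and Nv: "density lborel v = ?N'"
    using sigma_finite_measure.Radon_Nikodym[OF sigma_finite_lborel ac(2)] by auto
  have "density lborel (\<lambda>x. u x + v x) = density lborel (\<lambda>_. 1)"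
  proof (rule measure_eqI)
    fix A :: "real set" assume "A \<in> sets (density lborel (\<lambda>x. u x + v x))"
    then have A[measurable]: "A \<in> sets borel" by simp
    have "emeasure (density lborel (\<lambda>x. u x + v x)) A = emeasure (density lborel u) A + emeasure (density lborel v) A"
      by (simp add: emeasure_density distrib_right nn_integral_add)
    also have "\<dots> = emeasure lborel A" unfolding Nu Nv using sum A by simp
    finally show "emeasure (density lborel (\<lambda>x. u x + v x)) A = emeasure (density lborel (\<lambda>_. 1)) A"
      by (simp add: density_1)
  qed simp
  then have uv: "AE x in lborel. u x + v x = 1"
    by (subst (asm) sigma_finite_measure.density_unique_iff[OF sigma_finite_lborel]) auto
  define g where "g x = min 1 (enn2real (u x))" for x
  have ug: "AE x in lborel. u x = ennreal (g x)"
    using uv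
  proof (rule AE_mp, intro AE_I2 impI)
    fix x assume 1: "u x + v x = 1"
    then have "u x \<le> 1" by (metis le_iff_add)
    then show "u x = ennreal (g x)" unfolding g_def
      by (metis enn2real_leI ennreal_1 ennreal_enn2real_if ennreal_less_top min_absorb2 neq_top_trans order.strict_iff_order zero_le_one infinity_ennreal_def top.not_eq_extremum)
  qed
  have g: "g \<in> borel_measurable borel" unfolding g_def by measurable
  have cont: "continuous_on UNIV f"
  proof (rule lipschitz_on_continuous_on[of 1], rule lipschitz_onI)
    fix x y :: real
    show "dist (f x) (f y) \<le> 1 * dist x y"
      using mono[of x y] lip[of x y] mono[of y x] lip[of y x] linear[of x y]
      unfolding dist_real_def by argo
  qed simp
  have "f b - f a = (LBINT s:{a..b}. g s)" if "a \<le> b" for a b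
  proof -
    have "ennreal (f b - f a) = emeasure ?N {a..b}"
      using emeasure_interval_measure_Icc[of a b f] that mono cont by simp
    also have "\<dots> = (\<integral>\<^sup>+x. u x * indicator {a..b} x \<partial>lborel)"
      unfolding Nu[symmetric] by (simp add: emeasure_density)
    also have "\<dots> = (\<integral>\<^sup>+x. ennreal (indicator {a..b} x *\<^sub>R g x) \<partial>lborel)"
      by (rule nn_integral_cong_AE) (use ug in \<open>rule AE_mp, auto intro!: AE_I2 split: split_indicator\<close>)
    finally have *: "(\<integral>\<^sup>+x. ennreal (indicator {a..b} x *\<^sub>R g x) \<partial>lborel) = ennreal (f b - f a)" ..
    have "(LBINT s:{a..b}. g s) = enn2real (ennreal (f b - f a))"
      unfolding set_lebesgue_integral_def *[symmetric]
      by (rule integral_eq_nn_integral) (use g in \<open>auto simp: g_def\<close>)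
    then show ?thesis using mono[OF that] by simp
  qed
  then show ?thesis using g by (intro bexI[of _ g]) (auto simp: g_def)
qed

text \<open>
  An affine change of variables makes the slopes lie in $[0,1]$.  The constant $L + 1$
  serves as a positive Lipschitz constant even when $L = 0$.
\<close>

lemma lipschitz_density:
  fixes f :: "real \<Rightarrow> real"
  assumes "L-lipschitz_on UNIV f"
  shows "\<exists>g\<in>borel_measurable borel. (\<forall>x. \<bar>g x\<bar> \<le> L + 1) \<and>
           (\<forall>a b. a \<le> b \<longrightarrow> f b - f a = (LBINT s:{a..b}. g s))"
proof -
  define K where "K = L + 1"
  have L: "L \<ge> 0" using assms by (rule lipschitz_on_nonneg)
  have K: "K > 0" using L by (simp add: K_def)
  have lip: "\<bar>f y - f x\<bar> \<le> K * (y - x)" if "x \<le> y" for x y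
  proof -
    have "\<bar>f y - f x\<bar> \<le> L * (y - x)"
      using lipschitz_onD[OF assms, of y x] that by (simp add: dist_real_def)
    also have "\<dots> \<le> K * (y-x)" using that by (simp add: K_def algebra_simps)
    finally show ?thesis .
  qed
  define F where "F x = (f x + K * x) / (2 * K)" for x
  have "\<exists>g\<in>borel_measurable borel. (\<forall>x. 0 \<le> g x \<and> g x \<le> 1) \<and>
           (\<forall>a b. a \<le> b \<longrightarrow> F b - F a = (LBINT s:{a..b}. g s))"
  proof (rule slope_le_1_density)
    fix x y :: real assume "x \<le> y"
    have "F y - F x = ((f y - f x) + K * (y - x)) / (2 * K)"
      by (simp add: F_def diff_divide_distrib[symmetric] algebra_simps)
    moreover have "((f y - f x) + K * (y - x)) / (2 * K) \<ge> 0"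
      using lip[OF \<open>x \<le> y\<close>] K by (intro divide_nonneg_pos) auto
    moreover have "((f y - f x) + K * (y - x)) / (2 * K) \<le> y - x"
      using lip[OF \<open>x \<le> y\<close>] K by (simp add: divide_le_eq)
    ultimately show "F x \<le> F y" "F y - F x \<le> y - x" by simp_all
  qed
  then obtain g where g[measurable]: "g \<in> borel_measurable borel" and b: "\<And>x. 0 \<le> g x" "\<And>x. g x \<le> 1"
    and F: "\<And>a b. a \<le> b \<Longrightarrow> F b - F a = (LBINT s:{a..b}. g s)" by auto
  have int: "set_integrable lborel {a..b} g" for a b
    by (rule set_integrable_Icc_bounded[where C=1]) (use b in auto)
  show ?thesis
  proof (intro bexI[of _ "\<lambda>x. 2 * K * g x - K"] conjI allI impI)
    show "\<bar>2 * K * g x - K\<bar> \<le> L + 1" for x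
      unfolding K_def[symmetric] using b[of x] K mult_left_mono[OF b(2)[of x], of K]
      by (auto simp: abs_le_iff mult_nonneg_nonneg algebra_simps)
    fix a b :: real assume ab: "a \<le> b"
    have "(LBINT s:{a..b}. 2 * K * g s - K) = 2 * K * (LBINT s:{a..b}. g s) - (LBINT s:{a..b}. K)"
      by (subst set_integral_diff) (use int in \<open>auto intro!: borel_integrable_atLeastAtMost'\<close>)
    also have "\<dots> = 2 * K * (F b - F a) - K * (b - a)"
      unfolding F[OF ab] by (simp add: set_lebesgue_integral_def ab)
    also have "\<dots> = f b - f a" using K by (simp add: F_def field_simps)
    finally show "f b - f a = (LBINT s:{a..b}. 2 * K * g s - K)" ..
  qed measurable
qed

text \<open>
  On each compact interval $[0, c_n]$ the function is Lipschitz and has a density.  These densities agree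
  almost everywhere on common intervals, since their integrals do, and so they glue together.
\<close>

lemma locally_lipschitz_density:
  fixes f :: "real \<Rightarrow> real"
  assumes "local_lipschitz {0::real} {0..<1} (\<lambda>_. f)"
  shows "\<exists>g\<in>borel_measurable borel.
           (\<forall>\<delta>>0. \<exists>C. AE s in lborel. s \<in> {0..1 - \<delta>} \<longrightarrow> \<bar>g s\<bar> \<le> C) \<and>
           (\<forall>a b. 0 \<le> a \<longrightarrow> a \<le> b \<longrightarrow> b < 1 \<longrightarrow> f b - f a = (LBINT s:{a..b}. g s))"
proof -
  define c where "c n = 1 - 1 / (real n + 2)" for n :: nat
  have c01: "0 < c n" "c n < 1" for n by (auto simp: c_def field_simps)
  have c_mono: "c m \<le> c n" if "m \<le> n" for m n
    using that by (auto simp: c_def frac_le)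
  have c_ex: "\<exists>n. b < c n" if "b < 1" for b
  proof -
    obtain n where "1 / (1 - b) < real n" using reals_Archimedean2 by blast
    then have "1 / (1 - b) < real n + 2" by linarith
    then have "b < c n" using that by (simp add: c_def field_simps)
    then show ?thesis ..
  qed
  have "\<exists>g L. g \<in> borel_measurable borel \<and> (\<forall>x. \<bar>g x\<bar> \<le> L) \<and>
           (\<forall>a b. 0 \<le> a \<longrightarrow> a \<le> b \<longrightarrow> b \<le> c n \<longrightarrow> f b - f a = (LBINT s:{a..b}. g s))" for n
  proof -
    have ll: "local_lipschitz {0::real} {0..c n} (\<lambda>_. f)"
      by (rule local_lipschitz_subset[OF assms]) (use c01[of n] in auto)
    obtain L where L: "L-lipschitz_on {0..c n} f"
      by (rule local_lipschitz_compact_implies_lipschitz[OF ll]) (auto simp: that)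
    define F where "F x = f (min (max x 0) (c n))" for x
    have "L-lipschitz_on UNIV F"
    proof (rule lipschitz_onI)
      fix x y :: real
      have "dist (F x) (F y) \<le> L * dist (min (max x 0) (c n)) (min (max y 0) (c n))"
        unfolding F_def by (rule lipschitz_onD[OF L]) (use c01[of n] in auto)
      also have "\<dots> \<le> L * dist x y"
        by (rule mult_left_mono) (use lipschitz_on_nonneg[OF L] in \<open>auto simp: dist_real_def\<close>)
      finally show "dist (F x) (F y) \<le> L * dist x y" .
    qed (rule lipschitz_on_nonneg[OF L])
    from lipschitz_density[OF this] obtain g where
      g: "g\<in>borel_measurable borel" "\<forall>x. \<bar>g x\<bar> \<le> L + 1"
         "\<And>a b. a \<le> b \<Longrightarrow> F b - F a = (LBINT s:{a..b}. g s)" by auto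
    have "f b - f a = (LBINT s:{a..b}. g s)" if "0 \<le> a" "a \<le> b" "b \<le> c n" for a b
      using g(3)[OF that(2)] that by (simp add: F_def)
    then show ?thesis using g by blast
  qed
  then obtain G K where G[measurable]: "\<And>n. G n \<in> borel_measurable borel"
    and K: "\<And>n x. \<bar>G n x\<bar> \<le> K n"
    and Gf: "\<And>n a b. 0 \<le> a \<Longrightarrow> a \<le> b \<Longrightarrow> b \<le> c n \<Longrightarrow> f b - f a = (LBINT s:{a..b}. G n s)"
    by metis
  have int: "set_integrable lborel {a..b} (G n)" for a b n
    by (rule set_integrable_Icc_bounded[where C="K n"]) (use K in auto)
  have compat: "AE s in lborel. s \<in> {0<..<c m} \<longrightarrow> G m s - G n s = 0" if "m \<le> n" for m n
  proof (rule AE_zero_if_integrals_zero)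
    show "set_integrable lborel {0..c m} (\<lambda>s. G m s - G n s)"
      by (rule set_integral_diff) (rule int)+
    fix a e assume ae: "0 < a" "a < e" "e < c m"
    then show "(LBINT s:{a..e}. G m s - G n s) = 0"
      using Gf[of a e m] Gf[of a e n] c_mono[OF that]
      by (subst set_integral_diff) (auto simp: int)
  qed
  have compat: "AE s in lborel. \<forall>m n. m \<le> n \<longrightarrow> 0 < s \<longrightarrow> s < c m \<longrightarrow> G m s = G n s"
    unfolding AE_all_countable
  proof (intro allI)
    fix m n
    show "AE s in lborel. m \<le> n \<longrightarrow> 0 < s \<longrightarrow> s < c m \<longrightarrow> G m s = G n s"
      by (cases "m \<le> n") (use compat[of m n] in auto)
  qed
  define N where "N s = (LEAST n. s < c n)" for s :: real
  define g where "g s = G (N s) s" for s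
  have N[measurable]: "N \<in> borel \<rightarrow>\<^sub>M count_space UNIV" unfolding N_def by measurable
  have g[measurable]: "g \<in> borel_measurable borel" unfolding g_def
    by (rule measurable_compose_countable[OF _ N]) measurable
  have gG: "AE s in lborel. s \<in> {0..b} \<longrightarrow> g s = G n s" if b: "b < c n" for b n
  proof -
    have "AE s in lborel. s \<noteq> (0::real)" by (rule AE_lborel_singleton)
    with compat show ?thesis
    proof eventually_elim
      case (elim s)
      show ?case
      proof
        assume "s \<in> {0..b}"
        then have s: "0 < s" "s < c n" using elim b by auto
        then have "N s \<le> n" "s < c (N s)" unfolding N_def
          by (auto intro: Least_le LeastI)
        then show "g s = G n s" using elim(1) s(1) unfolding g_def by blast
      qed
    qed
  qed
  show ?thesis
  proof (intro bexI[OF _ g] conjI allI impI)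
    fix \<delta> :: real assume "\<delta> > 0"
    then obtain n where n: "1 - \<delta> < c n" using c_ex[of "1-\<delta>"] by auto
    show "\<exists>C. AE s in lborel. s \<in> {0..1 - \<delta>} \<longrightarrow> \<bar>g s\<bar> \<le> C"
      by (rule exI[of _ "K n"]) (use gG[OF n] in eventually_elim, use K in auto)
  next
    fix a b :: real assume ab: "0 \<le> a" "a \<le> b" "b < 1"
    obtain n where n: "b < c n" using c_ex ab by blast
    have "(LBINT s:{a..b}. g s) = (LBINT s:{a..b}. G n s)"
      by (rule set_lebesgue_integral_cong_AE)
         (use ab in \<open>auto intro!: eventually_mono[OF gG[OF n]]\<close>)
    then show "f b - f a = (LBINT s:{a..b}. g s)" using Gf[of a b n] ab n by simp
  qed
qed

section \<open>Exchanging integrals\<close>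

lemma integrable_pair_product:
  fixes u :: "'a \<Rightarrow> real" and v :: "'b \<Rightarrow> real"
  assumes "pair_sigma_finite M1 M2" and u: "integrable M1 u" and v: "integrable M2 v"
  shows "integrable (M1 \<Otimes>\<^sub>M M2) (\<lambda>(x,y). u x * v y)"
proof -
  interpret pair_sigma_finite M1 M2 by fact
  have [measurable]: "u \<in> borel_measurable M1" "v \<in> borel_measurable M2"
    using u v by auto
  show ?thesis
    by (rule Fubini_integrable) (use u v in \<open>auto simp: abs_mult\<close>)
qed

lemma Fubini_dominated:
  fixes f :: "'a \<Rightarrow> 'b \<Rightarrow> real" and u :: "'a \<Rightarrow> real" and v :: "'b \<Rightarrow> real"
  assumes ps: "pair_sigma_finite M1 M2" and u: "integrable M1 u" and v: "integrable M2 v"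
    and f: "case_prod f \<in> borel_measurable (M1 \<Otimes>\<^sub>M M2)"
    and b: "\<And>x y. x \<in> space M1 \<Longrightarrow> y \<in> space M2 \<Longrightarrow> \<bar>f x y\<bar> \<le> \<bar>u x\<bar> * \<bar>v y\<bar>"
  shows "(\<integral>y. (\<integral>x. f x y \<partial>M1) \<partial>M2) = (\<integral>x. (\<integral>y. f x y \<partial>M2) \<partial>M1)"
    and "integrable M2 (\<lambda>y. \<integral>x. f x y \<partial>M1)" and "integrable M1 (\<lambda>x. \<integral>y. f x y \<partial>M2)"
proof -
  interpret pair_sigma_finite M1 M2 by fact
  have i: "integrable (M1 \<Otimes>\<^sub>M M2) (case_prod f)"
    by (rule Bochner_Integration.integrable_bound[OF integrable_pair_product[OF ps u v] f])
       (use b in \<open>auto intro!: AE_I2 simp: space_pair_measure abs_mult\<close>)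
  from Fubini_integral[OF i] integrable_snd[OF i] integrable_fst[OF i]
  show "(\<integral>y. (\<integral>x. f x y \<partial>M1) \<partial>M2) = (\<integral>x. (\<integral>y. f x y \<partial>M2) \<partial>M1)"
    and "integrable M2 (\<lambda>y. \<integral>x. f x y \<partial>M1)" and "integrable M1 (\<lambda>x. \<integral>y. f x y \<partial>M2)"
    by auto
qed

lemma pair_sigma_finite_lborel: "pair_sigma_finite lborel lborel" ..

text \<open>
  Fubini's theorem on the triangle $a \le s \le t \le b$.  It serves as integration by parts for the
  primitive of a function that is merely integrable.
\<close>

lemma Fubini_triangle:
  fixes g k :: "real \<Rightarrow> real"
  assumes k: "set_integrable lborel {a..b} k" and g: "set_integrable lborel {a..b} g"
  shows "(LBINT t:{a..b}. k t * (LBINT s:{a..t}. g s)) = (LBINT s:{a..b}. g s * (LBINT t:{s..b}. k t))"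
proof -
  define K where "K t = indicator {a..b} t * k t" for t
  define G where "G t = indicator {a..b} t * g t" for t
  have K: "integrable lborel K" and G: "integrable lborel G"
    using k g by (auto simp: set_integrable_def K_def[abs_def] G_def[abs_def])
  have [measurable]: "K \<in> borel_measurable borel" "G \<in> borel_measurable borel"
    using K G by auto
  define f where "f s t = K t * (G s * indicator {(s,t). s \<le> t} (s,t))" for s t
  have "(LBINT t. (LBINT s. f s t)) = (LBINT s. (LBINT t. f s t))"
  proof (rule Fubini_dominated(1)[OF pair_sigma_finite_lborel G K])
    show "case_prod f \<in> borel_measurable (lborel \<Otimes>\<^sub>M lborel)"
      unfolding f_def by measurable
    show "\<bar>f s t\<bar> \<le> \<bar>G s\<bar> * \<bar>K t\<bar>" for s t
      unfolding f_def by (auto simp: abs_mult mult_ac split: split_indicator)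
  qed
  moreover have "(LBINT s. f s t) = indicator {a..b} t *\<^sub>R (k t * (LBINT s:{a..t}. g s))" for t
  proof -
    have "(LBINT s. f s t) = (LBINT s. K t * (indicator {..t} s * G s))"
      by (rule Bochner_Integration.integral_cong) (auto simp: f_def split: split_indicator)
    also have "\<dots> = K t * (LBINT s. (indicator {..t} s * G s))" by simp
    also have "\<dots> = indicator {a..b} t *\<^sub>R (k t * (LBINT s:{a..t}. g s))"
      unfolding K_def G_def set_lebesgue_integral_def
      by (auto simp: intro!: Bochner_Integration.integral_cong split: split_indicator)
    finally show ?thesis .
  qed
  moreover have "(LBINT t. f s t) = indicator {a..b} s *\<^sub>R (g s * (LBINT t:{s..b}. k t))" for s
  proof -
    have "(LBINT t. f s t) = (LBINT t. G s * (indicator {s..} t * K t))"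
      by (rule Bochner_Integration.integral_cong) (auto simp: f_def split: split_indicator)
    also have "\<dots> = G s * (LBINT t. (indicator {s..} t * K t))" by simp
    also have "\<dots> = indicator {a..b} s *\<^sub>R (g s * (LBINT t:{s..b}. k t))"
      unfolding K_def G_def set_lebesgue_integral_def
      by (auto simp: intro!: Bochner_Integration.integral_cong split: split_indicator)
    finally show ?thesis .
  qed
  ultimately show ?thesis by (simp add: set_lebesgue_integral_def)
qed

section \<open>Smooth bumps that approximate indicators of intervals\<close>

text \<open>
  The coefficient of the exponential is a polynomial in $1/x$, so that this class of functions
  is closed under differentiation; $p = 1$ gives the standard smooth function that is
  flat at $0$.
\<close>

definition flat :: "real poly \<Rightarrow> real \<Rightarrow> real" where
  "flat p x = (if x \<le> 0 then 0 else poly p (1 / x) * exp (- 1 / x))"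

lemma poly_exp_decay: "((\<lambda>y. poly p y * exp (- y)) \<longlongrightarrow> (0::real)) at_top"
proof -
  have "((\<lambda>y. \<Sum>i\<le>degree p. coeff p i * (y ^ i / exp y)) \<longlongrightarrow> (\<Sum>i\<le>degree p. coeff p i * 0)) at_top"
    by (intro tendsto_intros tendsto_power_div_exp_0)
  then show ?thesis
    by (simp add: poly_altdef exp_minus sum_distrib_left divide_inverse mult_ac)
qed

lemma flat_has_derivative:
  "(flat p has_real_derivative flat ([:0,0,1:] * (p - pderiv p)) x) (at x)"
proof -
  consider "x < 0" | "x = 0" | "x > 0" by linarith
  then show ?thesis
  proof cases
    case 1
    have "((\<lambda>_. 0) has_real_derivative 0) (at x)" by simp
    then have "(flat p has_real_derivative 0) (at x)"
      by (rule has_field_derivative_transform_within_open[where S="{..<0}"])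
         (use 1 in \<open>auto simp: flat_def\<close>)
    then show ?thesis using 1 by (simp add: flat_def)
  next
    case 3
    have "((\<lambda>x. poly p (1 / x) * exp (- 1 / x)) has_real_derivative
        (poly (pderiv p) (1/x) * (- 1 / x\<^sup>2)) * exp (- 1 / x) + (exp (- 1 / x) * (1 / x\<^sup>2)) * poly p (1 / x)) (at x)"
      by (rule DERIV_mult; (rule DERIV_chain2[where f="poly p"] poly_DERIV | rule DERIV_chain2[where f=exp] DERIV_exp)+;
          use 3 in \<open>auto intro!: derivative_eq_intros simp: power2_eq_square\<close>)
    then have "(flat p has_real_derivative
        (poly (pderiv p) (1/x) * (- 1 / x\<^sup>2)) * exp (- 1 / x) + (exp (- 1 / x) * (1 / x\<^sup>2)) * poly p (1 / x)) (at x)"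
      by (rule has_field_derivative_transform_within_open[where S="{0<..}"])
         (use 3 in \<open>auto simp: flat_def\<close>)
    also have "(poly (pderiv p) (1/x) * (- 1 / x\<^sup>2)) * exp (- 1 / x) + (exp (- 1 / x) * (1 / x\<^sup>2)) * poly p (1 / x)
       = flat ([:0,0,1:] * (p - pderiv p)) x"
      using 3 by (simp add: flat_def power2_eq_square divide_simps) (simp add: algebra_simps)
    finally show ?thesis .
  next
    case 2
    have "((\<lambda>h. flat p h / h) \<longlongrightarrow> 0) (at_right 0)"
    proof (rule Lim_transform_eventually)
      show "((\<lambda>h. poly (pCons 0 p) (inverse h) * exp (- inverse h)) \<longlongrightarrow> (0::real)) (at_right 0)"
        by (rule filterlim_compose[OF poly_exp_decay filterlim_inverse_at_top_right])
      show "\<forall>\<^sub>F h in at_right 0. poly (pCons 0 p) (inverse h) * exp (- inverse h) = flat p h / h"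
        using eventually_at_right_less[of 0]
        by eventually_elim (auto simp: flat_def divide_simps)
    qed
    moreover have "((\<lambda>h. flat p h / h) \<longlongrightarrow> 0) (at_left 0)"
      by (rule Lim_transform_eventually[where f="\<lambda>_. 0"])
         (auto simp: flat_def eventually_at_filter)
    ultimately have "((\<lambda>h. flat p h / h) \<longlongrightarrow> 0) (at 0)"
      by (simp add: filterlim_split_at)
    then show ?thesis using 2 by (simp add: DERIV_def flat_def)
  qed
qed

text \<open>
  Differentiation leaves this family invariant, so all its members are smooth.
\<close>

inductive bump_family :: "real \<Rightarrow> real \<Rightarrow> real \<Rightarrow> (real \<Rightarrow> real) \<Rightarrow> bool" for n a b where
  prod: "bump_family n a b (\<lambda>x. c * (flat p (n * (x - a)) * flat q (n * (b - x))))"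
| add: "bump_family n a b F \<Longrightarrow> bump_family n a b G \<Longrightarrow> bump_family n a b (\<lambda>x. F x + G x)"

lemma bump_family_deriv:
  assumes "bump_family n a b F"
  shows "\<exists>F'. bump_family n a b F' \<and> (\<forall>x. (F has_real_derivative F' x) (at x))"
  using assms
proof induction
  case (prod c p q)
  define D where "D r = [:0,0,1:] * (r - pderiv r)" for r :: "real poly"
  let ?F = "\<lambda>x. (c*n) * (flat (D p) (n * (x - a)) * flat q (n * (b - x)))
               + (-c*n) * (flat p (n * (x - a)) * flat (D q) (n * (b - x)))"
  have "bump_family n a b ?F" by (intro bump_family.intros)
  moreover have "((\<lambda>x. c * (flat p (n * (x - a)) * flat q (n * (b - x)))) has_real_derivative ?F x) (at x)" for x
    by (rule derivative_eq_intros DERIV_chain2[OF flat_has_derivative] refl | simp)+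
       (simp add: algebra_simps D_def)
  ultimately show ?case by blast
next
  case (add F G)
  then obtain F' G' where "bump_family n a b F'" "\<forall>x. (F has_real_derivative F' x) (at x)"
     "bump_family n a b G'" "\<forall>x. (G has_real_derivative G' x) (at x)" by auto
  then show ?case by (intro exI[of _ "\<lambda>x. F' x + G' x"]) (auto intro: bump_family.add DERIV_add)
qed

lemma bump_family_higher_deriv: "bump_family n a b F \<Longrightarrow> bump_family n a b ((deriv ^^ k) F)"
proof (induction k)
  case (Suc k)
  then obtain F' where F': "bump_family n a b F'" "\<forall>x. ((deriv ^^ k) F has_real_derivative F' x) (at x)"
    using bump_family_deriv by blast
  then have "deriv ((deriv ^^ k) F) = F'" by (auto intro: DERIV_imp_deriv)
  then show ?case using F' by simp
qed simp

text \<open>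
  Since $e^{-1/(n y)}$ tends to $1$ for every $y > 0$, dilating the two factors makes the product tend to
  the indicator of the open interval, within a fixed support.
\<close>

definition bump :: "real \<Rightarrow> real \<Rightarrow> nat \<Rightarrow> real \<Rightarrow> real" where
  "bump a b n x = flat 1 (real (Suc n) * (x - a)) * flat 1 (real (Suc n) * (b - x))"

lemma bump_test_function:
  assumes "0 < a" "b < 1"
  shows "bump a b n \<in> test_functions"
proof -
  have "bump_family (real (Suc n)) a b (\<lambda>x. 1 * (flat 1 (real (Suc n) * (x - a)) * flat 1 (real (Suc n) * (b - x))))"
    by (rule bump_family.prod)
  then have "bump_family (real (Suc n)) a b (bump a b n)"
    by (simp add: bump_def[abs_def])
  then have "(deriv ^^ k) (bump a b n) field_differentiable at x" for k x
    using bump_family_deriv[OF bump_family_higher_deriv] field_differentiable_def by blast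
  moreover have "bump a b n x = 0" if "x \<notin> {a..b}" for x
    using that by (auto simp: bump_def flat_def mult_le_0_iff)
  ultimately show ?thesis unfolding test_functions_def
    using assms by (intro CollectI conjI allI exI[of _ "{a..b}"]) auto
qed

lemma bump_bounds: "0 \<le> bump a b n x" "bump a b n x \<le> indicator {a..b} x"
proof -
  have f: "0 \<le> flat 1 y" "flat 1 y \<le> 1" for y by (auto simp: flat_def)
  show "0 \<le> bump a b n x" by (simp add: bump_def f)
  show "bump a b n x \<le> indicator {a..b} x"
  proof (cases "x \<in> {a..b}")
    case True then show ?thesis by (simp add: bump_def f mult_le_one)
  next
    case False then show ?thesis by (auto simp: bump_def flat_def mult_le_0_iff)
  qed
qed

lemma bump_tendsto: "(\<lambda>n. bump a b n x) \<longlonglongrightarrow> indicator {a<..<b} x"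
proof (cases "x \<in> {a<..<b}")
  case True
  have *: "(\<lambda>n. exp (- 1 / (real (Suc n) * y))) \<longlonglongrightarrow> exp 0" if "y > 0" for y
  proof (rule tendsto_exp)
    have "(\<lambda>n. (- 1 / y) * inverse (real (Suc n))) \<longlonglongrightarrow> (-1/y) * 0"
      by (intro tendsto_intros LIMSEQ_inverse_real_of_nat)
    then show "(\<lambda>n. - 1 / (real (Suc n) * y)) \<longlonglongrightarrow> 0" by (simp add: divide_simps mult_ac)
  qed
  have "(\<lambda>n. exp (- 1 / (real (Suc n) * (x - a))) * exp (- 1 / (real (Suc n) * (b - x)))) \<longlonglongrightarrow> exp 0 * exp 0"
    by (intro tendsto_mult *) (use True in auto)
  moreover have "bump a b n x = exp (- 1 / (real (Suc n) * (x - a))) * exp (- 1 / (real (Suc n) * (b - x)))" for n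
    using True by (auto simp: bump_def flat_def mult_le_0_iff)
  ultimately show ?thesis using True by simp
next
  case False
  then have "bump a b n x = 0" for n by (auto simp: bump_def flat_def mult_le_0_iff)
  with False show ?thesis by simp
qed

section \<open>Second distributional derivatives\<close>

lemma LBINT_FTC:
  fixes F f :: "real \<Rightarrow> real"
  assumes "a \<le> b" "\<And>x. a \<le> x \<Longrightarrow> x \<le> b \<Longrightarrow> (F has_real_derivative f x) (at x within {a..b})"
    and "continuous_on {a..b} f"
  shows "(LBINT x:{a..b}. f x) = F b - F a"
  unfolding set_lebesgue_integral_def
  by (rule integral_FTC_atLeastAtMost)
     (use assms in \<open>auto simp: has_real_derivative_iff_has_vector_derivative\<close>)

lemma bump_integral_tendsto:
  assumes g: "set_integrable lborel {a..b} g" and "0 < a" "b < 1"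
    and [measurable]: "g \<in> borel_measurable borel"
  shows "(\<lambda>n. LBINT s:{0<..<1}. g s * bump a b n s) \<longlonglongrightarrow> (LBINT s:{a..b}. g s)"
proof -
  have [measurable]: "bump a b n \<in> borel_measurable borel" for n
    unfolding bump_def[abs_def] flat_def poly_1 by measurable
  have "(\<lambda>n. LBINT s. indicator {0<..<1} s *\<^sub>R (g s * bump a b n s)) \<longlonglongrightarrow> (LBINT s. indicator {a<..<b} s *\<^sub>R g s)"
  proof (rule integral_dominated_convergence)
    show "integrable lborel (\<lambda>s. \<bar>indicator {a..b} s *\<^sub>R g s\<bar>)"
      using g unfolding set_integrable_def by (rule integrable_abs)
    show "AE s in lborel. (\<lambda>n. indicator {0<..<1} s *\<^sub>R (g s * bump a b n s)) \<longlonglongrightarrow> indicator {a<..<b} s *\<^sub>R g s"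
    proof (rule AE_I2)
      fix s :: real
      have "(\<lambda>n. indicator {0<..<1} s *\<^sub>R (g s * bump a b n s)) \<longlonglongrightarrow>
         indicator {0<..<1} s *\<^sub>R (g s * indicator {a<..<b} s)"
        by (intro tendsto_intros bump_tendsto)
      also have "indicator {0<..<1} s *\<^sub>R (g s * indicator {a<..<b} s) = indicator {a<..<b} s *\<^sub>R g s"
        using assms by (auto split: split_indicator)
      finally show "(\<lambda>n. indicator {0<..<1} s *\<^sub>R (g s * bump a b n s)) \<longlonglongrightarrow> indicator {a<..<b} s *\<^sub>R g s" .
    qed
    show "AE s in lborel. norm (indicator {0<..<1} s *\<^sub>R (g s * bump a b n s)) \<le> \<bar>indicator {a..b} s *\<^sub>R g s\<bar>" for n
    proof (rule AE_I2)
      fix s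
      have "\<bar>bump a b n s\<bar> \<le> indicator {a..b} s"
        using bump_bounds[of a b n s] by simp
      then have "\<bar>g s\<bar> * \<bar>bump a b n s\<bar> \<le> \<bar>g s\<bar> * indicator {a..b} s"
        by (rule mult_left_mono) simp
      then show "norm (indicator {0<..<1} s *\<^sub>R (g s * bump a b n s)) \<le> \<bar>indicator {a..b} s *\<^sub>R g s\<bar>"
        by (auto simp: abs_mult mult_ac split: split_indicator)
    qed
  qed measurable
  also have "(LBINT s. indicator {a<..<b} s *\<^sub>R g s) = (LBINT s. indicator {a..b} s *\<^sub>R g s)"
  proof (rule integral_cong_AE)
    have "AE s in lborel. s \<noteq> a" "AE s in lborel. s \<noteq> b" by (rule AE_lborel_singleton)+
    then show "AE s in lborel. indicator {a<..<b} s *\<^sub>R g s = indicator {a..b} s *\<^sub>R g s"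
      by eventually_elim (auto split: split_indicator)
  qed measurable
  finally show ?thesis unfolding set_lebesgue_integral_def .
qed

lemma is_distr_deriv2_set_integrable:
  assumes "is_distr_deriv2 \<eta> g" "0 \<le> a" "b < 1"
  shows "set_integrable lborel {a..b} g"
proof -
  obtain C where C: "AE s in lborel. s \<in> {0..1 - (1 - b)} \<longrightarrow> \<bar>g s\<bar> \<le> C"
    and g: "g \<in> borel_measurable borel"
    using assms unfolding is_distr_deriv2_def by (metis diff_gt_0_iff_gt)
  show ?thesis
    by (rule set_integrable_Icc_bounded[OF g, where C=C])
       (use C assms in \<open>auto elim!: eventually_mono\<close>)
qed

text \<open>
  Testing with bumps and passing to the limit, two candidates have the same integral over every
  compact subinterval of $(0,1)$.
\<close>

lemma distr_deriv2_unique: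
  assumes "is_distr_deriv2 \<eta> g1" "is_distr_deriv2 \<eta> g2"
  shows "AE s in lborel. s \<in> {0..<1} \<longrightarrow> g1 s = g2 s"
proof -
  have g1[measurable]: "g1 \<in> borel_measurable borel" and g2[measurable]: "g2 \<in> borel_measurable borel"
    using assms by (auto simp: is_distr_deriv2_def)
  have "AE s in lborel. \<forall>n::nat. s \<in> {0<..<1 - 1 / real (Suc n)} \<longrightarrow> g1 s - g2 s = 0"
    unfolding AE_all_countable
  proof
    fix n
    let ?c = "1 - 1 / real (Suc n)"
    have c: "?c < 1" by simp
    show "AE s in lborel. s \<in> {0<..<?c} \<longrightarrow> g1 s - g2 s = 0"
    proof (rule AE_zero_if_integrals_zero)
      show "set_integrable lborel {0..?c} (\<lambda>s. g1 s - g2 s)"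
        by (intro set_integral_diff is_distr_deriv2_set_integrable[OF assms(1) order_refl c] is_distr_deriv2_set_integrable[OF assms(2) order_refl c])
      fix p q assume pq: "0 < p" "p < q" "q < ?c"
      then have q1: "q < 1" using c by linarith
      have p0: "0 \<le> p" using pq by simp
      note i = is_distr_deriv2_set_integrable[OF assms(1) p0 q1] is_distr_deriv2_set_integrable[OF assms(2) p0 q1]
      have eq: "(LBINT s:{0<..<1}. g1 s * bump p q n s) = (LBINT s:{0<..<1}. g2 s * bump p q n s)" for n
        using assms bump_test_function[OF pq(1) q1, of n] unfolding is_distr_deriv2_def by metis
      have "(LBINT s:{p..q}. g1 s) = (LBINT s:{p..q}. g2 s)"
        by (rule LIMSEQ_unique[OF bump_integral_tendsto[OF i(1) pq(1) q1 g1, unfolded eq] bump_integral_tendsto[OF i(2) pq(1) q1 g2]])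
      then show "(LBINT s:{p..q}. g1 s - g2 s) = 0"
        using i pq by (subst set_integral_diff) auto
    qed
  qed
  moreover have "AE s in lborel. s \<noteq> (0::real)" by (rule AE_lborel_singleton)
  ultimately show ?thesis
  proof eventually_elim
    case (elim s)
    show ?case
    proof
      assume s: "s \<in> {0..<1}"
      obtain n where "1 / (1 - s) < real n" using reals_Archimedean2 by blast
      then have "1 / (1 - s) < real (Suc n)" by simp
      then have "s < 1 - 1 / real (Suc n)" using s by (simp add: field_simps)
      then show "g1 s = g2 s" using elim s by (auto dest!: spec[of _ n])
    qed
  qed
qed

text \<open>
  Two integrations by parts move the derivatives from the test function to $\eta$: the first is
  classical, the second exchanges integrals because \<open>g\<close> need not be continuous.
\<close>

lemma is_distr_deriv2I:
  assumes g[measurable]: "g \<in> borel_measurable borel"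
    and bounded: "\<And>\<delta>. \<delta> > 0 \<Longrightarrow> \<exists>C. AE s in lborel. s \<in> {0..1 - \<delta>} \<longrightarrow> \<bar>g s\<bar> \<le> C"
    and deriv: "\<And>s. s \<in> {0..<1} \<Longrightarrow> (\<eta> has_real_derivative e s) (at s within {0..<1})"
    and cont: "continuous_on {0..<1} e"
    and rep: "\<And>a b. 0 \<le> a \<Longrightarrow> a \<le> b \<Longrightarrow> b < 1 \<Longrightarrow> e b - e a = (LBINT s:{a..b}. g s)"
  shows "is_distr_deriv2 \<eta> g"
  unfolding is_distr_deriv2_def
proof (intro conjI allI impI ballI)
  fix \<psi> assume "\<psi> \<in> test_functions"
  then obtain K where smooth: "\<And>k x. (deriv ^^ k) \<psi> field_differentiable at x"
    and K: "compact K" "K \<subseteq> {0<..<1}" "\<And>x. x \<notin> K \<Longrightarrow> \<psi> x = 0"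
    unfolding test_functions_def by blast
  have d1: "(\<psi> has_real_derivative deriv \<psi> x) (at x)" for x
    using smooth[of 0 x] by (simp add: field_differentiable_derivI)
  have d2: "(deriv \<psi> has_real_derivative deriv (deriv \<psi>) x) (at x)" for x
    using smooth[of 1 x] by (simp add: field_differentiable_derivI)
  have d3: "deriv (deriv \<psi>) field_differentiable at x" for x
    using smooth[of 2 x] by (simp add: numeral_2_eq_2)
  have cont1: "continuous_on A \<psi>" "continuous_on A (deriv \<psi>)" "continuous_on A (deriv (deriv \<psi>))" for A
    using d1 d2 d3 unfolding field_differentiable_def
    by (meson continuous_at_imp_continuous_on DERIV_isCont)+
  have openK: "open (- K)" using K(1) by (simp add: compact_imp_closed open_Compl)
  have z1: "deriv \<psi> x = 0" if "x \<notin> K" for x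
  proof -
    have "((\<lambda>_. 0) has_real_derivative 0) (at x)" by simp
    then have "(\<psi> has_real_derivative 0) (at x)"
      by (rule has_field_derivative_transform_within_open[OF _ openK]) (use that K in auto)
    then show ?thesis by (rule DERIV_imp_deriv)
  qed
  have z2: "deriv (deriv \<psi>) x = 0" if "x \<notin> K" for x
  proof -
    have "((\<lambda>_. 0) has_real_derivative 0) (at x)" by simp
    then have "(deriv \<psi> has_real_derivative 0) (at x)"
      by (rule has_field_derivative_transform_within_open[OF _ openK]) (use that z1 in auto)
    then show ?thesis by (rule DERIV_imp_deriv)
  qed
  obtain q where q: "0 < q" "q < 1" "K \<subseteq> {0<..<q}"
  proof (cases "K = {}")
    case True then show ?thesis using that[of "1/2"] by simp
  next
    case False
    then obtain m where m: "m \<in> K" "\<forall>x\<in>K. x \<le> m" using compact_attains_sup[OF K(1)] by blast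
    show ?thesis by (rule that[of "(m+1)/2"]) (use m K(2) in force)+
  qed
  then have q0: "q \<notin> K" "0 \<notin> K" by auto
  have e: "(\<eta> has_real_derivative e x) (at x within {0..q})" if "0 \<le> x" "x \<le> q" for x
    using deriv[of x] that q by (auto simp: has_field_derivative_def intro: has_derivative_subset)
  have conte: "continuous_on {0..q} e" by (rule continuous_on_subset[OF cont]) (use q in auto)
  have cont\<eta>: "continuous_on {0..q} \<eta>"
    by (rule DERIV_continuous_on[OF e]) auto
  have gi: "set_integrable lborel {0..q} g"
  proof -
    obtain C where "AE s in lborel. s \<in> {0..1 - (1 - q)} \<longrightarrow> \<bar>g s\<bar> \<le> C"
      using bounded[of "1 - q"] q by auto
    then show ?thesis by (intro set_integrable_Icc_bounded[where C=C]) auto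
  qed
  have restr: "(LBINT s:{0<..<1}. f s) = (LBINT s:{0..q}. f s)" if "\<And>s. s \<notin> K \<Longrightarrow> f s = 0" for f :: "real \<Rightarrow> real"
    unfolding set_lebesgue_integral_def
  proof (intro Bochner_Integration.integral_cong refl)
    fix s show "indicator {0<..<1} s *\<^sub>R f s = indicator {0..q} s *\<^sub>R f s"
      by (cases "s \<in> K") (use that[of s] q in \<open>auto split: split_indicator\<close>)
  qed
  have "(LBINT s:{0..q}. e s * deriv \<psi> s + \<eta> s * deriv (deriv \<psi>) s) = \<eta> q * deriv \<psi> q - \<eta> 0 * deriv \<psi> 0"
    by (rule LBINT_FTC)
       (use q in \<open>auto intro!: derivative_eq_intros e has_field_derivative_at_within[OF d2] continuous_intros conte cont\<eta> cont1\<close>)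
  then have parts1: "(LBINT s:{0..q}. e s * deriv \<psi> s + \<eta> s * deriv (deriv \<psi>) s) = 0" using z1 q0 by simp
  have "(LBINT s:{0..q}. e s * deriv \<psi> s + \<eta> s * deriv (deriv \<psi>) s) =
      (LBINT s:{0..q}. e s * deriv \<psi> s) + (LBINT s:{0..q}. \<eta> s * deriv (deriv \<psi>) s)"
    by (intro set_integral_add borel_integrable_atLeastAtMost' continuous_intros conte cont\<eta> cont1)
  with parts1 have s1: "(LBINT s:{0..q}. \<eta> s * deriv (deriv \<psi>) s) = - (LBINT s:{0..q}. e s * deriv \<psi> s)" by simp
  have FTC\<psi>: "(LBINT t:{s..q}. deriv \<psi> t) = - \<psi> s" if "s \<le> q" for s
    using LBINT_FTC[OF that, of \<psi> "deriv \<psi>"] has_field_derivative_at_within[OF d1] cont1 K(3)[OF q0(1)] by simp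
  have "(LBINT s:{0..q}. e s * deriv \<psi> s) = (LBINT s:{0..q}. e 0 * deriv \<psi> s + deriv \<psi> s * (LBINT r:{0..s}. g r))"
  proof (rule set_lebesgue_integral_cong)
    show "\<forall>s. s \<in> {0..q} \<longrightarrow> e s * deriv \<psi> s = e 0 * deriv \<psi> s + deriv \<psi> s * (LBINT r:{0..s}. g r)"
    proof (intro allI impI)
      fix s assume "s \<in> {0..q}"
      then have "(LBINT r:{0..s}. g r) = e s - e 0" using rep[of 0 s] q by auto
      then show "e s * deriv \<psi> s = e 0 * deriv \<psi> s + deriv \<psi> s * (LBINT r:{0..s}. g r)"
        unfolding \<open>(LBINT r:{0..s}. g r) = e s - e 0\<close> by (simp add: algebra_simps)
    qed
  qed simp
  also have "\<dots> = (LBINT s:{0..q}. e 0 * deriv \<psi> s) + (LBINT s:{0..q}. deriv \<psi> s * (LBINT r:{0..s}. g r))"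
  proof (rule set_integral_add)
    have "continuous_on {0..q} (\<lambda>s. deriv \<psi> s * (e s - e 0))"
      by (intro continuous_intros cont1 conte)
    moreover have "(LBINT r:{0..s}. g r) = e s - e 0" if "s \<in> {0..q}" for s using rep[of 0 s] that q by auto
    ultimately have "continuous_on {0..q} (\<lambda>s. deriv \<psi> s * (LBINT r:{0..s}. g r))"
      by (metis (no_types, lifting) continuous_on_cong)
    then show "set_integrable lborel {0..q} (\<lambda>s. deriv \<psi> s * (LBINT r:{0..s}. g r))"
      by (rule borel_integrable_atLeastAtMost')
  qed (intro borel_integrable_atLeastAtMost' continuous_intros cont1)
  also have "(LBINT s:{0..q}. e 0 * deriv \<psi> s) = 0"
    using FTC\<psi>[of 0] q K(3)[OF q0(2)] by simp
  also have "(LBINT s:{0..q}. deriv \<psi> s * (LBINT r:{0..s}. g r)) = (LBINT s:{0..q}. g s * (LBINT t:{s..q}. deriv \<psi> t))"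
    by (rule Fubini_triangle[OF borel_integrable_atLeastAtMost' gi]) (rule cont1)
  also have "\<dots> = (LBINT s:{0..q}. - (g s * \<psi> s))"
    by (rule set_lebesgue_integral_cong) (auto simp: FTC\<psi>)
  also have "\<dots> = - (LBINT s:{0..q}. g s * \<psi> s)" by (simp add: set_lebesgue_integral_def)
  finally show "(LBINT s:{0<..<1}. \<eta> s * deriv (deriv \<psi>) s) = (LBINT s:{0<..<1}. g s * \<psi> s)"
    using s1 by (subst (1 2) restr) (auto simp: z2 K(3))
qed (use g bounded in auto)

lemma X_space_distr_deriv2:
  assumes "\<eta> \<in> X_space"
  shows "is_distr_deriv2 \<eta> (distr_deriv2 \<eta>)"
    and "0 \<le> a \<Longrightarrow> a \<le> b \<Longrightarrow> b < 1 \<Longrightarrow> deriv1 \<eta> b - deriv1 \<eta> a = (LBINT s:{a..b}. distr_deriv2 \<eta> s)"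
proof -
  obtain g where g: "g\<in>borel_measurable borel"
           "\<And>\<delta>. \<delta> > 0 \<Longrightarrow> \<exists>C. AE s in lborel. s \<in> {0..1 - \<delta>} \<longrightarrow> \<bar>g s\<bar> \<le> C"
           "\<And>a b. 0 \<le> a \<Longrightarrow> a \<le> b \<Longrightarrow> b < 1 \<Longrightarrow> deriv1 \<eta> b - deriv1 \<eta> a = (LBINT s:{a..b}. g s)"
    using locally_lipschitz_density[of "deriv1 \<eta>"] assms unfolding X_space_def by blast
  have 1: "is_distr_deriv2 \<eta> g"
    by (rule is_distr_deriv2I[OF g(1,2) _ _ g(3)]) (use assms in \<open>auto simp: X_space_def\<close>)
  then show 2: "is_distr_deriv2 \<eta> (distr_deriv2 \<eta>)" unfolding distr_deriv2_def by (rule someI[of "is_distr_deriv2 \<eta>"])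
  assume ab: "0 \<le> a" "a \<le> b" "b < 1"
  have [measurable]: "distr_deriv2 \<eta> \<in> borel_measurable borel" using 2 by (simp add: is_distr_deriv2_def)
  have "(LBINT s:{a..b}. g s) = (LBINT s:{a..b}. distr_deriv2 \<eta> s)"
    by (rule set_lebesgue_integral_cong_AE)
       (use g(1) ab in \<open>auto intro!: eventually_mono[OF distr_deriv2_unique[OF 1 2]]\<close>)
  then show "deriv1 \<eta> b - deriv1 \<eta> a = (LBINT s:{a..b}. distr_deriv2 \<eta> s)" using g(3)[OF ab] by simp
qed

text \<open>
  The kernel $(r-s)^+$ is how measures enter $\phi_\mu$; this formula turns integrals of
  second derivatives against that kernel into values of the functions.
\<close>

lemma taylor_weak:
  assumes deriv: "\<And>s. s \<in> {0..<1} \<Longrightarrow> (\<eta> has_real_derivative e s) (at s within {0..<1})"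
    and cont: "continuous_on {0..<1} e"
    and rep: "\<And>b. 0 \<le> b \<Longrightarrow> b < 1 \<Longrightarrow> e b - e 0 = (LBINT s:{0..b}. g s)"
    and r: "0 \<le> r" "r < 1" and gi: "set_integrable lborel {0..r} g"
  shows "(LBINT s:{0..r}. g s * (r - s)) = \<eta> r - \<eta> 0 - e 0 * r"
proof -
  have "(LBINT s:{0..r}. g s * (r - s)) = (LBINT s:{0..r}. g s * (LBINT t:{s..r}. 1))"
    by (rule set_lebesgue_integral_cong) (auto simp: set_lebesgue_integral_def)
  also have "\<dots> = (LBINT t:{0..r}. 1 * (LBINT s:{0..t}. g s))"
    by (rule Fubini_triangle[symmetric, OF borel_integrable_atLeastAtMost' gi]) simp
  also have "\<dots> = (LBINT t:{0..r}. e t - e 0)"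
    by (rule set_lebesgue_integral_cong) (use rep r in auto)
  also have "\<dots> = (\<eta> r - e 0 * r) - (\<eta> 0 - e 0 * 0)"
  proof (rule LBINT_FTC)
    fix x assume x: "0 \<le> x" "x \<le> r"
    then have "(\<eta> has_real_derivative e x) (at x within {0..r})"
      using deriv[of x] r by (auto simp: has_field_derivative_def intro: has_derivative_subset)
    then show "((\<lambda>r. \<eta> r - e 0 * r) has_real_derivative e x - e 0) (at x within {0..r})"
      by (auto intro!: derivative_eq_intros)
  next
    show "continuous_on {0..r} (\<lambda>x. e x - e 0)"
      by (intro continuous_intros continuous_on_subset[OF cont]) (use r in auto)
  qed (use r in auto)
  finally show ?thesis by simp
qed

section \<open>The model function and the vanishing of frakd\<close>

text \<open>
  The function \<open>Z\<close> extends the second derivative of $\xi$ to a complex disc of radius greater than $1$.  It gives access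
  to analytic continuation and to all higher real derivatives.
\<close>

lemma model_power_series:
  assumes xi: "\<xi> = model \<beta> b"
    and conv: "\<exists>\<epsilon>>0. summable (\<lambda>p. (if 2 \<le> p then (b p)\<^sup>2 else 0) * (1 + \<epsilon>) ^ p)"
    and nonzero: "\<exists>t\<in>{0..1}. \<xi> t \<noteq> 0"
  obtains R \<xi>1 \<xi>2 Z where "1 < R" "\<xi> 0 = 0" "\<xi>1 0 = 0"
    "\<And>x. \<bar>x\<bar> < R \<Longrightarrow> (\<xi> has_real_derivative \<xi>1 x) (at x)"
    "\<And>x. \<bar>x\<bar> < R \<Longrightarrow> (\<xi>1 has_real_derivative \<xi>2 x) (at x)"
    "\<And>x. \<bar>x\<bar> < R \<Longrightarrow> deriv (deriv \<xi>) x = \<xi>2 x"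
    "\<And>x. 0 < x \<Longrightarrow> x < R \<Longrightarrow> 0 < \<xi>2 x"
    "Z holomorphic_on ball 0 R" "\<And>x. \<bar>x\<bar> < R \<Longrightarrow> Z (complex_of_real x) = complex_of_real (\<xi>2 x)"
proof -
  obtain \<epsilon> where \<epsilon>: "\<epsilon> > 0" and sm: "summable (\<lambda>p. (if 2 \<le> p then (b p)\<^sup>2 else 0) * (1 + \<epsilon>) ^ p)"
    using conv by blast
  define R where "R = 1 + \<epsilon>"
  define a where "a p = \<beta>\<^sup>2 * (if 2 \<le> p then (b p)\<^sup>2 else 0)" for p :: nat
  define A where "A p = complex_of_real (a p)" for p
  have R: "1 < R" using \<epsilon> by (simp add: R_def)
  have a0: "a p \<ge> 0" for p by (simp add: a_def)
  have sR: "summable (\<lambda>p. a p * R ^ p)"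
    using summable_mult[OF sm, of "\<beta>\<^sup>2"] by (simp add: a_def R_def mult.assoc)
  have sa: "summable (\<lambda>p. a p * x ^ p)" if "norm x < R" for x :: real
    by (rule powser_inside[OF sR]) (use that R in auto)
  have sRc: "summable (\<lambda>p. A p * complex_of_real R ^ p)"
    using summable_of_real[OF sR, where 'a=complex] by (simp add: A_def)
  have sA: "summable (\<lambda>p. A p * z ^ p)" if "norm z < R" for z
    by (rule powser_inside[OF sRc]) (use that R in auto)
  have sa1: "summable (\<lambda>p. diffs a p * x ^ p)" if "norm x < R" for x :: real
    by (rule termdiff_converges[OF that sa])
  have sa2: "summable (\<lambda>p. diffs (diffs a) p * x ^ p)" if "norm x < R" for x :: real
    by (rule termdiff_converges[OF that sa1])
  have sA1: "summable (\<lambda>p. diffs A p * x ^ p)" if "norm x < R" for x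
    by (rule termdiff_converges[OF that sA])
  have sA2: "summable (\<lambda>p. diffs (diffs A) p * x ^ p)" if "norm x < R" for x
    by (rule termdiff_converges[OF that sA1])
  define F where "F x = (\<Sum>p. a p * x ^ p)" for x
  define \<xi>1 where "\<xi>1 x = (\<Sum>p. diffs a p * x ^ p)" for x
  define \<xi>2 where "\<xi>2 x = (\<Sum>p. diffs (diffs a) p * x ^ p)" for x
  define Z where "Z z = (\<Sum>p. diffs (diffs A) p * z ^ p)" for z
  have \<xi>F: "\<xi> x = F x" if "\<bar>x\<bar> < R" for x
  proof -
    have "summable (\<lambda>p. (if 2 \<le> p then (b p)\<^sup>2 else 0) * x ^ p)"
      by (rule powser_inside[OF sm]) (use that R \<epsilon> in \<open>auto simp: R_def\<close>)
    from suminf_mult[OF this, of "\<beta>\<^sup>2"] show ?thesis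
      by (simp add: xi model_def F_def a_def mult.assoc)
  qed
  have opn: "open {x::real. \<bar>x\<bar> < R}"
    by (intro open_Collect_less continuous_intros)
  have d1: "(\<xi> has_real_derivative \<xi>1 x) (at x)" if x: "\<bar>x\<bar> < R" for x
  proof -
    have "(F has_real_derivative \<xi>1 x) (at x)"
      unfolding F_def[abs_def] \<xi>1_def by (rule termdiffs_strong'[of R]) (use sa x in auto)
    then show ?thesis
      by (rule has_field_derivative_transform_within_open[OF _ opn]) (use x \<xi>F in auto)
  qed
  have d2: "(\<xi>1 has_real_derivative \<xi>2 x) (at x)" if "\<bar>x\<bar> < R" for x
    unfolding \<xi>1_def[abs_def] \<xi>2_def by (rule termdiffs_strong'[of R]) (use sa1 that in auto)
  have dd: "deriv (deriv \<xi>) x = \<xi>2 x" if x: "\<bar>x\<bar> < R" for x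
  proof (rule DERIV_imp_deriv)
    show "(deriv \<xi> has_real_derivative \<xi>2 x) (at x)"
      by (rule has_field_derivative_transform_within_open[OF d2[OF x] opn])
         (use x in \<open>auto intro!: DERIV_imp_deriv[symmetric] d1\<close>)
  qed
  have c2: "diffs (diffs a) p = real (p+1) * real (p+2) * a (p + 2)" for p
    by (simp add: diffs_def numeral_2_eq_2 mult_ac)
  have "\<exists>p. a (p + 2) > 0"
  proof (rule ccontr)
    assume "\<not> (\<exists>p. a (p + 2) > 0)"
    then have "a (p + 2) = 0" for p using a0[of "p+2"] by (metis less_eq_real_def)
    then have "a p = 0" for p
    proof (cases "2 \<le> p")
      case True then show ?thesis using \<open>\<And>p. a (p + 2) = 0\<close>[of "p - 2"] by (simp only: le_add_diff_inverse2)
    qed (simp add: a_def)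
    then have "\<xi> t = 0" if "t \<in> {0..1}" for t using \<xi>F[of t] that R by (simp add: F_def)
    with nonzero show False by blast
  qed
  then obtain k where k: "a (k + 2) > 0" ..
  have pos: "0 < \<xi>2 x" if "0 < x" "x < R" for x
    unfolding \<xi>2_def
  proof (rule suminf_pos2[OF sa2, where i=k])
    show "0 \<le> diffs (diffs a) n * x ^ n" for n using that a0 by (auto simp: c2)
    show "0 < diffs (diffs a) k * x ^ k" unfolding c2 using that k by (intro mult_pos_pos) auto
  qed (use that in auto)
  have Z: "Z holomorphic_on ball 0 R"
  proof (rule holomorphic_onI)
    fix z :: complex assume "z \<in> ball 0 R"
    then have "(Z has_field_derivative (\<Sum>p. diffs (diffs (diffs A)) p * z ^ p)) (at z)"
      unfolding Z_def[abs_def] by (intro termdiffs_strong'[of R]) (use sA2 in auto)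
    then show "Z field_differentiable at z within ball 0 R"
      using field_differentiable_at_within field_differentiable_def by blast
  qed
  have Zr: "Z (complex_of_real x) = complex_of_real (\<xi>2 x)" if "\<bar>x\<bar> < R" for x
  proof -
    have "complex_of_real (\<xi>2 x) = (\<Sum>p. complex_of_real (diffs (diffs a) p * x ^ p))"
      unfolding \<xi>2_def by (rule suminf_of_real) (use sa2 that in auto)
    also have "\<dots> = Z (complex_of_real x)"
      by (simp add: Z_def A_def diffs_def)
    finally show ?thesis ..
  qed
  have 0: "\<xi> 0 = 0" "\<xi>1 0 = 0"
    using \<xi>F[of 0] R by (auto simp: F_def \<xi>1_def a_def diffs_def)
  show thesis
    by (rule that[OF R 0 d1 d2 dd pos Z Zr]) auto
qed

text \<open>
  The identity $\xi''(x)(p - c x)^2 = 1$ extends from the accumulating roots to the whole disc by analytic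
  continuation.  Then $p - c x$ has no zero, so $1/\sqrt{\xi''} = |p - c x|$ is locally affine.
\<close>

lemma frakd_zero_if_roots_accumulate:
  fixes \<xi>2 :: "real \<Rightarrow> real"
  assumes R: "1 < R" and dd: "\<And>x. \<bar>x\<bar> < R \<Longrightarrow> deriv (deriv \<xi>) x = \<xi>2 x"
    and Z: "Z holomorphic_on ball 0 R" and Zr: "\<And>x. \<bar>x\<bar> < R \<Longrightarrow> Z (complex_of_real x) = complex_of_real (\<xi>2 x)"
    and s: "s \<in> {0..<1}" "s islimpt {x \<in> {0..<1}. \<xi>2 x * (p - c * x)\<^sup>2 = 1}"
    and t: "t \<in> frakd_dom \<xi>"
  shows "frakd \<xi> t = 0"
proof -
  let ?U = "{x \<in> {0..<1}. \<xi>2 x * (p - c * x)\<^sup>2 = 1}"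
  define f where "f z = Z z * (complex_of_real p - complex_of_real c * z)\<^sup>2 - 1" for z
  have f_real: "f (complex_of_real x) = complex_of_real (\<xi>2 x * (p - c * x)\<^sup>2 - 1)" if "\<bar>x\<bar> < R" for x
    using Zr[OF that] by (simp add: f_def)
  have lim: "complex_of_real s islimpt (complex_of_real ` ?U)"
    unfolding islimpt_approachable
  proof (intro allI impI)
    fix e :: real assume "e > 0"
    then obtain x where x: "x \<in> ?U" "x \<noteq> s" "dist x s < e"
      using s(2) unfolding islimpt_approachable by blast
    then show "\<exists>x'\<in>complex_of_real ` ?U. x' \<noteq> complex_of_real s \<and> dist x' (complex_of_real s) < e"
      by (intro bexI[of _ "complex_of_real x"]) (auto simp: dist_of_real)
  qed
  have *: "\<xi>2 x * (p - c * x)\<^sup>2 = 1" if x: "\<bar>x\<bar> < R" for x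
  proof -
    have "f (complex_of_real x) = 0"
    proof (rule analytic_continuation[of f "ball 0 R" "complex_of_real ` ?U" "complex_of_real s"])
      show "f holomorphic_on ball 0 R" unfolding f_def by (intro holomorphic_intros Z)
      show "complex_of_real ` ?U \<subseteq> ball 0 R" using R by auto
      show "f z = 0" if "z \<in> complex_of_real ` ?U" for z
      proof -
        obtain x where x: "z = complex_of_real x" "x \<in> {0..<1}" and 1: "\<xi>2 x * (p - c * x)\<^sup>2 = 1"
          using \<open>z \<in> complex_of_real ` ?U\<close> by blast
        show ?thesis using f_real[of x] x R unfolding 1 by simp
      qed
    qed (use R s lim x in auto)
    then show ?thesis using f_real[OF x] by (simp del: of_real_diff of_real_mult of_real_power)
  qed
  have ne: "p - c * x \<noteq> 0" if "\<bar>x\<bar> < R" for x using *[OF that] by auto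
  have t01: "\<bar>t\<bar> < R" using t R by (auto simp: frakd_dom_def)
  define \<sigma> where "\<sigma> = sgn (p - c * t)"
  define T where "T = {x. \<bar>x\<bar> < R} \<inter> {x. 0 < \<sigma> * (p - c * x)}"
  have T: "open T" unfolding T_def by (intro open_Int open_Collect_less continuous_intros)
  have tT: "t \<in> T" using ne[OF t01] t01 by (auto simp: T_def \<sigma>_def sgn_if)
  have \<sigma>: "\<sigma> * \<sigma> = 1" using ne[OF t01] by (simp add: \<sigma>_def sgn_if)
  have w: "1 / sqrt (deriv (deriv \<xi>) x) = \<sigma> * (p - c * x)" if x: "x \<in> T" for x
  proof -
    have x': "\<bar>x\<bar> < R" "0 < \<sigma> * (p - c * x)" using x by (auto simp: T_def)
    have "(\<sigma> * (p - c * x))\<^sup>2 = (p - c * x)\<^sup>2"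
      using \<sigma> by (simp add: power_mult_distrib power2_eq_square)
    then have "\<xi>2 x = 1 / (\<sigma> * (p - c * x))\<^sup>2" using *[OF x'(1)] ne[OF x'(1)] by (simp add: field_simps)
    then show ?thesis using x' by (simp add: dd real_sqrt_divide)
  qed
  have w1: "deriv (\<lambda>s. 1 / sqrt (deriv (deriv \<xi>) s)) x = - \<sigma> * c" if x: "x \<in> T" for x
  proof (rule DERIV_imp_deriv)
    have "((\<lambda>x. \<sigma> * (p - c * x)) has_real_derivative - \<sigma> * c) (at x)"
      by (auto intro!: derivative_eq_intros)
    then show "((\<lambda>s. 1 / sqrt (deriv (deriv \<xi>) s)) has_real_derivative - \<sigma> * c) (at x)"
      by (rule has_field_derivative_transform_within_open[OF _ T x]) (simp add: w)
  qed
  show ?thesis unfolding frakd_def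
  proof (rule DERIV_imp_deriv)
    have "((\<lambda>x. - \<sigma> * c) has_real_derivative 0) (at t)" by simp
    then show "(deriv (\<lambda>s. 1 / sqrt (deriv (deriv \<xi>) s)) has_real_derivative 0) (at t)"
      by (rule has_field_derivative_transform_within_open[OF _ T tT]) (simp add: w1)
  qed
qed

text \<open>
  The second derivative of $1/\sqrt{\xi''}$ vanishes on $(0,1]$, where $\xi'' > 0$, so this
  function is affine there.  Continuity carries the conclusion to $0$, which also shows
  that $\xi''(0) > 0$.
\<close>

lemma reciprocal_sqrt_affine_if_frakd_zero:
  fixes \<xi>2 :: "real \<Rightarrow> real"
  assumes R: "1 < R" and dd: "\<And>x. \<bar>x\<bar> < R \<Longrightarrow> deriv (deriv \<xi>) x = \<xi>2 x"
    and pos: "\<And>x. 0 < x \<Longrightarrow> x < R \<Longrightarrow> 0 < \<xi>2 x"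
    and Z: "Z holomorphic_on ball 0 R" and Zr: "\<And>x. \<bar>x\<bar> < R \<Longrightarrow> Z (complex_of_real x) = complex_of_real (\<xi>2 x)"
    and zero: "\<forall>t\<in>frakd_dom \<xi>. frakd \<xi> t = 0"
  obtains p c where "\<And>x. x \<in> {0..1} \<Longrightarrow> 0 < p - c * x" "\<And>x. x \<in> {0..1} \<Longrightarrow> \<xi>2 x = 1 / (p - c * x)\<^sup>2"
proof -
  have deriv_re: "((\<lambda>x. Re (H (complex_of_real x))) has_real_derivative Re (deriv H (complex_of_real x))) (at x)"
    if H: "H holomorphic_on ball 0 R" and x: "\<bar>x\<bar> < R" for H x
  proof -
    have "(H has_field_derivative deriv H (complex_of_real x)) (at (complex_of_real x))"
      by (rule holomorphic_derivI[OF H]) (use x in auto)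
    then have "(H has_derivative (*) (deriv H (complex_of_real x))) (at (complex_of_real x))"
      by (simp add: has_field_derivative_def)
    from has_derivative_compose[OF has_derivative_of_real[OF has_derivative_ident] this]
    have "((\<lambda>x. Re (H (complex_of_real x))) has_derivative (\<lambda>y. Re (deriv H (complex_of_real x) * complex_of_real y))) (at x)"
      by (rule has_derivative_Re)
    moreover have "(\<lambda>y. Re (deriv H (complex_of_real x) * complex_of_real y)) = (*) (Re (deriv H (complex_of_real x)))"
      by (simp add: fun_eq_iff)
    ultimately show ?thesis unfolding has_field_derivative_def by simp
  qed
  define \<xi>3 where "\<xi>3 x = Re (deriv Z (complex_of_real x))" for x
  have opn: "open {x::real. \<bar>x\<bar> < R}"
    by (intro open_Collect_less continuous_intros)
  have d3: "(\<xi>2 has_real_derivative \<xi>3 x) (at x)" if x: "\<bar>x\<bar> < R" for x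
    unfolding \<xi>3_def
    by (rule has_field_derivative_transform_within_open[OF deriv_re[OF Z x] opn]) (use x Zr in auto)
  define \<xi>4 where "\<xi>4 x = Re (deriv (deriv Z) (complex_of_real x))" for x
  have d4: "(\<xi>3 has_real_derivative \<xi>4 x) (at x)" if x: "\<bar>x\<bar> < R" for x
    unfolding \<xi>3_def[abs_def] \<xi>4_def
    by (rule deriv_re[OF _ x]) (intro holomorphic_intros Z open_ball)
  define w where "w x = 1 / sqrt (\<xi>2 x)" for x
  define w1 where "w1 x = - \<xi>3 x / (2 * \<xi>2 x * sqrt (\<xi>2 x))" for x
  have dw: "(w has_real_derivative w1 x) (at x)" if "0 < x" "x < R" for x
    unfolding w_def[abs_def] w1_def
    by (rule derivative_eq_intros d3 refl | use pos[OF that] that in \<open>simp add: field_simps power2_eq_square\<close>)+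
  have dw1: "\<exists>D. (w1 has_real_derivative D) (at x)" if "0 < x" "x < R" for x
  proof -
    have px: "0 < \<xi>2 x" "\<bar>x\<bar> < R" using pos[OF that] that by auto
    have "((\<lambda>x. 2 * \<xi>2 x * sqrt (\<xi>2 x)) has_real_derivative
        2 * \<xi>3 x * sqrt (\<xi>2 x) + (inverse (sqrt (\<xi>2 x)) / 2 * \<xi>3 x) * (2 * \<xi>2 x)) (at x)"
      by (intro DERIV_mult DERIV_cmult DERIV_chain2[OF DERIV_real_sqrt] d3 px)
    moreover have "((\<lambda>x. - \<xi>3 x) has_real_derivative - \<xi>4 x) (at x)"
      by (intro DERIV_minus d4 px)
    moreover have "2 * \<xi>2 x * sqrt (\<xi>2 x) \<noteq> 0" using px by simp
    ultimately show ?thesis unfolding w1_def[abs_def] using DERIV_divide by blast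
  qed
  have S: "open {0<..<R}" by simp
  have dw1z: "(w1 has_real_derivative 0) (at x)" if x: "x \<in> {0<..1}" for x
  proof -
    have xR: "x \<in> {0<..<R}" using x R by auto
    have "deriv (\<lambda>s. 1 / sqrt (deriv (deriv \<xi>) s)) y = w1 y" if y: "y \<in> {0<..<R}" for y
    proof (rule DERIV_imp_deriv)
      have "(w has_real_derivative w1 y) (at y)" using dw y by auto
      then show "((\<lambda>s. 1 / sqrt (deriv (deriv \<xi>) s)) has_real_derivative w1 y) (at y)"
        by (rule has_field_derivative_transform_within_open[OF _ S y]) (simp add: w_def dd)
    qed
    moreover obtain D where D: "(w1 has_real_derivative D) (at x)" using dw1[of x] xR by auto
    ultimately have "(deriv (\<lambda>s. 1 / sqrt (deriv (deriv \<xi>) s)) has_real_derivative D) (at x)"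
      by (intro has_field_derivative_transform_within_open[OF D S xR]) simp
    then have "frakd \<xi> x = D" unfolding frakd_def by (rule DERIV_imp_deriv)
    moreover have "x \<in> frakd_dom \<xi>" using x pos[of x] xR by (auto simp: frakd_dom_def dd)
    ultimately show ?thesis using zero D by auto
  qed
  have cv: "convex {0<..1::real}" by (rule convex_real_interval)
  obtain k where k: "\<And>x. x \<in> {0<..1} \<Longrightarrow> w1 x = k"
    using has_field_derivative_zero_constant[OF cv, of w1] has_field_derivative_at_within[OF dw1z] by blast
  have "((\<lambda>x. w x - k * x) has_real_derivative 0) (at x within {0<..1})" if x: "x \<in> {0<..1}" for x
  proof -
    have "(w has_real_derivative k) (at x within {0<..1})"
      using dw[of x] k[OF x] x R by (auto intro: has_field_derivative_at_within)
    then show ?thesis by (auto intro!: derivative_eq_intros)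
  qed
  then obtain p where "\<And>x. x \<in> {0<..1} \<Longrightarrow> w x - k * x = p"
    using has_field_derivative_zero_constant[OF cv, of "\<lambda>x. w x - k * x"] by blast
  then have p: "w x = p + k * x" if "x \<in> {0<..1}" for x using that by (metis diff_add_cancel)
  have eq1: "\<xi>2 x * (p + k * x)\<^sup>2 = 1" "0 < p + k * x" if x: "x \<in> {0<..1}" for x
  proof -
    have "0 < \<xi>2 x" using pos[of x] x R by auto
    then show "\<xi>2 x * (p + k * x)\<^sup>2 = 1" "0 < p + k * x"
      unfolding p[OF x, symmetric] by (auto simp: w_def power_divide)
  qed
  have cl: "closure {0<..1::real} = {0..1}" by (rule closure_greaterThanAtMost) simp
  have c2: "continuous_on {0..1} \<xi>2"
    by (rule continuous_at_imp_continuous_on) (use R in \<open>auto intro!: DERIV_isCont d3\<close>)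
  have eq2: "\<xi>2 x * (p + k * x)\<^sup>2 = 1" if "x \<in> {0..1}" for x
    by (rule continuous_constant_on_closure[where S="{0<..1}" and f="\<lambda>x. \<xi>2 x * (p + k * x)\<^sup>2"])
       (unfold cl, use that eq1 in \<open>auto intro!: continuous_intros c2\<close>)
  have ge: "0 \<le> p + k * x" if "x \<in> {0..1}" for x
    by (rule continuous_ge_on_closure[where S="{0<..1}" and f="\<lambda>x. p + k * x"])
       (unfold cl, use that eq1(2) less_imp_le in \<open>auto intro!: continuous_intros\<close>)
  show thesis
  proof (rule that[of p "- k"])
    fix x :: real assume x: "x \<in> {0..1}"
    have "p + k * x \<noteq> 0" using eq2[OF x] by auto
    then show "0 < p - (- k) * x" using ge[OF x] by simp
    show "\<xi>2 x = 1 / (p - (- k) * x)\<^sup>2"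
      using eq2[OF x] \<open>p + k * x \<noteq> 0\<close> by (simp add: field_simps)
  qed
qed

section \<open>Probability measures on the unit interval\<close>

lemma Pr01D:
  assumes "\<mu> \<in> Pr01"
  shows "prob_space \<mu>" "sets \<mu> = sets borel01" "space \<mu> = {0..1}"
proof -
  show "prob_space \<mu>" and s: "sets \<mu> = sets borel01" using assms by (auto simp: Pr01_def)
  show "space \<mu> = {0..1}" using sets_eq_imp_space_eq[OF s] by (simp add: space_restrict_space)
qed

lemma Pr01_measurable:
  assumes "\<mu> \<in> Pr01" "f \<in> M1 \<rightarrow>\<^sub>M N" "sets M1 = sets borel"
  shows "f \<in> \<mu> \<rightarrow>\<^sub>M N"
proof -
  have "f \<in> borel \<rightarrow>\<^sub>M N" using assms(2,3) by (simp cong: measurable_cong_sets)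
  then have "f \<in> borel01 \<rightarrow>\<^sub>M N" by (rule measurable_restrict_space1)
  then show ?thesis using Pr01D(2)[OF assms(1)] by (simp cong: measurable_cong_sets)
qed

lemma Pr01_integrable:
  fixes f :: "real \<Rightarrow> real"
  assumes "\<mu> \<in> Pr01" "f \<in> borel_measurable borel" "\<And>r. r \<in> {0..1} \<Longrightarrow> \<bar>f r\<bar> \<le> B"
  shows "integrable \<mu> f"
proof -
  interpret prob_space \<mu> by (rule Pr01D(1)[OF assms(1)])
  show ?thesis
    by (rule integrable_const_bound[where B=B])
       (use Pr01_measurable[OF assms(1,2)] assms(3) Pr01D(3)[OF assms(1)] in \<open>auto intro!: AE_I2\<close>)
qed

text \<open>
  The stop-loss transform of a measure.  It is linear in the measure, convex and Lipschitz in \<open>s\<close>, and differs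
  from $\phi_\mu$ by a sign and an affine function, so it is more convenient than distribution functions.
\<close>

definition stop_loss :: "real measure \<Rightarrow> real \<Rightarrow> real" where
  "stop_loss \<mu> s = (\<integral>r. max 0 (r - s) \<partial>\<mu>)"

lemma stop_loss_integrable: "\<mu> \<in> Pr01 \<Longrightarrow> integrable \<mu> (\<lambda>r. max 0 (r - s))"
  by (rule Pr01_integrable[where B="1 + \<bar>s\<bar>"]) auto

lemma pair_sigma_finite_Pr01: "\<mu> \<in> Pr01 \<Longrightarrow> pair_sigma_finite \<mu> lborel"
  using Pr01D(1)
  by (simp add: pair_sigma_finite_def sigma_finite_lborel prob_space_imp_sigma_finite)

lemma phi_eq_stop_loss:
  assumes \<mu>: "\<mu> \<in> Pr01" and t: "0 \<le> t" "t \<le> 1"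
  shows "phi \<mu> t = 1 - t - stop_loss \<mu> t"
proof -
  interpret prob_space \<mu> by (rule Pr01D(1)[OF \<mu>])
  have [measurable]: "(\<lambda>x. x) \<in> borel_measurable \<mu>" by (rule Pr01_measurable[OF \<mu>, of _ borel]) auto
  define f where "f r s = indicator {t..1} s * (if r \<le> s then 1 else 0 :: real)" for r s :: real
  have [measurable]: "fst \<in> borel_measurable (\<mu> \<Otimes>\<^sub>M lborel)"
    by (rule measurable_compose[OF measurable_fst]) measurable
  have "(LBINT s. (\<integral>r. f r s \<partial>\<mu>)) = (\<integral>r. (LBINT s. f r s) \<partial>\<mu>)"
  proof (rule Fubini_dominated(1)[OF pair_sigma_finite_Pr01[OF \<mu>], where u="\<lambda>_. 1" and v="indicator {t..1}"])
    show "case_prod f \<in> borel_measurable (\<mu> \<Otimes>\<^sub>M lborel)"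
      unfolding f_def case_prod_beta by measurable
  qed (use t in \<open>auto simp: f_def intro!: integrable_real_indicator\<close>)
  moreover have "(\<integral>r. f r s \<partial>\<mu>) = indicator {t..1} s *\<^sub>R measure \<mu> {0..s}" for s
  proof (cases "s \<in> {t..1}")
    case True
    then have s: "{0..s} \<in> sets \<mu>" using t Pr01D(2)[OF \<mu>]
      by (auto simp: sets_restrict_space_iff)
    have "(\<integral>r. f r s \<partial>\<mu>) = (\<integral>r. indicator {0..s} r \<partial>\<mu>)"
      by (rule Bochner_Integration.integral_cong) (use True in \<open>auto simp: f_def Pr01D(3)[OF \<mu>]\<close>)
    also have "\<dots> = measure \<mu> {0..s}" using s by simp
    finally show ?thesis using True by simp
  qed (simp add: f_def)
  moreover have "(LBINT s. f r s) = 1 - t - max 0 (r - t)" if "r \<in> {0..1}" for r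
  proof -
    have "f r s = indicator {max r t..1} s" for s by (auto simp: f_def split: split_indicator)
    then show ?thesis using that t by simp
  qed
  then have "(\<integral>r. (LBINT s. f r s) \<partial>\<mu>) = (\<integral>r. 1 - t - max 0 (r - t) \<partial>\<mu>)"
    by (intro Bochner_Integration.integral_cong) (auto simp: Pr01D(3)[OF \<mu>])
  moreover have "(\<integral>r. 1 - t - max 0 (r - t) \<partial>\<mu>) = 1 - t - stop_loss \<mu> t"
    unfolding stop_loss_def
    by (subst Bochner_Integration.integral_diff) (auto simp: stop_loss_integrable[OF \<mu>] prob_space)
  ultimately show ?thesis unfolding phi_def set_lebesgue_integral_def
    by simp
qed

lemma stop_loss_Fubini:
  assumes \<mu>: "\<mu> \<in> Pr01" and g: "set_integrable lborel {0..q} g"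
    and q: "q \<le> 1"
  shows "(LBINT s:{0..q}. g s * stop_loss \<mu> s) = (\<integral>r. (LBINT s:{0..q}. g s * max 0 (r - s)) \<partial>\<mu>)"
    and "set_integrable lborel {0..q} (\<lambda>s. g s * stop_loss \<mu> s)"
    and "integrable \<mu> (\<lambda>r. LBINT s:{0..q}. g s * max 0 (r - s))"
proof -
  interpret prob_space \<mu> by (rule Pr01D(1)[OF \<mu>])
  have [measurable]: "(\<lambda>x. x) \<in> borel_measurable \<mu>" by (rule Pr01_measurable[OF \<mu>, of _ borel]) auto
  define G where "G s = indicator {0..q} s * g s" for s
  have G: "integrable lborel G" using g by (simp add: G_def[abs_def] set_integrable_def)
  then have [measurable]: "G \<in> borel_measurable borel" by auto
  define f where "f r s = G s * max 0 (r - s)" for r s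
  have [measurable]: "fst \<in> borel_measurable (\<mu> \<Otimes>\<^sub>M lborel)"
    by (rule measurable_compose[OF measurable_fst]) measurable
  have m: "case_prod f \<in> borel_measurable (\<mu> \<Otimes>\<^sub>M lborel)"
    unfolding f_def case_prod_beta by measurable
  have "\<bar>f r s\<bar> \<le> \<bar>1\<bar> * \<bar>G s\<bar>" if "r \<in> space \<mu>" for r s
  proof (cases "s \<in> {0..q}")
    case True
    then have "\<bar>max 0 (r - s)\<bar> \<le> 1" using that by (auto simp: Pr01D(3)[OF \<mu>])
    then show ?thesis by (auto simp: f_def abs_mult intro!: mult_left_le)
  qed (simp add: f_def G_def)
  from Fubini_dominated[OF pair_sigma_finite_Pr01[OF \<mu>] _ G m this]
  have 1: "(LBINT s. (\<integral>r. f r s \<partial>\<mu>)) = (\<integral>r. (LBINT s. f r s) \<partial>\<mu>)"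
    and 2: "integrable lborel (\<lambda>s. \<integral>r. f r s \<partial>\<mu>)"
    and 3: "integrable \<mu> (\<lambda>r. LBINT s. f r s)" by auto
  have eq1: "(\<lambda>s. \<integral>r. f r s \<partial>\<mu>) = (\<lambda>s. indicator {0..q} s *\<^sub>R (g s * stop_loss \<mu> s))"
    by (simp add: f_def stop_loss_def G_def fun_eq_iff)
  have eq2: "(\<lambda>r. LBINT s. f r s) = (\<lambda>r. LBINT s:{0..q}. g s * max 0 (r - s))"
    by (simp add: f_def G_def set_lebesgue_integral_def mult.assoc)
  show "(LBINT s:{0..q}. g s * stop_loss \<mu> s) = (\<integral>r. (LBINT s:{0..q}. g s * max 0 (r - s)) \<partial>\<mu>)"
    using 1 unfolding eq1 eq2 by (simp add: set_lebesgue_integral_def)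
  show "set_integrable lborel {0..q} (\<lambda>s. g s * stop_loss \<mu> s)"
    using 2 unfolding eq1 by (simp add: set_integrable_def)
  show "integrable \<mu> (\<lambda>r. LBINT s:{0..q}. g s * max 0 (r - s))"
    using 3 unfolding eq2 .
qed

lemma stop_loss_bounds:
  assumes \<mu>: "\<mu> \<in> Pr01"
  shows "0 \<le> stop_loss \<mu> s" "0 \<le> s \<Longrightarrow> s \<le> 1 \<Longrightarrow> stop_loss \<mu> s \<le> 1 - s" "1 \<le> s \<Longrightarrow> stop_loss \<mu> s = 0"
    "s \<le> t \<Longrightarrow> stop_loss \<mu> t \<le> stop_loss \<mu> s"
    "s \<le> t \<Longrightarrow> stop_loss \<mu> s \<le> stop_loss \<mu> t + (t - s)"
proof -
  interpret prob_space \<mu> by (rule Pr01D(1)[OF \<mu>])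
  note i = stop_loss_integrable[OF \<mu>]
  show "0 \<le> stop_loss \<mu> s" unfolding stop_loss_def by (rule Bochner_Integration.integral_nonneg) simp
  show "stop_loss \<mu> s \<le> 1 - s" if "0 \<le> s" "s \<le> 1"
  proof -
    have "stop_loss \<mu> s \<le> (\<integral>r. 1 - s \<partial>\<mu>)" unfolding stop_loss_def
      by (rule integral_mono[OF i]) (use that in \<open>auto simp: Pr01D(3)[OF \<mu>]\<close>)
    then show ?thesis by (simp add: prob_space)
  qed
  show "stop_loss \<mu> s = 0" if "1 \<le> s"
  proof -
    have "stop_loss \<mu> s = (\<integral>r. 0 \<partial>\<mu>)" unfolding stop_loss_def
      by (rule Bochner_Integration.integral_cong) (use that in \<open>auto simp: Pr01D(3)[OF \<mu>]\<close>)
    then show ?thesis by simp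
  qed
  show "stop_loss \<mu> t \<le> stop_loss \<mu> s" if "s \<le> t"
    unfolding stop_loss_def by (rule integral_mono[OF i i]) (use that in auto)
  show "stop_loss \<mu> s \<le> stop_loss \<mu> t + (t - s)" if "s \<le> t"
  proof -
    have "stop_loss \<mu> s \<le> (\<integral>r. max 0 (r - t) + (t - s) \<partial>\<mu>)" unfolding stop_loss_def
      by (rule integral_mono[OF i]) (use that i in auto)
    also have "\<dots> = stop_loss \<mu> t + (t - s)" unfolding stop_loss_def
      by (subst Bochner_Integration.integral_add) (auto simp: i prob_space)
    finally show ?thesis .
  qed
qed

lemma continuous_on_stop_loss:
  assumes \<mu>: "\<mu> \<in> Pr01"
  shows "continuous_on A (stop_loss \<mu>)"
proof (rule continuous_on_subset[where s=UNIV], rule lipschitz_on_continuous_on[of 1], rule lipschitz_onI)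
  fix x y :: real
  show "dist (stop_loss \<mu> x) (stop_loss \<mu> y) \<le> 1 * dist x y"
    using stop_loss_bounds(4,5)[OF \<mu>, of x y] stop_loss_bounds(4,5)[OF \<mu>, of y x] linear[of x y]
    unfolding dist_real_def by argo
qed simp_all

text \<open>
  For \<open>r\<close> outside the gap, the kernel $(r - s)^+$ is affine in \<open>s\<close> inside it.
\<close>

lemma stop_loss_affine:
  assumes \<mu>: "\<mu> \<in> Pr01" and gap: "AE r in \<mu>. \<not> (u < r \<and> r < v)"
  shows "\<exists>a c. \<forall>s. u \<le> s \<longrightarrow> s \<le> v \<longrightarrow> stop_loss \<mu> s = a - c * s"
proof -
  interpret prob_space \<mu> by (rule Pr01D(1)[OF \<mu>])
  have [measurable]: "(\<lambda>x. x) \<in> borel_measurable \<mu>" by (rule Pr01_measurable[OF \<mu>, of _ borel]) auto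
  have i: "integrable \<mu> (\<lambda>r. indicator {v..} r * r)" "integrable \<mu> (\<lambda>r. indicator {v..} r :: real)"
    by (rule Pr01_integrable[OF \<mu>, where B=1]; force split: split_indicator)+
  have "stop_loss \<mu> s = (\<integral>r. indicator {v..} r * r \<partial>\<mu>) - (\<integral>r. indicator {v..} r \<partial>\<mu>) * s" if s: "u \<le> s" "s \<le> v" for s
  proof -
    have "stop_loss \<mu> s = (\<integral>r. indicator {v..} r * r - indicator {v..} r * s \<partial>\<mu>)"
      unfolding stop_loss_def
    proof (rule integral_cong_AE)
      show "AE r in \<mu>. max 0 (r - s) = indicator {v..} r * r - indicator {v..} r * s"
        using gap by eventually_elim (use s in \<open>auto split: split_indicator\<close>)
    qed measurable
    also have "\<dots> = (\<integral>r. indicator {v..} r * r \<partial>\<mu>) - (\<integral>r. indicator {v..} r \<partial>\<mu>) * s"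
      by (subst Bochner_Integration.integral_diff) (use i in auto)
    finally show ?thesis .
  qed
  then show ?thesis by blast
qed

text \<open>
  The second difference of the kernel $(r - s)^+$ at the two ends and the midpoint is non-negative, and positive
  exactly when \<open>r\<close> lies strictly between the ends.  If its integral vanishes, the measure does not
  charge the open interval.
\<close>

lemma gap_if_stop_loss_affine:
  assumes \<mu>: "\<mu> \<in> Pr01"
    and aff: "stop_loss \<mu> u + stop_loss \<mu> v = 2 * stop_loss \<mu> ((u + v) / 2)"
  shows "AE r in \<mu>. \<not> (u < r \<and> r < v)"
proof -
  interpret prob_space \<mu> by (rule Pr01D(1)[OF \<mu>])
  note i = stop_loss_integrable[OF \<mu>]
  define m where "m = (u + v) / 2"
  have m: "u + v = m + m" by (simp add: m_def)
  define k where "k r = max 0 (r - u) + max 0 (r - v) - (max 0 (r - m) + max 0 (r - m))" for r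
  have ki: "integrable \<mu> k" unfolding k_def
    by (intro Bochner_Integration.integrable_diff Bochner_Integration.integrable_add i)
  have "(\<integral>r. k r \<partial>\<mu>) = stop_loss \<mu> u + stop_loss \<mu> v - 2 * stop_loss \<mu> m"
    unfolding k_def stop_loss_def by (simp add: i)
  then have "(\<integral>r. k r \<partial>\<mu>) = 0" using aff by (simp add: m_def)
  moreover have "AE r in \<mu>. 0 \<le> k r"
    by (rule AE_I2) (use m in \<open>simp add: k_def max_def\<close>)
  ultimately have "AE r in \<mu>. k r = 0"
    using integral_nonneg_eq_0_iff_AE[OF ki] by simp
  then show ?thesis
    by eventually_elim (use m in \<open>auto simp: k_def max_def split: if_splits\<close>)
qed

lemma distr_Pr01:
  assumes \<mu>: "\<mu> \<in> Pr01" and T: "T \<in> borel_measurable borel" "\<And>r. r \<in> {0..1} \<Longrightarrow> T r \<in> {0..1}"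
  shows "T \<in> \<mu> \<rightarrow>\<^sub>M borel01" "distr \<mu> borel01 T \<in> Pr01"
proof -
  interpret prob_space \<mu> by (rule Pr01D(1)[OF \<mu>])
  show *: "T \<in> \<mu> \<rightarrow>\<^sub>M borel01"
    by (rule measurable_restrict_space2) (use T Pr01D(3)[OF \<mu>] Pr01_measurable[OF \<mu> T(1)] in auto)
  show "distr \<mu> borel01 T \<in> Pr01" unfolding Pr01_def using prob_space_distr[OF *] by simp
qed

text \<open>
  A random coin decides whether a point drawn from \<open>\<mu>\<close> is moved by \<open>T\<close>; the law of the result is the convex
  combination of \<open>\<mu>\<close> and its image.
\<close>

lemma mixture_exists:
  assumes \<mu>: "\<mu> \<in> Pr01" and T: "T \<in> borel_measurable borel" "\<And>r. r \<in> {0..1} \<Longrightarrow> T r \<in> {0..1}"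
    and t: "0 \<le> t" "t \<le> 1"
  shows "\<exists>\<nu>\<in>Pr01. \<forall>s. stop_loss \<nu> s = (1 - t) * stop_loss \<mu> s + t * stop_loss (distr \<mu> borel01 T) s"
proof -
  interpret prob_space \<mu> by (rule Pr01D(1)[OF \<mu>])
  have T\<mu>: "T \<in> \<mu> \<rightarrow>\<^sub>M borel01" by (rule distr_Pr01(1)[OF \<mu> T])
  have id\<mu>: "(\<lambda>x. x) \<in> \<mu> \<rightarrow>\<^sub>M borel01"
    by (rule distr_Pr01(1)[OF \<mu>]) auto
  let ?B = "measure_pmf (bernoulli_pmf t)"
  interpret B: prob_space ?B by (rule measure_pmf.prob_space_axioms)
  interpret P: pair_prob_space ?B \<mu> ..
  define H where "H = (\<lambda>(c,r). if c then T r else r)"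
  have H: "H \<in> ?B \<Otimes>\<^sub>M \<mu> \<rightarrow>\<^sub>M borel01"
  proof -
    have "{z \<in> space (?B \<Otimes>\<^sub>M \<mu>). fst z} = {True} \<times> space \<mu>"
      by (auto simp: space_pair_measure)
    also have "\<dots> \<in> sets (?B \<Otimes>\<^sub>M \<mu>)" by (rule pair_measureI) auto
    finally show ?thesis unfolding H_def case_prod_beta
      by (rule measurable_If[OF measurable_compose[OF measurable_snd T\<mu>] measurable_compose[OF measurable_snd id\<mu>]])
  qed
  define \<nu> where "\<nu> = distr (?B \<Otimes>\<^sub>M \<mu>) borel01 H"
  have \<nu>: "\<nu> \<in> Pr01" unfolding Pr01_def \<nu>_def using P.prob_space_distr[OF H] by simp
  show "\<exists>\<nu>\<in>Pr01. \<forall>s. stop_loss \<nu> s = (1 - t) * stop_loss \<mu> s + t * stop_loss (distr \<mu> borel01 T) s"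
  proof (intro bexI[OF _ \<nu>] allI)
    fix s
    have m: "(\<lambda>r. max 0 (r - s)) \<in> borel_measurable borel01"
      by (rule measurable_restrict_space1) measurable
    have "stop_loss \<nu> s = (\<integral>z. max 0 (H z - s) \<partial>(?B \<Otimes>\<^sub>M \<mu>))"
      unfolding stop_loss_def \<nu>_def by (rule integral_distr[OF H m])
    also have "\<dots> = (\<integral>c. (\<integral>r. max 0 (H (c,r) - s) \<partial>\<mu>) \<partial>?B)"
    proof (rule P.integral_fst'[symmetric])
      show "integrable (?B \<Otimes>\<^sub>M \<mu>) (\<lambda>z. max 0 (H z - s))"
        using stop_loss_integrable[OF \<nu>, of s] unfolding \<nu>_def by (simp add: integrable_distr_eq[OF H m])
    qed
    also have "\<dots> = (1 - t) * stop_loss \<mu> s + t * (\<integral>r. max 0 (T r - s) \<partial>\<mu>)"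
      using t by (simp add: H_def stop_loss_def)
    also have "(\<integral>r. max 0 (T r - s) \<partial>\<mu>) = stop_loss (distr \<mu> borel01 T) s"
      unfolding stop_loss_def by (rule integral_distr[OF T\<mu> m, symmetric])
    finally show "stop_loss \<nu> s = (1 - t) * stop_loss \<mu> s + t * stop_loss (distr \<mu> borel01 T) s" .
  qed
qed

section \<open>The Crisanti-Sommers functional and its first variation\<close>

text \<open>
  The function \<^const>\<open>phi\<close> is of interest on $[0,1]$ only.  This extension is continuous and
  Borel measurable on the whole line.
\<close>

definition phi_ext :: "real measure \<Rightarrow> real \<Rightarrow> real" where
  "phi_ext \<mu> s = 1 - s - stop_loss \<mu> s"

lemma phi_ext_props:
  assumes \<mu>: "\<mu> \<in> Pr01"
  shows "0 \<le> s \<Longrightarrow> s \<le> 1 \<Longrightarrow> phi \<mu> s = phi_ext \<mu> s" "phi_ext \<mu> s \<le> 1 - s"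
    "0 \<le> s \<Longrightarrow> s \<le> 1 \<Longrightarrow> 0 \<le> phi_ext \<mu> s"
    "s \<le> t \<Longrightarrow> phi_ext \<mu> t \<le> phi_ext \<mu> s"
    "continuous_on A (phi_ext \<mu>)"
  using phi_eq_stop_loss[OF \<mu>, of s] stop_loss_bounds(1-3)[OF \<mu>, of s] stop_loss_bounds(5)[OF \<mu>, of s t]
  by (auto simp: phi_ext_def[abs_def] intro!: continuous_intros continuous_on_stop_loss[OF \<mu>])

lemma borel_measurable_phi_ext: "\<mu> \<in> Pr01 \<Longrightarrow> phi_ext \<mu> \<in> borel_measurable borel"
  by (rule borel_measurable_continuous_onI, rule phi_ext_props)

lemma crisanti_sommers_phi_ext:
  assumes \<mu>: "\<mu> \<in> Pr01" and dd: "\<forall>x\<in>{0..1}. deriv (deriv \<xi>) x = \<xi>2 x"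
  shows "crisanti_sommers \<xi> h \<mu> = ereal (1/2) *
     (ereal (LBINT s:{0..1}. \<xi>2 s * phi_ext \<mu> s)
      + enn2ereal (\<integral>\<^sup>+s\<in>{0..<1}. (1 / ennreal (phi_ext \<mu> s) - 1 / ennreal (1 - s)) \<partial>lborel)
      + ereal (h\<^sup>2 * phi_ext \<mu> 0))"
proof -
  have "(LBINT s:{0..1}. deriv (deriv \<xi>) s * phi \<mu> s) = (LBINT s:{0..1}. \<xi>2 s * phi_ext \<mu> s)"
    by (rule set_lebesgue_integral_cong) (auto simp: dd phi_ext_props[OF \<mu>])
  moreover have "(\<integral>\<^sup>+s\<in>{0..<1}. (1 / ennreal (phi \<mu> s) - 1 / ennreal (1 - s)) \<partial>lborel)
     = (\<integral>\<^sup>+s\<in>{0..<1}. (1 / ennreal (phi_ext \<mu> s) - 1 / ennreal (1 - s)) \<partial>lborel)"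
    by (rule nn_integral_cong) (auto simp: phi_ext_props[OF \<mu>] split: split_indicator)
  ultimately show ?thesis unfolding crisanti_sommers_def by (simp add: phi_ext_props[OF \<mu>])
qed

lemma interaction_integrand_eq:
  assumes \<mu>: "\<mu> \<in> Pr01" and pos: "\<forall>s\<in>{0..<1}. 0 < phi_ext \<mu> s"
  shows "(1 / ennreal (phi_ext \<mu> s) - 1 / ennreal (1 - s)) * indicator {0..<1} s
       = ennreal (indicator {0..<1} s *\<^sub>R (1 / phi_ext \<mu> s - 1 / (1 - s)))"
proof (cases "s \<in> {0..<1}")
  case True
  have "1 / ennreal x = ennreal (1 / x)" if "0 < x" for x
    using divide_ennreal[of 1 x] that by simp
  then show ?thesis using True pos by (simp add: ennreal_minus)
qed simp

lemma interaction_nonneg: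
  assumes \<mu>: "\<mu> \<in> Pr01" and pos: "\<forall>s\<in>{0..<1}. 0 < phi_ext \<mu> s"
  shows "0 \<le> indicator {0..<1} s *\<^sub>R (1 / phi_ext \<mu> s - 1 / (1 - s))"
  using bspec[OF pos, of s] phi_ext_props(2)[OF \<mu>, of s]
  by (auto simp: frac_le split: split_indicator)

text \<open>
  Where $\phi_\mu$ vanishes it vanishes from there on, because it is decreasing, and the
  integrand $1/\phi_\mu - 1/(1-s)$ is then infinite on a set of positive length.
\<close>

lemma finite_crisanti_sommers:
  assumes \<mu>: "\<mu> \<in> Pr01" and fin: "crisanti_sommers \<xi> h \<mu> < \<infinity>"
    and dd: "\<forall>x\<in>{0..1}. deriv (deriv \<xi>) x = \<xi>2 x"
  shows "\<forall>s\<in>{0..<1}. 0 < phi_ext \<mu> s"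
    and "set_integrable lborel {0..<1} (\<lambda>s. 1 / phi_ext \<mu> s - 1 / (1 - s))"
proof -
  note [measurable] = borel_measurable_phi_ext[OF \<mu>]
  let ?I = "\<integral>\<^sup>+s\<in>{0..<1}. (1 / ennreal (phi_ext \<mu> s) - 1 / ennreal (1 - s)) \<partial>lborel"
  have I: "?I < \<infinity>"
    using fin unfolding crisanti_sommers_phi_ext[OF \<mu> dd]
    by (cases "?I = \<infinity>") (auto simp: less_top[symmetric])
  show pos: "\<forall>s\<in>{0..<1}. 0 < phi_ext \<mu> s"
  proof (rule ballI, rule ccontr)
    fix s :: real assume s: "s \<in> {0..<1}"
    assume "\<not> 0 < phi_ext \<mu> s"
    then have z: "ennreal (phi_ext \<mu> r) = 0" if "s \<le> r" for r
      using phi_ext_props(4)[OF \<mu> that] by (simp add: ennreal_neg)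
    have "(\<integral>\<^sup>+r. \<infinity> * indicator {s..<1} r \<partial>lborel) \<le> ?I"
      by (rule nn_integral_mono) (use s z in \<open>auto split: split_indicator simp: ennreal_top_minus\<close>)
    moreover have "(\<integral>\<^sup>+r. \<infinity> * indicator {s..<1} r \<partial>lborel) = \<infinity>"
      using s by (subst nn_integral_cmult_indicator) (auto simp: ennreal_top_mult)
    ultimately show False using I by simp
  qed
  show "set_integrable lborel {0..<1} (\<lambda>s. 1 / phi_ext \<mu> s - 1 / (1 - s))"
    unfolding set_integrable_def
  proof (rule integrableI_nonneg)
    show "AE s in lborel. 0 \<le> indicator {0..<1} s *\<^sub>R (1 / phi_ext \<mu> s - 1 / (1 - s))"
      by (rule AE_I2, rule interaction_nonneg[OF \<mu> pos])
    show "(\<integral>\<^sup>+s. ennreal (indicator {0..<1} s *\<^sub>R (1 / phi_ext \<mu> s - 1 / (1 - s))) \<partial>lborel) < \<infinity>"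
      using I unfolding interaction_integrand_eq[OF \<mu> pos] .
  qed measurable
qed

lemma crisanti_sommers_eq_real:
  assumes \<mu>: "\<mu> \<in> Pr01" and pos: "\<forall>s\<in>{0..<1}. 0 < phi_ext \<mu> s"
    and int: "set_integrable lborel {0..<1} (\<lambda>s. 1 / phi_ext \<mu> s - 1 / (1 - s))"
    and dd: "\<forall>x\<in>{0..1}. deriv (deriv \<xi>) x = \<xi>2 x"
  shows "crisanti_sommers \<xi> h \<mu> = ereal (1/2 * ((LBINT s:{0..1}. \<xi>2 s * phi_ext \<mu> s)
      + (LBINT s:{0..<1}. 1 / phi_ext \<mu> s - 1 / (1 - s)) + h\<^sup>2 * phi_ext \<mu> 0))"
proof -
  have "(\<integral>\<^sup>+s\<in>{0..<1}. (1 / ennreal (phi_ext \<mu> s) - 1 / ennreal (1 - s)) \<partial>lborel)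
     = ennreal (LBINT s:{0..<1}. 1 / phi_ext \<mu> s - 1 / (1 - s))"
    unfolding set_lebesgue_integral_def
    by (subst interaction_integrand_eq[OF \<mu> pos], rule nn_integral_eq_integral) (use int interaction_nonneg[OF \<mu> pos] in \<open>auto simp: set_integrable_def\<close>)
  moreover have "0 \<le> (LBINT s:{0..<1}. 1 / phi_ext \<mu> s - 1 / (1 - s))"
    unfolding set_lebesgue_integral_def
    by (rule Bochner_Integration.integral_nonneg) (rule interaction_nonneg[OF \<mu> pos])
  ultimately show ?thesis
    unfolding crisanti_sommers_phi_ext[OF \<mu> dd] by simp
qed

text \<open>
  The Dirac mass at $0$ has $\phi(s) = 1 - s$, so its functional is finite.
\<close>

lemma minimizer_finite:
  assumes min: "\<forall>\<nu>\<in>Pr01. crisanti_sommers \<xi> h \<mu> \<le> crisanti_sommers \<xi> h \<nu>"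
  shows "crisanti_sommers \<xi> h \<mu> < \<infinity>"
proof -
  let ?\<delta> = "return borel01 (0::real)"
  have sp: "0 \<in> space borel01" by (simp add: space_restrict_space)
  have \<delta>: "?\<delta> \<in> Pr01" unfolding Pr01_def using prob_space_return[OF sp] by simp
  have "stop_loss ?\<delta> s = max 0 (- s)" for s
    unfolding stop_loss_def
    by (subst integral_return[OF sp]) (auto intro: measurable_restrict_space1)
  then have \<phi>: "phi_ext ?\<delta> s = 1 - s" if "0 \<le> s" for s using that by (simp add: phi_ext_def)
  have "(LBINT s:{0..<1}. 1 / phi_ext ?\<delta> s - 1 / (1 - s)) = (LBINT s:{0..<1::real}. 0 :: real)"
    by (rule set_lebesgue_integral_cong) (auto simp: \<phi>)
  moreover have "set_integrable lborel {0..<1} (\<lambda>s. 1 / phi_ext ?\<delta> s - 1 / (1 - s)) \<longleftrightarrow> set_integrable lborel {0..<1::real} (\<lambda>s. 0 :: real)"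
    by (rule set_integrable_cong) (auto simp: \<phi>)
  then have "crisanti_sommers \<xi> h ?\<delta> < \<infinity>"
    by (subst crisanti_sommers_eq_real[OF \<delta>, where ?\<xi>2.0="deriv (deriv \<xi>)"]) (auto simp: \<phi> set_integrable_def)
  with bspec[OF min \<delta>] show ?thesis by (rule le_less_trans)
qed

text \<open>
  The map \<open>T\<close> moves mass only within $[0,q]$, so the perturbation of $\phi_\mu$ vanishes beyond
  \<open>q\<close>, and $\phi_\mu$ is bounded below where the perturbation lives.  This makes the remainder
  of $1/\phi$ uniformly quadratic and keeps the singularity at $1$ out of the computation.
\<close>

lemma first_variation:
  assumes \<mu>: "\<mu> \<in> Pr01"
    and min: "\<forall>\<nu>\<in>Pr01. crisanti_sommers \<xi> h \<mu> \<le> crisanti_sommers \<xi> h \<nu>"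
    and dd: "\<forall>x\<in>{0..1}. deriv (deriv \<xi>) x = \<xi>2 x"
    and c\<xi>: "continuous_on {0..1} \<xi>2"
    and q: "0 \<le> q" "q < 1"
    and T: "T \<in> borel_measurable borel" "\<And>r. r \<in> {0..1} \<Longrightarrow> T r \<in> {0..1}"
      "\<And>r. q < r \<Longrightarrow> T r = r" "\<And>r. r \<le> q \<Longrightarrow> T r \<le> q"
  defines "\<Delta> \<equiv> \<lambda>s. stop_loss \<mu> s - stop_loss (distr \<mu> borel01 T) s"
  shows "0 \<le> h\<^sup>2 * \<Delta> 0 + (LBINT s:{0..q}. (\<xi>2 s - 1 / (phi_ext \<mu> s)\<^sup>2) * \<Delta> s)"
proof -
  have \<mu>': "distr \<mu> borel01 T \<in> Pr01" by (rule distr_Pr01(2)[OF \<mu> T(1,2)])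
  have T\<mu>: "T \<in> \<mu> \<rightarrow>\<^sub>M borel01" by (rule distr_Pr01(1)[OF \<mu> T(1,2)])
  note fin = minimizer_finite[OF min]
  note pos = finite_crisanti_sommers(1)[OF \<mu> fin dd] and int = finite_crisanti_sommers(2)[OF \<mu> fin dd]
  have contD: "continuous_on A \<Delta>" for A unfolding \<Delta>_def
    by (intro continuous_intros continuous_on_stop_loss \<mu> \<mu>')
  have D0: "\<Delta> s = 0" if "q \<le> s" for s
  proof -
    have "stop_loss (distr \<mu> borel01 T) s = (\<integral>r. max 0 (T r - s) \<partial>\<mu>)"
      unfolding stop_loss_def by (rule integral_distr[OF T\<mu>]) (rule measurable_restrict_space1, measurable)
    also have "max 0 (T r - s) = max 0 (r - s)" for r
      using T(3,4)[of r] that by (cases "q < r") auto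
    then have "(\<integral>r. max 0 (T r - s) \<partial>\<mu>) = stop_loss \<mu> s" unfolding stop_loss_def by simp
    finally show ?thesis by (simp add: \<Delta>_def)
  qed
  have D1: "\<bar>\<Delta> s\<bar> \<le> 1" if "s \<in> {0..1}" for s
    using that stop_loss_bounds(1,2)[OF \<mu>, of s] stop_loss_bounds(1,2)[OF \<mu>', of s]
    unfolding \<Delta>_def by auto
  define m where "m = phi_ext \<mu> q"
  have m: "0 < m" "m \<le> 1" using bspec[OF pos, of q] phi_ext_props(2)[OF \<mu>, of q] q by (auto simp: m_def)
  have \<phi>m: "m \<le> phi_ext \<mu> s" if "s \<in> {0..q}" for s
    using phi_ext_props(4)[OF \<mu>, of s q] that by (simp add: m_def)
  let ?\<phi> = "phi_ext \<mu>"
  have c\<phi>: "continuous_on A ?\<phi>" for A by (rule phi_ext_props[OF \<mu>])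
  have ne: "?\<phi> s \<noteq> 0" if "s \<in> {0..q}" for s using \<phi>m[OF that] m by auto
  define L where "L = h\<^sup>2 * \<Delta> 0 + (LBINT s:{0..q}. (\<xi>2 s - 1 / (?\<phi> s)\<^sup>2) * \<Delta> s)"
  have c\<xi>q: "continuous_on {0..q} \<xi>2" by (rule continuous_on_subset[OF c\<xi>]) (use q in auto)
  have i\<xi>\<Delta>: "set_integrable lborel {0..q} (\<lambda>s. \<xi>2 s * \<Delta> s)"
    by (intro borel_integrable_atLeastAtMost' continuous_intros c\<xi>q contD)
  have i\<phi>\<Delta>: "set_integrable lborel {0..q} (\<lambda>s. \<Delta> s / (?\<phi> s)\<^sup>2)"
    by (intro borel_integrable_atLeastAtMost' continuous_intros c\<phi> contD) (use ne in auto)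
  have L_eq: "L = h\<^sup>2 * \<Delta> 0 + (LBINT s:{0..q}. \<xi>2 s * \<Delta> s) - (LBINT s:{0..q}. \<Delta> s / (?\<phi> s)\<^sup>2)"
    unfolding L_def using set_integral_diff(2)[OF i\<xi>\<Delta> i\<phi>\<Delta>] by (simp add: algebra_simps)
  \<comment> \<open>comparison with the mixture of weight \<open>t\<close>, up to an error of second order in \<open>t\<close>\<close>
  have key: "0 \<le> t * L + t\<^sup>2 * (2 * q / m ^ 3)" if t: "0 < t" "t \<le> m / 2" for t
  proof -
    have t01: "0 \<le> t" "t \<le> 1" using t m by auto
    obtain \<nu> where \<nu>: "\<nu> \<in> Pr01"
      and sl: "\<And>s. stop_loss \<nu> s = (1 - t) * stop_loss \<mu> s + t * stop_loss (distr \<mu> borel01 T) s"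
      using mixture_exists[OF \<mu> T(1,2) t01] by blast
    let ?\<psi> = "phi_ext \<nu>"
    have \<psi>: "?\<psi> s = ?\<phi> s + t * \<Delta> s" for s
      unfolding phi_ext_def sl \<Delta>_def by (simp add: algebra_simps)
    have \<psi>m: "m / 2 \<le> ?\<psi> s" if s: "s \<in> {0..q}" for s
    proof -
      have "\<bar>t * \<Delta> s\<bar> \<le> (m/2) * 1"
        unfolding abs_mult by (rule mult_mono) (use t D1[of s] s q in auto)
      then show ?thesis using \<phi>m[OF s] unfolding \<psi> by linarith
    qed
    have pos\<nu>: "\<forall>s\<in>{0..<1}. 0 < ?\<psi> s"
    proof
      fix s :: real assume that: "s \<in> {0..<1}"
      show "0 < ?\<psi> s"
      proof (cases "s \<le> q")
      case True then show ?thesis using \<psi>m[of s] that m by auto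
    next
      case False then show ?thesis using D0[of s] bspec[OF pos that] by (simp add: \<psi>)
      qed
    qed
    have c\<psi>: "continuous_on A ?\<psi>" for A by (rule phi_ext_props[OF \<nu>])
    have ne\<psi>: "?\<psi> s \<noteq> 0" if "s \<in> {0..q}" for s using \<psi>m[OF that] m by auto
    have idiff: "set_integrable lborel {0..q} (\<lambda>s. 1 / ?\<psi> s - 1 / ?\<phi> s)"
      by (intro borel_integrable_atLeastAtMost' continuous_intros c\<phi> c\<psi>) (use ne ne\<psi> in auto)
    have split: "indicator {0..<1} s *\<^sub>R (1 / ?\<psi> s - 1 / (1 - s)) =
       indicator {0..<1} s *\<^sub>R (1 / ?\<phi> s - 1 / (1 - s)) + indicator {0..q} s *\<^sub>R (1 / ?\<psi> s - 1 / ?\<phi> s)" for s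
    proof (cases "s \<le> q")
      case True then show ?thesis using q by (auto split: split_indicator)
    next
      case False then show ?thesis using D0[of s] by (simp add: \<psi>)
    qed
    have int\<nu>: "set_integrable lborel {0..<1} (\<lambda>s. 1 / ?\<psi> s - 1 / (1 - s))"
      using int idiff unfolding set_integrable_def split by (rule Bochner_Integration.integrable_add)
    have B: "(LBINT s:{0..<1}. 1 / ?\<psi> s - 1 / (1 - s)) =
        (LBINT s:{0..<1}. 1 / ?\<phi> s - 1 / (1 - s)) + (LBINT s:{0..q}. 1 / ?\<psi> s - 1 / ?\<phi> s)"
      using int idiff unfolding set_integrable_def set_lebesgue_integral_def split
      by (rule Bochner_Integration.integral_add)
    have A: "(LBINT s:{0..1}. \<xi>2 s * ?\<psi> s) = (LBINT s:{0..1}. \<xi>2 s * ?\<phi> s) + t * (LBINT s:{0..q}. \<xi>2 s * \<Delta> s)"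
    proof -
      have "(LBINT s:{0..1}. \<xi>2 s * ?\<psi> s) = (LBINT s:{0..1}. \<xi>2 s * ?\<phi> s + t * (\<xi>2 s * \<Delta> s))"
        by (rule set_lebesgue_integral_cong) (auto simp: \<psi> algebra_simps)
      also have "\<dots> = (LBINT s:{0..1}. \<xi>2 s * ?\<phi> s) + (LBINT s:{0..1}. t * (\<xi>2 s * \<Delta> s))"
        by (intro set_integral_add borel_integrable_atLeastAtMost' continuous_intros c\<xi> c\<phi> contD)
      also have "(LBINT s:{0..1}. t * (\<xi>2 s * \<Delta> s)) = t * (LBINT s:{0..1}. \<xi>2 s * \<Delta> s)" by simp
      also have "(LBINT s:{0..1}. \<xi>2 s * \<Delta> s) = (LBINT s:{0..q}. \<xi>2 s * \<Delta> s)"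
        unfolding set_lebesgue_integral_def
      proof (rule Bochner_Integration.integral_cong[OF refl])
        fix s show "indicator {0..1} s *\<^sub>R (\<xi>2 s * \<Delta> s) = indicator {0..q} s *\<^sub>R (\<xi>2 s * \<Delta> s)"
          using D0[of s] q by (cases "s \<le> q") (auto split: split_indicator)
      qed
      finally show ?thesis .
    qed
    have quad: "1 / ?\<psi> s - 1 / ?\<phi> s \<le> - t * (\<Delta> s / (?\<phi> s)\<^sup>2) + t\<^sup>2 * (2 / m ^ 3)" if s: "s \<in> {0..q}" for s
    proof -
      have p: "0 < ?\<phi> s" "0 < ?\<psi> s" using \<phi>m[OF s] \<psi>m[OF s] m by auto
      have "1 / ?\<psi> s - 1 / ?\<phi> s = - t * (\<Delta> s / (?\<phi> s)\<^sup>2) + t\<^sup>2 * ((\<Delta> s)\<^sup>2 / ((?\<phi> s)\<^sup>2 * ?\<psi> s))"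
      proof -
        have "t * \<Delta> s = ?\<psi> s - ?\<phi> s" by (simp add: \<psi>)
        then have "- t * (\<Delta> s / (?\<phi> s)\<^sup>2) + t\<^sup>2 * ((\<Delta> s)\<^sup>2 / ((?\<phi> s)\<^sup>2 * ?\<psi> s)) =
          - ((?\<psi> s - ?\<phi> s) / (?\<phi> s)\<^sup>2) + (?\<psi> s - ?\<phi> s)\<^sup>2 / ((?\<phi> s)\<^sup>2 * ?\<psi> s)"
          by (metis (no_types, lifting) mult_minus_left power_mult_distrib times_divide_eq_right)
        also have "\<dots> = 1 / ?\<psi> s - 1 / ?\<phi> s"
          using p by (simp add: field_simps power2_eq_square)
        finally show ?thesis ..
      qed
      moreover have "(\<Delta> s)\<^sup>2 / ((?\<phi> s)\<^sup>2 * ?\<psi> s) \<le> 1 / (m\<^sup>2 * (m / 2))"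
      proof (rule frac_le)
        show "(\<Delta> s)\<^sup>2 \<le> 1" using D1[of s] s q by (simp add: abs_square_le_1)
        show "m\<^sup>2 * (m / 2) \<le> (?\<phi> s)\<^sup>2 * ?\<psi> s"
          by (intro mult_mono power_mono \<phi>m \<psi>m s) (use m p in auto)
      qed (use m in auto)
      moreover have "1 / (m\<^sup>2 * (m / 2)) = 2 / m ^ 3" using m by (simp add: field_simps power2_eq_square power3_eq_cube)
      ultimately show ?thesis using mult_left_mono[of _ _ "t\<^sup>2"] by (metis add_left_mono zero_le_power2)
    qed
    have "(LBINT s:{0..q}. 1 / ?\<psi> s - 1 / ?\<phi> s) \<le> (LBINT s:{0..q}. - t * (\<Delta> s / (?\<phi> s)\<^sup>2) + t\<^sup>2 * (2 / m ^ 3))"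
    proof (rule set_integral_mono[OF idiff _ quad])
      show "set_integrable lborel {0..q} (\<lambda>s. - t * (\<Delta> s / (?\<phi> s)\<^sup>2) + t\<^sup>2 * (2 / m ^ 3))"
        by (intro borel_integrable_atLeastAtMost' continuous_intros c\<phi> contD) (use ne m in auto)
    qed
    also have "\<dots> = (LBINT s:{0..q}. - t * (\<Delta> s / (?\<phi> s)\<^sup>2)) + (LBINT s:{0..q}. t\<^sup>2 * (2 / m ^ 3))"
      by (intro set_integral_add borel_integrable_atLeastAtMost' continuous_intros c\<phi> contD) (use ne m in auto)
    also have "(LBINT s:{0..q}. - t * (\<Delta> s / (?\<phi> s)\<^sup>2)) = - t * (LBINT s:{0..q}. \<Delta> s / (?\<phi> s)\<^sup>2)"
      by (simp only: set_integral_mult_right)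
    also have "(LBINT s:{0..q}. t\<^sup>2 * (2 / m ^ 3)) = t\<^sup>2 * (2 * q / m ^ 3)"
      using q by (simp add: set_lebesgue_integral_def)
    finally have C: "(LBINT s:{0..q}. 1 / ?\<psi> s - 1 / ?\<phi> s) \<le> - t * (LBINT s:{0..q}. \<Delta> s / (?\<phi> s)\<^sup>2) + t\<^sup>2 * (2 * q / m ^ 3)" .
    have "crisanti_sommers \<xi> h \<mu> \<le> crisanti_sommers \<xi> h \<nu>" using min \<nu> by blast
    then have "0 \<le> t * (LBINT s:{0..q}. \<xi>2 s * \<Delta> s) + (LBINT s:{0..q}. 1 / ?\<psi> s - 1 / ?\<phi> s) + h\<^sup>2 * (t * \<Delta> 0)"
      unfolding crisanti_sommers_eq_real[OF \<mu> pos int dd] crisanti_sommers_eq_real[OF \<nu> pos\<nu> int\<nu> dd] A B \<psi>[of 0]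
      by (simp add: algebra_simps)
    with C show ?thesis unfolding L_eq by (simp add: algebra_simps)
  qed
  have "0 \<le> L"
  proof (rule ccontr)
    assume neg: "\<not> 0 \<le> L"
    define k where "k = 2 * q / m ^ 3"
    have k: "0 \<le> k" using q m by (simp add: k_def)
    \<comment> \<open>so small that the quadratic error is at most half of the linear gain\<close>
    define t where "t = min (m / 2) (- L / (2 * (k + 1)))"
    have t: "0 < t" "t \<le> m / 2" "t \<le> - L / (2 * (k + 1))" using neg m k by (auto simp: t_def field_simps)
    have "0 \<le> t * (L + t * k)" using key[OF t(1,2)] by (simp add: k_def power2_eq_square algebra_simps)
    then have "0 \<le> L + t * k" using t by (simp add: zero_le_mult_iff)
    moreover have "t * k \<le> - L / (2 * (k + 1)) * (k + 1)"
      by (rule mult_mono) (use t k neg in auto)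
    moreover have "- L / (2 * (k + 1)) * (k + 1) = - L / 2" using k by (simp add: field_simps)
    ultimately show False using neg by simp
  qed
  then show ?thesis unfolding L_def .
qed

lemma set_integral_positive_part_kernel:
  fixes g :: "real \<Rightarrow> real"
  assumes "0 \<le> r" "r \<le> q"
  shows "(LBINT s:{0..q}. g s * max 0 (r - s)) = (LBINT s:{0..r}. g s * (r - s))"
  unfolding set_lebesgue_integral_def
  by (rule Bochner_Integration.integral_cong[OF refl]) (use assms in \<open>auto split: split_indicator\<close>)

text \<open>
  Both first order terms are integrals of $(1/\phi_\mu^2 - \xi'')$ against the kernel $(r-s)^+$; by Taylor's formula
  they become values of the function \<open>Y\<close> whose second derivative is this factor.
\<close>

lemma variation_moving_mass_to_point:
  assumes \<mu>: "\<mu> \<in> Pr01"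
    and min: "\<forall>\<nu>\<in>Pr01. crisanti_sommers \<xi> h \<mu> \<le> crisanti_sommers \<xi> h \<nu>"
    and dd: "\<forall>x\<in>{0..1}. deriv (deriv \<xi>) x = \<xi>2 x"
    and c\<xi>: "continuous_on {0..1} \<xi>2"
    and x: "0 \<le> x" "x \<le> q" and q: "q < 1"
    and Y: "\<And>r. 0 \<le> r \<Longrightarrow> r \<le> q \<Longrightarrow>
      (LBINT s:{0..r}. (1 / (phi_ext \<mu> s)\<^sup>2 - \<xi>2 s) * (r - s)) = Y r - Y 0 + h\<^sup>2 * r"
  shows "(\<integral>r. indicator {0..q} r * (Y r - Y x) \<partial>\<mu>) \<le> 0"
proof -
  note fin = minimizer_finite[OF min]
  note pos = finite_crisanti_sommers(1)[OF \<mu> fin dd]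
  define T where "T r = (if r \<le> q then x else r)" for r
  have T: "T \<in> borel_measurable borel" "\<And>r. r \<in> {0..1} \<Longrightarrow> T r \<in> {0..1}"
      "\<And>r. q < r \<Longrightarrow> T r = r" "\<And>r. r \<le> q \<Longrightarrow> T r \<le> q"
    unfolding T_def using x q by (measurable, auto)
  have q0: "0 \<le> q" using x by simp
  define \<mu>' where "\<mu>' = distr \<mu> borel01 T"
  have \<mu>': "\<mu>' \<in> Pr01" unfolding \<mu>'_def by (rule distr_Pr01(2)[OF \<mu> T(1,2)])
  have T\<mu>: "T \<in> \<mu> \<rightarrow>\<^sub>M borel01" by (rule distr_Pr01(1)[OF \<mu> T(1,2)])
  define G where "G s = 1 / (phi_ext \<mu> s)\<^sup>2 - \<xi>2 s" for s
  have cG: "continuous_on {0..q} G" unfolding G_def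
    by (intro continuous_intros phi_ext_props(5)[OF \<mu>] continuous_on_subset[OF c\<xi>])
       (use pos q x in \<open>force+\<close>)
  have iG: "set_integrable lborel {0..q} G" by (rule borel_integrable_atLeastAtMost'[OF cG])
  define W where "W r = (LBINT s:{0..q}. G s * max 0 (r - s))" for r
  have q1: "q \<le> 1" using q by simp
  note K = stop_loss_Fubini[OF \<mu> iG q1, folded W_def] and K' = stop_loss_Fubini[OF \<mu>' iG q1, folded W_def]
  have W01: "W \<in> borel_measurable borel01" using K'(3) unfolding \<mu>'_def by auto
  have WT: "integrable \<mu> (\<lambda>r. W (T r))" using K'(3) unfolding \<mu>'_def by (simp add: integrable_distr_eq[OF T\<mu> W01])
  have W': "(\<integral>r. W r \<partial>\<mu>') = (\<integral>r. W (T r) \<partial>\<mu>)" unfolding \<mu>'_def by (rule integral_distr[OF T\<mu> W01])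
  have Wr: "W r = Y r - Y 0 + h\<^sup>2 * r" if "0 \<le> r" "r \<le> q" for r
    unfolding W_def set_integral_positive_part_kernel[OF that] G_def by (rule Y[OF that])
  have "(\<integral>r. indicator {0..q} r * (Y r - Y x) \<partial>\<mu>) = (\<integral>r. (W r - W (T r)) - h\<^sup>2 * (r - T r) \<partial>\<mu>)"
  proof (rule Bochner_Integration.integral_cong[OF refl])
    fix r assume "r \<in> space \<mu>"
    then have r: "0 \<le> r" "r \<le> 1" by (auto simp: Pr01D(3)[OF \<mu>])
    show "indicator {0..q} r * (Y r - Y x) = (W r - W (T r)) - h\<^sup>2 * (r - T r)"
      using Wr[of r] Wr[of x] r x by (auto simp: T_def algebra_simps)
  qed
  also have "\<dots> = ((\<integral>r. W r \<partial>\<mu>) - (\<integral>r. W (T r) \<partial>\<mu>)) - h\<^sup>2 * ((\<integral>r. r \<partial>\<mu>) - (\<integral>r. T r \<partial>\<mu>))"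
  proof -
    have i: "integrable \<mu> (\<lambda>r. r)" "integrable \<mu> T"
      by (rule Pr01_integrable[OF \<mu>, where B=1]; use T in force)+
    show ?thesis using WT K(3) i by simp
  qed
  also have "(\<integral>r. W r \<partial>\<mu>) - (\<integral>r. W (T r) \<partial>\<mu>) = (LBINT s:{0..q}. G s * (stop_loss \<mu> s - stop_loss \<mu>' s))"
    unfolding K(1)[symmetric] W'[symmetric] K'(1)[symmetric]
    by (subst set_integral_diff(2)[OF K(2) K'(2), symmetric]) (simp add: algebra_simps)
  also have "(\<integral>r. r \<partial>\<mu>) - (\<integral>r. T r \<partial>\<mu>) = stop_loss \<mu> 0 - stop_loss \<mu>' 0"
  proof -
    have "(\<integral>r. r \<partial>\<mu>) = stop_loss \<mu> 0" unfolding stop_loss_def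
      by (rule Bochner_Integration.integral_cong) (auto simp: Pr01D(3)[OF \<mu>])
    moreover have "(\<integral>r. T r \<partial>\<mu>) = (\<integral>r. r \<partial>\<mu>')" unfolding \<mu>'_def
      by (rule integral_distr[OF T\<mu>, symmetric]) (rule measurable_restrict_space1, simp)
    moreover have "(\<integral>r. r \<partial>\<mu>') = stop_loss \<mu>' 0" unfolding stop_loss_def
      by (rule Bochner_Integration.integral_cong) (auto simp: Pr01D(3)[OF \<mu>'])
    ultimately show ?thesis by simp
  qed
  also have "(LBINT s:{0..q}. G s * (stop_loss \<mu> s - stop_loss \<mu>' s)) =
     - (LBINT s:{0..q}. (\<xi>2 s - 1 / (phi_ext \<mu> s)\<^sup>2) * (stop_loss \<mu> s - stop_loss \<mu>' s))"
    unfolding G_def set_lebesgue_integral_def Bochner_Integration.integral_minus[symmetric]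
    by (rule Bochner_Integration.integral_cong[OF refl]) (simp add: algebra_simps)
  finally show ?thesis
    using first_variation[OF \<mu> min dd c\<xi> q0 q T, folded \<mu>'_def] by simp
qed

text \<open>
  The variational inequality at a minimum point of \<open>Y\<close> shows that \<open>Y\<close> equals its minimum
  $\mu$-almost everywhere on $[0,1)$, so coercivity confines this part of the mass to some $[0,q]$.  An
  atom \<open>p\<close> at $1$ would give $\phi_\mu(s) = (1 - p)(1 - s)$ beyond \<open>q\<close>, and the interaction term
  would diverge logarithmically.
\<close>

lemma minimizer_support:
  assumes \<mu>: "\<mu> \<in> Pr01"
    and min: "\<forall>\<nu>\<in>Pr01. crisanti_sommers \<xi> h \<mu> \<le> crisanti_sommers \<xi> h \<nu>"
    and dd: "\<forall>x\<in>{0..1}. deriv (deriv \<xi>) x = \<xi>2 x"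
    and c\<xi>: "continuous_on {0..1} \<xi>2"
    and Y: "\<And>r. 0 \<le> r \<Longrightarrow> r < 1 \<Longrightarrow>
      (LBINT s:{0..r}. (1 / (phi_ext \<mu> s)\<^sup>2 - \<xi>2 s) * (r - s)) = Y r - Y 0 + h\<^sup>2 * r"
    and cY: "continuous_on {0..<1} Y"
    and coercive: "\<And>M. \<exists>q<1. \<forall>r. q \<le> r \<longrightarrow> r < 1 \<longrightarrow> M < Y r"
  obtains q m where "0 \<le> q" "q < 1" "AE r in \<mu>. r \<le> q" "AE r in \<mu>. Y r = m" "\<forall>r\<in>{0..<1}. m \<le> Y r"
proof -
  interpret prob_space \<mu> by (rule Pr01D(1)[OF \<mu>])
  note fin = minimizer_finite[OF min]
  note pos = finite_crisanti_sommers(1)[OF \<mu> fin dd] and int = finite_crisanti_sommers(2)[OF \<mu> fin dd]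
  obtain x where x: "x \<in> {0..<1}" "\<And>r. r \<in> {0..<1} \<Longrightarrow> Y x \<le> Y r"
  proof -
    obtain q where q: "q < 1" "\<And>r. q \<le> r \<Longrightarrow> r < 1 \<Longrightarrow> Y 0 < Y r" using coercive by blast
    have "continuous_on {0..max q 0} Y" by (rule continuous_on_subset[OF cY]) (use q in auto)
    then obtain x where "x \<in> {0..max q 0}" "\<And>r. r \<in> {0..max q 0} \<Longrightarrow> Y x \<le> Y r"
      using continuous_attains_inf[of "{0..max q 0}" Y] by auto
    moreover have "Y x \<le> Y r" if "r \<in> {0..<1}" for r
    proof (cases "r \<le> max q 0")
      case True then show ?thesis using calculation(2)[of r] that by simp
    next
      case False
      then have "Y 0 < Y r" using q(2)[of r] that by simp
      then show ?thesis using calculation(2)[of 0] by simp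
    qed
    ultimately show ?thesis using that[of x] q by auto
  qed
  have ae: "AE r in \<mu>. r \<le> q \<longrightarrow> Y r = Y x" if q: "x \<le> q" "q < 1" for q
  proof -
    have "continuous_on {0..q} (\<lambda>r. Y r - Y x)"
      by (intro continuous_intros continuous_on_subset[OF cY]) (use q in auto)
    then have "bounded ((\<lambda>r. Y r - Y x) ` {0..q})"
      by (intro compact_imp_bounded compact_continuous_image) simp_all
    then obtain B where B: "\<forall>r\<in>{0..q}. \<bar>Y r - Y x\<bar> \<le> B"
      unfolding bounded_iff by auto
    have "(\<lambda>r. indicator {0..q} r *\<^sub>R (Y r - Y x)) \<in> borel_measurable borel"
      by (rule borel_measurable_continuous_on_indicator) (use \<open>continuous_on {0..q} (\<lambda>r. Y r - Y x)\<close> in auto)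
    then have "integrable \<mu> (\<lambda>r. indicator {0..q} r *\<^sub>R (Y r - Y x))"
      by (rule Pr01_integrable[OF \<mu>, where B="\<bar>B\<bar>"])
         (use B in \<open>force split: split_indicator\<close>)
    then have i: "integrable \<mu> (\<lambda>r. indicator {0..q} r * (Y r - Y x))" by simp
    have nn: "AE r in \<mu>. 0 \<le> indicator {0..q} r * (Y r - Y x)"
      by (rule AE_I2) (use x(2) q in \<open>auto split: split_indicator\<close>)
    have "(\<integral>r. indicator {0..q} r * (Y r - Y x) \<partial>\<mu>) \<le> 0"
      by (rule variation_moving_mass_to_point[OF \<mu> min dd c\<xi>]) (use x q Y in auto)
    moreover have "0 \<le> (\<integral>r. indicator {0..q} r * (Y r - Y x) \<partial>\<mu>)"
      using nn by (rule integral_nonneg_AE)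
    ultimately have "AE r in \<mu>. indicator {0..q} r * (Y r - Y x) = 0"
      using integral_nonneg_eq_0_iff_AE[OF i nn] by simp
    moreover have "AE r in \<mu>. r \<in> {0..1}" by (rule AE_I2) (simp add: Pr01D(3)[OF \<mu>])
    ultimately show ?thesis by eventually_elim auto
  qed
  have "AE r in \<mu>. \<forall>n::nat. r \<le> 1 - (1 - x) / real (Suc n) \<longrightarrow> Y r = Y x"
    unfolding AE_all_countable
  proof
    fix n show "AE r in \<mu>. r \<le> 1 - (1 - x) / real (Suc n) \<longrightarrow> Y r = Y x"
    proof (rule ae)
      have "(1 - x) / real (Suc n) \<le> (1 - x) / 1" using x by (intro divide_left_mono) auto
      then show "x \<le> 1 - (1 - x) / real (Suc n)" by simp
      show "1 - (1 - x) / real (Suc n) < 1" using x by simp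
    qed
  qed
  then have aeY: "AE r in \<mu>. r < 1 \<longrightarrow> Y r = Y x"
  proof eventually_elim
    case (elim r)
    show ?case
    proof
      assume r: "r < 1"
      obtain n where "(1 - x) / (1 - r) < real n" using reals_Archimedean2 by blast
      then have "(1 - x) / (1 - r) < real (Suc n)" by simp
      then have "r \<le> 1 - (1 - x) / real (Suc n)" using r by (simp add: field_simps)
      then show "Y r = Y x" using elim by blast
    qed
  qed
  obtain q0 where q0: "q0 < 1" "\<And>r. q0 \<le> r \<Longrightarrow> r < 1 \<Longrightarrow> Y x < Y r" using coercive by blast
  define q where "q = max q0 0"
  have q: "0 \<le> q" "q < 1" "\<And>r. q \<le> r \<Longrightarrow> r < 1 \<Longrightarrow> Y x < Y r" using q0 by (auto simp: q_def)
  have aeq: "AE r in \<mu>. r < 1 \<longrightarrow> r \<le> q"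
    using aeY
  proof eventually_elim
    case (elim r)
    then show ?case using q(3)[of r] by (cases "r \<le> q") auto
  qed
  define p :: real where "p = (\<integral>r. indicator {1} r \<partial>\<mu>)"
  have pi: "integrable \<mu> (indicator {1} :: real \<Rightarrow> real)"
    by (rule Pr01_integrable[OF \<mu>, where B=1]) (auto split: split_indicator)
  have p0: "0 \<le> p" unfolding p_def by (rule Bochner_Integration.integral_nonneg) simp
  have \<phi>: "phi_ext \<mu> s = (1 - p) * (1 - s)" if s: "q \<le> s" "s < 1" for s
  proof -
    have "stop_loss \<mu> s = (\<integral>r. (1 - s) * indicator {1} r \<partial>\<mu>)" unfolding stop_loss_def
    proof (rule integral_cong_AE)
      have "AE r in \<mu>. r \<in> {0..1}" by (rule AE_I2) (simp add: Pr01D(3)[OF \<mu>])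
      with aeq show "AE r in \<mu>. max 0 (r - s) = (1 - s) * indicator {1} r"
        by eventually_elim (use s in \<open>auto split: split_indicator\<close>)
    qed (rule Pr01_measurable[OF \<mu>, of _ borel]; simp)+
    also have "\<dots> = (1 - s) * p" unfolding p_def by (rule integral_mult_right_zero)
    finally show ?thesis by (simp add: phi_ext_def algebra_simps)
  qed
  have "0 < phi_ext \<mu> q" using bspec[OF pos, of q] q by auto
  then have p1: "p < 1" using \<phi>[of q] q by (simp add: zero_less_mult_iff)
  have "p = 0"
  proof (rule ccontr)
    assume "p \<noteq> 0"
    then have pp: "0 < p" using p0 by simp
    define c where "c = 1 / (1 - p) - 1"
    have c: "0 < c" using pp p1 by (simp add: c_def field_simps)
    define B where "B = (LBINT s:{0..<1}. 1 / phi_ext \<mu> s - 1 / (1 - s))"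
    have B0: "0 \<le> B" unfolding B_def set_lebesgue_integral_def
      by (rule Bochner_Integration.integral_nonneg) (rule interaction_nonneg[OF \<mu> pos])
    \<comment> \<open>chosen so that the integral of $c/(1-s)$ from \<open>q\<close> to \<open>t\<close> equals $B + 1$\<close>
    define t where "t = 1 - (1 - q) * exp (- (B + 1) / c)"
    have e1: "exp (- (B + 1) / c) \<le> 1" using B0 c by (simp add: divide_le_0_iff)
    have "(1 - q) * exp (- (B + 1) / c) \<le> 1 - q"
      by (rule mult_left_le[OF e1]) (use q in simp)
    moreover have "0 < (1 - q) * exp (- (B + 1) / c)" using q by simp
    ultimately have t: "q \<le> t" "t < 1" unfolding t_def by linarith+
    have "(LBINT s:{q..t}. c * (1 / (1 - s))) = - c * ln (1 - t) - - c * ln (1 - q)"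
    proof (rule LBINT_FTC[OF t(1)])
      fix s assume "q \<le> s" "s \<le> t"
      then have "0 < 1 - s" using t by simp
      then show "((\<lambda>s. - c * ln (1 - s)) has_real_derivative c * (1 / (1 - s))) (at s within {q..t})"
        by (auto intro!: derivative_eq_intros simp: field_simps)
    next
      show "continuous_on {q..t} (\<lambda>s. c * (1 / (1 - s)))"
        by (intro continuous_intros) (use t in auto)
    qed
    also have "\<dots> = B + 1"
    proof -
      have "ln (1 - t) = ln (1 - q) + - (B + 1) / c"
        unfolding t_def using q by (simp add: ln_mult)
      then show ?thesis using c by (simp add: field_simps)
    qed
    finally have 1: "(LBINT s:{q..t}. c * (1 / (1 - s))) = B + 1" .
    have "(LBINT s:{q..t}. c * (1 / (1 - s))) \<le> B"
      unfolding B_def set_lebesgue_integral_def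
    proof (rule integral_mono)
      show "integrable lborel (\<lambda>s. indicator {q..t} s *\<^sub>R (c * (1 / (1 - s))))"
        unfolding set_integrable_def[symmetric]
        by (intro borel_integrable_atLeastAtMost' continuous_intros) (use t in auto)
      show "integrable lborel (\<lambda>s. indicator {0..<1} s *\<^sub>R (1 / phi_ext \<mu> s - 1 / (1 - s)))"
        using int unfolding set_integrable_def .
      fix s
      show "indicator {q..t} s *\<^sub>R (c * (1 / (1 - s))) \<le> indicator {0..<1} s *\<^sub>R (1 / phi_ext \<mu> s - 1 / (1 - s))"
      proof (cases "s \<in> {q..t}")
        case True
        then have "1 / phi_ext \<mu> s - 1 / (1 - s) = c * (1 / (1 - s))"
        proof -
          have "1 / (u * v) - 1 / v = (1 / u - 1) * (1 / v)" for u v :: real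
            by (simp add: diff_divide_distrib)
          moreover have "phi_ext \<mu> s = (1 - p) * (1 - s)" using \<phi>[of s] True t by simp
          ultimately show ?thesis unfolding c_def by simp
        qed
        then show ?thesis using True q t by auto
      next
        case False
        then show ?thesis using interaction_nonneg[OF \<mu> pos, of s] by simp
      qed
    qed
    with 1 show False by simp
  qed
  then have "AE r in \<mu>. indicator {1} r = (0::real)"
    using integral_nonneg_eq_0_iff_AE[OF pi] unfolding p_def by simp
  moreover have "AE r in \<mu>. r \<in> {0..1}" by (rule AE_I2) (simp add: Pr01D(3)[OF \<mu>])
  ultimately have lt1: "AE r in \<mu>. r < 1"
    by eventually_elim (auto simp: less_le split: split_indicator_asm)
  show thesis
  proof (rule that[of q "Y x"])
    show "AE r in \<mu>. r \<le> q" using lt1 aeq by eventually_elim simp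
    show "AE r in \<mu>. Y r = Y x" using lt1 aeY by eventually_elim simp
  qed (use q x in auto)
qed

section \<open>Duality\<close>

text \<open>
  Beyond \<open>q\<close> one has $\phi_\mu(s) = 1 - s$, so that the dual integrand \<open>K\<close> and the squared term
  \<open>E\<close> of the gap differ only on $[0,q]$, by integrable terms.  The pointwise identity \<open>K + B = E + R\<close> between non-negative functions
  can therefore be integrated even when \<open>K\<close> and \<open>E\<close> have infinite
  integral.  The cut-off $\min(r,q)$ keeps \<open>\<eta>\<close> within the range where it is continuous.
\<close>

lemma duality_gap:
  fixes g :: "real \<Rightarrow> real"
  assumes \<mu>: "\<mu> \<in> Pr01"
    and pos: "\<forall>s\<in>{0..<1}. 0 < phi_ext \<mu> s"
    and int: "set_integrable lborel {0..<1} (\<lambda>s. 1 / phi_ext \<mu> s - 1 / (1 - s))"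
    and dd: "\<forall>x\<in>{0..1}. deriv (deriv \<xi>) x = \<xi>2 x"
    and c\<xi>: "continuous_on {0..1} \<xi>2"
    and \<xi>_taylor: "\<forall>r\<in>{0..1}. (LBINT s:{0..r}. \<xi>2 s * (r - s)) = \<xi> r"
    and c\<xi>0: "continuous_on {0..1} \<xi>"
    and q: "0 \<le> q" "q < 1" and supp: "AE r in \<mu>. r \<le> q"
    and \<eta>: "\<eta> \<in> Lambda \<xi> h"
  shows "dual_functional \<xi> h \<eta> = crisanti_sommers \<xi> h \<mu> - ereal (1/2) *
     (enn2ereal (\<integral>\<^sup>+s\<in>{0..<1}. ennreal (phi_ext \<mu> s * (sqrt (distr_deriv2 \<eta> s) - 1 / phi_ext \<mu> s)\<^sup>2) \<partial>lborel)
      + ereal (\<integral>r. \<eta> (min r q) - \<xi> (min r q) \<partial>\<mu>))"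
    and "integrable \<mu> (\<lambda>r. \<eta> (min r q) - \<xi> (min r q))"
proof -
  interpret prob_space \<mu> by (rule Pr01D(1)[OF \<mu>])
  have \<xi>T: "(LBINT s:{0..r}. \<xi>2 s * (r - s)) = \<xi> r" if "0 \<le> r" "r \<le> 1" for r
    using \<xi>_taylor that by auto
  define g where "g = distr_deriv2 \<eta>"
  have \<eta>X: "\<eta> \<in> X_space" and \<eta>0: "deriv1 \<eta> 0 = - h\<^sup>2"
    and g0: "AE s in lborel. s \<in> {0..<1} \<longrightarrow> 0 \<le> g s"
    using \<eta> by (auto simp: Lambda_def g_def)
  have gd: "is_distr_deriv2 \<eta> g" unfolding g_def by (rule X_space_distr_deriv2(1)[OF \<eta>X])
  have [measurable]: "g \<in> borel_measurable borel" using gd by (simp add: is_distr_deriv2_def)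
  have grep: "deriv1 \<eta> b - deriv1 \<eta> 0 = (LBINT s:{0..b}. g s)" if "0 \<le> b" "b < 1" for b
    unfolding g_def by (rule X_space_distr_deriv2(2)[OF \<eta>X]) (use that in auto)
  have gi: "set_integrable lborel {0..r} g" if "r < 1" for r
    by (rule is_distr_deriv2_set_integrable[OF gd order_refl that])
  note [measurable] = borel_measurable_phi_ext[OF \<mu>]
  let ?\<phi> = "phi_ext \<mu>"
  have T\<eta>: "(LBINT s:{0..r}. g s * (r - s)) = \<eta> r - \<eta> 0 + h\<^sup>2 * r" if "0 \<le> r" "r < 1" for r
    using taylor_weak[of \<eta> "deriv1 \<eta>" g r] \<eta>X grep gi[OF that(2)] that \<eta>0
    by (simp add: X_space_def)
  have sl0: "stop_loss \<mu> s = 0" if "q \<le> s" for s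
  proof -
    have "stop_loss \<mu> s = (\<integral>r. 0 \<partial>\<mu>)" unfolding stop_loss_def
      by (rule integral_cong_AE) (use supp that in \<open>auto intro: Pr01_measurable[OF \<mu>, of _ borel]\<close>)
    then show ?thesis by simp
  qed
  define K where "K s = - (2 * sqrt (g s) - g s * (1 - s) - 1 / (1 - s))" for s
  define B where "B s = 1 / ?\<phi> s - 1 / (1 - s)" for s
  define E where "E s = ?\<phi> s * (sqrt (g s) - 1 / ?\<phi> s)\<^sup>2" for s
  define R where "R s = indicator {0..q} s * (g s * stop_loss \<mu> s)" for s
  have iR: "integrable lborel R"
    using stop_loss_Fubini(2)[OF \<mu> gi[OF q(2)]] q unfolding R_def set_integrable_def by simp
  have square: "a * (sqrt y - 1 / a)\<^sup>2 = y * a + 1 / a - 2 * sqrt y" if "0 < a" "0 \<le> y" for a y :: real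
    using that by (simp add: power2_eq_square field_simps)
  have K_eq: "K s + B s = E s + R s" if s: "s \<in> {0..<1}" "0 \<le> g s" for s
  proof -
    have p: "0 < ?\<phi> s" using pos s by auto
    have "E s = g s * ?\<phi> s + 1 / ?\<phi> s - 2 * sqrt (g s)"
      using square[OF p s(2)] by (simp add: E_def)
    moreover have "R s = g s * (1 - s - ?\<phi> s)"
      using sl0[of s] s by (cases "s \<le> q") (simp_all add: R_def phi_ext_def)
    ultimately show ?thesis by (simp add: K_def B_def algebra_simps)
  qed
  have nonneg: "0 \<le> K s" "0 \<le> B s" "0 \<le> E s" "0 \<le> R s" if s: "s \<in> {0..<1}" "0 \<le> g s" for s
  proof -
    have p: "0 < ?\<phi> s" "0 < 1 - s" using pos s by auto
    have "K s = (1 - s) * (sqrt (g s) - 1 / (1 - s))\<^sup>2"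
      using square[OF p(2) s(2)] by (simp add: K_def)
    then show "0 \<le> K s" using p by simp
    show "0 \<le> B s" using interaction_nonneg[OF \<mu> pos, of s] s by (simp add: B_def)
    show "0 \<le> E s" using p by (simp add: E_def)
    show "0 \<le> R s" using s stop_loss_bounds(1)[OF \<mu>] by (simp add: R_def)
  qed
  have [measurable]: "K \<in> borel_measurable borel" "B \<in> borel_measurable borel" "E \<in> borel_measurable borel"
    unfolding K_def[abs_def] B_def[abs_def] E_def[abs_def] by measurable
  have [measurable]: "R \<in> borel_measurable borel" using iR by auto
  let ?K = "\<integral>\<^sup>+s\<in>{0..<1}. ennreal (K s) \<partial>lborel" and ?E = "\<integral>\<^sup>+s\<in>{0..<1}. ennreal (E s) \<partial>lborel"
  let ?B = "\<integral>\<^sup>+s\<in>{0..<1}. ennreal (B s) \<partial>lborel" and ?R = "\<integral>\<^sup>+s\<in>{0..<1}. ennreal (R s) \<partial>lborel"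
  have balance: "?K + ?B = ?E + ?R"
  proof -
    have "?K + ?B = (\<integral>\<^sup>+s. ennreal (K s) * indicator {0..<1} s + ennreal (B s) * indicator {0..<1} s \<partial>lborel)"
      by (rule nn_integral_add[symmetric]) measurable
    also have "\<dots> = (\<integral>\<^sup>+s. ennreal (E s) * indicator {0..<1} s + ennreal (R s) * indicator {0..<1} s \<partial>lborel)"
    proof (rule nn_integral_cong_AE)
      show "AE s in lborel. ennreal (K s) * indicator {0..<1} s + ennreal (B s) * indicator {0..<1} s
          = ennreal (E s) * indicator {0..<1} s + ennreal (R s) * indicator {0..<1} s"
        using g0
      proof eventually_elim
        case (elim s)
        then show ?case
          using K_eq[of s] nonneg[of s] by (cases "s \<in> {0..<1}") (auto simp: ennreal_plus[symmetric] simp del: ennreal_plus)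
      qed
    qed
    also have "\<dots> = ?E + ?R" by (rule nn_integral_add) measurable
    finally show ?thesis .
  qed
  define b where "b = (LBINT s:{0..<1}. 1 / ?\<phi> s - 1 / (1 - s))"
  have b0: "0 \<le> b" unfolding b_def set_lebesgue_integral_def
    by (rule Bochner_Integration.integral_nonneg) (rule interaction_nonneg[OF \<mu> pos])
  have B_eq: "?B = ennreal b"
  proof -
    have "?B = (\<integral>\<^sup>+s. ennreal (indicator {0..<1} s *\<^sub>R (1 / ?\<phi> s - 1 / (1 - s))) \<partial>lborel)"
      by (rule nn_integral_cong) (auto simp: B_def split: split_indicator)
    also have "\<dots> = ennreal b" unfolding b_def set_lebesgue_integral_def
      by (rule nn_integral_eq_integral) (use int interaction_nonneg[OF \<mu> pos] in \<open>auto simp: set_integrable_def\<close>)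
    finally show ?thesis .
  qed
  define w where "w = (LBINT s:{0..q}. g s * stop_loss \<mu> s)"
  have R_eq: "?R = ennreal w" and w0: "0 \<le> w"
  proof -
    have ae: "AE s in lborel. 0 \<le> R s"
      using g0 by eventually_elim (use q stop_loss_bounds(1)[OF \<mu>] in \<open>auto simp: R_def split: split_indicator\<close>)
    have "?R = (\<integral>\<^sup>+s. ennreal (R s) \<partial>lborel)"
      by (rule nn_integral_cong) (use q in \<open>auto simp: R_def split: split_indicator\<close>)
    also have "\<dots> = ennreal (LBINT s. R s)"
      by (rule nn_integral_eq_integral[OF iR ae])
    also have eq: "(LBINT s. R s) = w" by (simp add: w_def R_def set_lebesgue_integral_def)
    finally show "?R = ennreal w" .
    show "0 \<le> w" unfolding eq[symmetric] by (rule integral_nonneg_AE[OF ae])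
  qed
  have q1: "q \<le> 1" using q by simp
  define W where "W r = (LBINT s:{0..q}. g s * max 0 (r - s))" for r
  note W = stop_loss_Fubini[OF \<mu> gi[OF q(2)] q1, folded w_def, folded W_def]
  have ae01: "AE r in \<mu>. 0 \<le> r \<and> r \<le> q"
  proof -
    have "AE r in \<mu>. r \<in> {0..1}" by (rule AE_I2) (simp add: Pr01D(3)[OF \<mu>])
    with supp show ?thesis by eventually_elim simp
  qed
  have c\<eta>: "continuous_on {0..<1} \<eta>"
    using \<eta>X by (auto simp: X_space_def intro!: DERIV_continuous_on)
  have imin: "integrable \<mu> (\<lambda>r. f (min r q))" if cf: "continuous_on {0..q} f" for f :: "real \<Rightarrow> real"
  proof -
    have "bounded (f ` {0..q})"
      by (intro compact_imp_bounded compact_continuous_image cf) simp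
    then obtain C where C: "\<forall>r\<in>{0..q}. \<bar>f r\<bar> \<le> C"
      unfolding bounded_iff by auto
    have "continuous_on UNIV (\<lambda>r. f (max 0 (min r q)))"
      by (rule continuous_on_compose2[OF cf]) (use q in \<open>auto intro!: continuous_intros\<close>)
    then have "integrable \<mu> (\<lambda>r. f (max 0 (min r q)))"
      by (intro Pr01_integrable[OF \<mu>, where B=C] borel_measurable_continuous_onI bspec[OF C]) (use q in auto)
    then show ?thesis
      by (rule Bochner_Integration.integrable_cong[THEN iffD1, rotated -1])
         (use q in \<open>auto simp: Pr01D(3)[OF \<mu>]\<close>)
  qed
  have i\<eta>: "integrable \<mu> (\<lambda>r. \<eta> (min r q))"
    by (rule imin, rule continuous_on_subset[OF c\<eta>]) (use q in auto)
  have i\<xi>: "integrable \<mu> (\<lambda>r. \<xi> (min r q))"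
    by (rule imin, rule continuous_on_subset[OF c\<xi>0]) (use q in auto)
  show "integrable \<mu> (\<lambda>r. \<eta> (min r q) - \<xi> (min r q))" using i\<eta> i\<xi> by simp
  have iid: "integrable \<mu> (\<lambda>r. r)" by (rule Pr01_integrable[OF \<mu>, where B=1]) auto
  have sl_id: "stop_loss \<mu> 0 = (\<integral>r. r \<partial>\<mu>)" unfolding stop_loss_def
    by (rule Bochner_Integration.integral_cong) (auto simp: Pr01D(3)[OF \<mu>])
  have w_eq: "w = (\<integral>r. \<eta> (min r q) \<partial>\<mu>) - \<eta> 0 + h\<^sup>2 * stop_loss \<mu> 0"
  proof -
    have "w = (\<integral>r. \<eta> (min r q) - \<eta> 0 + h\<^sup>2 * r \<partial>\<mu>)" unfolding W(1)
    proof (rule integral_cong_AE)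
      show "AE r in \<mu>. W r = \<eta> (min r q) - \<eta> 0 + h\<^sup>2 * r"
        using ae01
      proof eventually_elim
        case (elim r)
        then show ?case unfolding W_def using set_integral_positive_part_kernel[of r q g] T\<eta>[of r] q by simp
      qed
    next
      show "W \<in> borel_measurable \<mu>" by (rule borel_measurable_integrable[OF W(3)])
      show "(\<lambda>r. \<eta> (min r q) - \<eta> 0 + h\<^sup>2 * r) \<in> borel_measurable \<mu>"
        by (intro borel_measurable_integrable Bochner_Integration.integrable_add
              Bochner_Integration.integrable_diff integrable_mult_right i\<eta> iid integrable_const)
    qed
    also have "\<dots> = (\<integral>r. \<eta> (min r q) \<partial>\<mu>) - \<eta> 0 + h\<^sup>2 * (\<integral>r. r \<partial>\<mu>)"
      using i\<eta> iid by (simp add: prob_space)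
    finally show ?thesis by (simp add: sl_id)
  qed
  have A_eq: "(LBINT s:{0..1}. \<xi>2 s * ?\<phi> s) = \<xi> 1 - (\<integral>r. \<xi> (min r q) \<partial>\<mu>)"
  proof -
    have i\<xi>2: "set_integrable lborel {0..1} \<xi>2" by (rule borel_integrable_atLeastAtMost'[OF c\<xi>])
    note S = stop_loss_Fubini[OF \<mu> i\<xi>2 order_refl]
    have "(LBINT s:{0..1}. \<xi>2 s * ?\<phi> s) = (LBINT s:{0..1}. \<xi>2 s * (1 - s) - \<xi>2 s * stop_loss \<mu> s)"
      by (simp add: phi_ext_def algebra_simps)
    also have "\<dots> = (LBINT s:{0..1}. \<xi>2 s * (1 - s)) - (LBINT s:{0..1}. \<xi>2 s * stop_loss \<mu> s)"
      by (intro set_integral_diff(2) S borel_integrable_atLeastAtMost' continuous_intros c\<xi>)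
    also have "(LBINT s:{0..1}. \<xi>2 s * (1 - s)) = \<xi> 1" by (rule \<xi>T) auto
    also have "(LBINT s:{0..1}. \<xi>2 s * stop_loss \<mu> s) = (\<integral>r. \<xi> (min r q) \<partial>\<mu>)"
      unfolding S(1)
    proof (rule integral_cong_AE)
      show "AE r in \<mu>. (LBINT s:{0..1}. \<xi>2 s * max 0 (r - s)) = \<xi> (min r q)"
        using ae01
      proof eventually_elim
        case (elim r)
        then show ?case using set_integral_positive_part_kernel[of r 1 \<xi>2] \<xi>T[of r] q by simp
      qed
    qed (rule borel_measurable_integrable[OF S(3)] borel_measurable_integrable[OF i\<xi>])+
    finally show ?thesis .
  qed
  have P: "crisanti_sommers \<xi> h \<mu> = ereal (1/2 * (\<xi> 1 - (\<integral>r. \<xi> (min r q) \<partial>\<mu>) + b + h\<^sup>2 * (1 - stop_loss \<mu> 0)))"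
    unfolding crisanti_sommers_eq_real[OF \<mu> pos int dd] A_eq b_def by (simp add: phi_ext_def)
  have D: "dual_functional \<xi> h \<eta> = ereal (1/2) * (- enn2ereal ?K + ereal (- \<eta> 0 + h\<^sup>2 + \<xi> 1))"
    unfolding dual_functional_def K_def g_def ..
  have gap: "(\<integral>r. \<eta> (min r q) - \<xi> (min r q) \<partial>\<mu>) = (\<integral>r. \<eta> (min r q) \<partial>\<mu>) - (\<integral>r. \<xi> (min r q) \<partial>\<mu>)"
    by (rule Bochner_Integration.integral_diff[OF i\<eta> i\<xi>])
  have "dual_functional \<xi> h \<eta> = crisanti_sommers \<xi> h \<mu> - ereal (1/2) *
     (enn2ereal ?E + ereal (\<integral>r. \<eta> (min r q) - \<xi> (min r q) \<partial>\<mu>))"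
  proof (cases "?E = \<infinity>")
    case True
    then have "?K + ennreal b = \<infinity>" using balance unfolding B_eq by simp
    then have "?K = \<infinity>" by simp
    with True show ?thesis unfolding D P by simp
  next
    case False
    then obtain e where e: "0 \<le> e" "?E = ennreal e" by (cases ?E) auto
    have "?K + ennreal b = ennreal (e + w)" using balance e w0 unfolding B_eq R_eq by simp
    moreover from this obtain k where k: "0 \<le> k" "?K = ennreal k" by (cases ?K) auto
    ultimately have "k + b = e + w"
      using b0 e w0 by (simp add: ennreal_plus[symmetric] del: ennreal_plus)
    then have k_eq: "k = e + w - b" by simp
    show ?thesis unfolding D P gap e(2) k(2)
      using e(1) k(1) by (simp add: k_eq w_eq algebra_simps)
  qed
  then show "dual_functional \<xi> h \<eta> = crisanti_sommers \<xi> h \<mu> - ereal (1/2) *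
     (enn2ereal (\<integral>\<^sup>+s\<in>{0..<1}. ennreal (phi_ext \<mu> s * (sqrt (distr_deriv2 \<eta> s) - 1 / phi_ext \<mu> s)\<^sup>2) \<partial>lborel)
      + ereal (\<integral>r. \<eta> (min r q) - \<xi> (min r q) \<partial>\<mu>))"
    unfolding E_def g_def .
qed

lemma has_derivative_integral_Ico:
  fixes f :: "real \<Rightarrow> real"
  assumes f: "continuous_on {0..<1} f" and t: "t \<in> {0..<1}"
  shows "((\<lambda>x. integral {0..x} f) has_real_derivative f t) (at t within {0..<1})"
proof -
  define b where "b = (1 + t) / 2"
  have b: "t < b" "b < 1" "0 \<le> t" using t by (auto simp: b_def)
  have "((\<lambda>x. integral {0..x} f) has_real_derivative f t) (at t within {0..b})"
    by (rule integral_has_real_derivative[OF continuous_on_subset[OF f]]) (use b in auto)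
  moreover have "at t within {0..b} = at t within {0..<1}"
    by (rule at_within_nhd[where S="{..<b}"]) (use b in auto)
  ultimately show ?thesis by simp
qed

text \<open>
  One-sided derivatives along $[0,1)$ are unique, because no point of this interval is isolated to
  its right.
\<close>

lemma deriv1_eqI:
  assumes s: "s \<in> {0..<1}" and "(\<eta> has_real_derivative e) (at s within {0..<1})"
  shows "deriv1 \<eta> s = e"
  unfolding deriv1_def
proof (rule vector_derivative_within)
  have "at_right s = at s within {s<..<1}" using s by (intro at_within_nhd[where S="{..<1}"]) auto
  also have "\<dots> \<le> at s within {0..<1}" by (rule at_le) (use s in auto)
  finally have "at_right s \<le> at s within {0..<1}" .
  moreover have "at_right s \<noteq> bot" by simp
  ultimately show "at s within {0..<1} \<noteq> bot" by (auto simp: bot_unique)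
qed (use assms in \<open>simp add: has_real_derivative_iff_has_vector_derivative\<close>)

text \<open>
  Since $\phi_\mu(s) \le 1 - s$, a function with second derivative $1/\phi_\mu^2$ grows at least like
  the function $-\ln(1-r)$, whose second derivative is $1/(1-r)^2$.
\<close>

lemma log_lower_bound:
  assumes \<mu>: "\<mu> \<in> Pr01" and pos: "\<forall>s\<in>{0..<1}. 0 < phi_ext \<mu> s" and r: "0 \<le> r" "r < 1"
  shows "- ln (1 - r) - r \<le> (LBINT s:{0..r}. (1 / (phi_ext \<mu> s)\<^sup>2) * (r - s))"
proof -
  have "- ln (1 - r) - r = (LBINT s:{0..r}. (1 / (1 - s)\<^sup>2) * (r - s))"
  proof -
    have "(LBINT s:{0..r}. (1 / (1 - s)\<^sup>2) * (r - s)) =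
       (- (r - r) * (1 - 1 / (1 - r)) - ln (1 - r) - r) - (- (r - 0) * (1 - 1 / (1 - 0)) - ln (1 - 0) - 0)"
    proof (rule LBINT_FTC)
      fix s assume "0 \<le> s" "s \<le> r"
      then have p: "0 < 1 - s" using r by simp
      have "((\<lambda>s. - (r - s) * (1 - 1 / (1 - s)) - ln (1 - s) - s) has_real_derivative
         (1 - 1 / (1 - s)) + (r - s) * (1 / (1 - s)\<^sup>2) + 1 / (1 - s) - 1) (at s within {0..r})"
        using p by (auto intro!: derivative_eq_intros simp: power2_eq_square diff_divide_distrib)
      then show "((\<lambda>s. - (r - s) * (1 - 1 / (1 - s)) - ln (1 - s) - s) has_real_derivative
         (1 / (1 - s)\<^sup>2) * (r - s)) (at s within {0..r})" by (simp add: mult.commute)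
    next
      show "continuous_on {0..r} (\<lambda>s. (1 / (1 - s)\<^sup>2) * (r - s))"
        by (intro continuous_intros) (use r in auto)
    qed (use r in auto)
    then show ?thesis by simp
  qed
  also have "\<dots> \<le> (LBINT s:{0..r}. (1 / (phi_ext \<mu> s)\<^sup>2) * (r - s))"
  proof (rule set_integral_mono)
    show "set_integrable lborel {0..r} (\<lambda>s. (1 / (1 - s)\<^sup>2) * (r - s))"
      by (intro borel_integrable_atLeastAtMost' continuous_intros) (use r in auto)
    show "set_integrable lborel {0..r} (\<lambda>s. (1 / (phi_ext \<mu> s)\<^sup>2) * (r - s))"
      by (intro borel_integrable_atLeastAtMost' continuous_intros phi_ext_props(5)[OF \<mu>]) (use r pos in force)
    fix s assume s: "s \<in> {0..r}"
    have "(phi_ext \<mu> s)\<^sup>2 \<le> (1 - s)\<^sup>2"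
      using phi_ext_props(2,3)[OF \<mu>, of s] s r by (intro power_mono) auto
    moreover have "0 < phi_ext \<mu> s" using pos s r by auto
    ultimately show "(1 / (1 - s)\<^sup>2) * (r - s) \<le> (1 / (phi_ext \<mu> s)\<^sup>2) * (r - s)"
      using s by (intro mult_right_mono divide_left_mono) (auto intro!: mult_pos_pos)
  qed
  finally show ?thesis .
qed

lemma log_coercive: "\<exists>q<1. \<forall>r. q \<le> r \<longrightarrow> r < 1 \<longrightarrow> M < - ln (1 - r) - (1::real)"
proof (intro exI[of _ "1 - exp (- (M + 2))"] conjI allI impI)
  fix r :: real assume r: "1 - exp (- (M + 2)) \<le> r" "r < 1"
  then have "ln (1 - r) \<le> ln (exp (- (M + 2)))" by (subst ln_le_cancel_iff) auto
  then show "M < - ln (1 - r) - 1" by simp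
qed simp

text \<open>
  The solution of $\theta'' = 1/\phi_\mu^2$, shifted so that it touches $\xi$ from above, has no duality
  gap with \<open>\<mu>\<close>.  Hence the maximizer has no gap either, and both non-negative terms of
  the gap vanish.
\<close>

lemma optimality_conditions:
  assumes R: "1 < R" and \<xi>0: "\<xi> 0 = 0" and \<xi>10: "\<xi>1 0 = 0"
    and d1: "\<And>x. \<bar>x\<bar> < R \<Longrightarrow> (\<xi> has_real_derivative \<xi>1 x) (at x)"
    and d2: "\<And>x. \<bar>x\<bar> < R \<Longrightarrow> (\<xi>1 has_real_derivative \<xi>2 x) (at x)"
    and dd: "\<forall>x\<in>{0..1}. deriv (deriv \<xi>) x = \<xi>2 x"
    and c2: "continuous_on {0..1} \<xi>2"
    and mu: "is_arg_min (crisanti_sommers \<xi> h) (\<lambda>\<nu>. \<nu> \<in> Pr01) \<mu>"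
    and eta: "is_arg_max (dual_functional \<xi> h) (\<lambda>\<theta>. \<theta> \<in> Lambda \<xi> h) \<eta>"
  obtains e where "\<mu> \<in> Pr01" "\<forall>s\<in>{0..<1}. 0 < phi_ext \<mu> s" "\<forall>s\<in>{0..<1}. \<xi> s \<le> \<eta> s" "e 0 = - h\<^sup>2"
    "\<And>s. s \<in> {0..<1} \<Longrightarrow> (\<eta> has_real_derivative e s) (at s within {0..<1})"
    "\<And>s. s \<in> {0..<1} \<Longrightarrow> (e has_real_derivative 1 / (phi_ext \<mu> s)\<^sup>2) (at s within {0..<1})"
    "AE r in \<mu>. r \<in> contact_set \<xi> \<eta>"
    "\<exists>q<1. \<forall>r\<in>contact_set \<xi> \<eta>. r \<le> q"
proof -
  have \<mu>: "\<mu> \<in> Pr01" and min: "\<forall>\<nu>\<in>Pr01. crisanti_sommers \<xi> h \<mu> \<le> crisanti_sommers \<xi> h \<nu>"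
    using mu by (auto simp: is_arg_min_def not_less)
  have \<eta>: "\<eta> \<in> Lambda \<xi> h" and max: "\<forall>\<theta>\<in>Lambda \<xi> h. dual_functional \<xi> h \<theta> \<le> dual_functional \<xi> h \<eta>"
    using eta by (auto simp: is_arg_max_def not_less)
  note fin = minimizer_finite[OF min]
  note pos = finite_crisanti_sommers(1)[OF \<mu> fin dd] and int = finite_crisanti_sommers(2)[OF \<mu> fin dd]
  interpret prob_space \<mu> by (rule Pr01D(1)[OF \<mu>])
  have c\<xi>: "continuous_on {0..1} \<xi>"
    by (rule continuous_at_imp_continuous_on) (use R in \<open>auto intro!: DERIV_isCont d1\<close>)
  have \<xi>T: "(LBINT s:{0..r}. \<xi>2 s * (r - s)) = \<xi> r" if r: "0 \<le> r" "r \<le> 1" for r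
  proof -
    have "(LBINT s:{0..r}. \<xi>2 s * (r - s)) = ((r - r) * \<xi>1 r + \<xi> r) - ((r - 0) * \<xi>1 0 + \<xi> 0)"
    proof (rule LBINT_FTC[OF r(1)])
      fix s assume s: "0 \<le> s" "s \<le> r"
      then have "\<bar>s\<bar> < R" using r R by simp
      note d = has_field_derivative_at_within[OF d1[OF this]] has_field_derivative_at_within[OF d2[OF this]]
      show "((\<lambda>s. (r - s) * \<xi>1 s + \<xi> s) has_real_derivative \<xi>2 s * (r - s)) (at s within {0..r})"
        by (auto intro!: derivative_eq_intros d)
    next
      show "continuous_on {0..r} (\<lambda>s. \<xi>2 s * (r - s))"
        by (intro continuous_intros continuous_on_subset[OF c2]) (use r in auto)
    qed
    then show ?thesis by (simp add: \<xi>0 \<xi>10)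
  qed
  define k where "k s = 1 / (phi_ext \<mu> s)\<^sup>2" for s
  have ck: "continuous_on {0..<1} k" unfolding k_def
    by (intro continuous_intros phi_ext_props(5)[OF \<mu>]) (use pos in force)
  define e where "e b = - h\<^sup>2 + integral {0..b} k" for b
  have de: "(e has_real_derivative k s) (at s within {0..<1})" if "s \<in> {0..<1}" for s
    unfolding e_def[abs_def] using has_derivative_integral_Ico[OF ck that]
    by (auto intro!: derivative_eq_intros)
  have e0: "e 0 = - h\<^sup>2" by (simp add: e_def)
  have ce: "continuous_on {0..<1} e" by (rule DERIV_continuous_on[OF de])
  define \<eta>0 where "\<eta>0 r = integral {0..r} e" for r
  have d\<eta>0: "(\<eta>0 has_real_derivative e s) (at s within {0..<1})" if "s \<in> {0..<1}" for s
    unfolding \<eta>0_def[abs_def] by (rule has_derivative_integral_Ico[OF ce that])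
  have krep: "e b - e a = (LBINT s:{a..b}. k s)" if ab: "0 \<le> a" "a \<le> b" "b < 1" for a b
  proof (rule LBINT_FTC[symmetric, OF ab(2)])
    show "(e has_real_derivative k x) (at x within {a..b})" if "a \<le> x" "x \<le> b" for x
      using de[of x] that ab by (auto simp: has_field_derivative_def intro: has_derivative_subset)
    show "continuous_on {a..b} k" by (rule continuous_on_subset[OF ck]) (use ab in auto)
  qed
  have ki: "set_integrable lborel {0..r} k" if "r < 1" for r
    by (rule borel_integrable_atLeastAtMost', rule continuous_on_subset[OF ck]) (use that in auto)
  have T0: "(LBINT s:{0..r}. k s * (r - s)) = \<eta>0 r - \<eta>0 0 + h\<^sup>2 * r" if r: "0 \<le> r" "r < 1" for r
    using taylor_weak[OF d\<eta>0 ce krep r ki[OF r(2)]] r by (simp add: e0)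
  define Y where "Y r = \<eta>0 r - \<xi> r" for r
  have c\<eta>0: "continuous_on {0..<1} \<eta>0" by (rule DERIV_continuous_on[OF d\<eta>0])
  have cY: "continuous_on {0..<1} Y" unfolding Y_def
    by (intro continuous_intros c\<eta>0 continuous_on_subset[OF c\<xi>]) auto
  have "bounded (\<xi> ` {0..1})" by (intro compact_imp_bounded compact_continuous_image c\<xi>) simp
  then obtain X where X: "\<forall>r\<in>{0..1}. \<bar>\<xi> r\<bar> \<le> X" unfolding bounded_iff by auto
  have coercive: "\<exists>q<1. \<forall>r. q \<le> r \<longrightarrow> r < 1 \<longrightarrow> M < \<theta> r - \<xi> r"
    if \<theta>: "\<And>r. 0 \<le> r \<Longrightarrow> r < 1 \<Longrightarrow> (LBINT s:{0..r}. k s * (r - s)) = \<theta> r - \<theta> 0 + h\<^sup>2 * r"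
    for \<theta> :: "real \<Rightarrow> real" and M
  proof -
    obtain q where q: "q < 1" "\<And>r. q \<le> r \<Longrightarrow> r < 1 \<Longrightarrow> M + X - \<theta> 0 + h\<^sup>2 < - ln (1 - r) - 1"
      using log_coercive[of "M + X - \<theta> 0 + h\<^sup>2"] by blast
    show ?thesis
    proof (intro exI[of _ "max q 0"] conjI allI impI)
      fix r assume r: "max q 0 \<le> r" "r < 1"
      have "h\<^sup>2 * r \<le> h\<^sup>2" using r by (intro mult_left_le) auto
      moreover have "\<xi> r \<le> X" using X r by (auto simp: abs_le_iff)
      ultimately show "M < \<theta> r - \<xi> r"
        using q(2)[of r] log_lower_bound[OF \<mu> pos, of r] \<theta>[of r] r unfolding k_def by simp
    qed (use q in simp)
  qed
  have YT: "(LBINT s:{0..r}. (1 / (phi_ext \<mu> s)\<^sup>2 - \<xi>2 s) * (r - s)) = Y r - Y 0 + h\<^sup>2 * r" if r: "0 \<le> r" "r < 1" for r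
  proof -
    have "(LBINT s:{0..r}. (1 / (phi_ext \<mu> s)\<^sup>2 - \<xi>2 s) * (r - s)) = (LBINT s:{0..r}. k s * (r - s) - \<xi>2 s * (r - s))"
      by (simp add: k_def left_diff_distrib)
    also have "\<dots> = (LBINT s:{0..r}. k s * (r - s)) - (LBINT s:{0..r}. \<xi>2 s * (r - s))"
      by (intro set_integral_diff(2) borel_integrable_atLeastAtMost' continuous_intros
            continuous_on_subset[OF c2] continuous_on_subset[OF ck]) (use r in auto)
    also have "\<dots> = Y r - Y 0 + h\<^sup>2 * r" using T0[OF r] \<xi>T[of r] r by (simp add: Y_def \<xi>0)
    finally show ?thesis .
  qed
  obtain q m where q: "0 \<le> q" "q < 1" and aeq: "AE r in \<mu>. r \<le> q" and aeY: "AE r in \<mu>. Y r = m"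
    and Ym: "\<forall>r\<in>{0..<1}. m \<le> Y r"
    by (rule minimizer_support[OF \<mu> min dd c2 YT cY coercive[OF T0, folded Y_def]]) auto
  have ae0: "AE r in \<mu>. 0 \<le> r" by (rule AE_I2) (simp add: Pr01D(3)[OF \<mu>])
  \<comment> \<open>subtracting the minimal value makes this admissible, with contact \<open>\<mu>\<close>-almost everywhere\<close>
  define \<theta> where "\<theta> r = \<eta>0 r - m" for r
  have d\<theta>: "(\<theta> has_real_derivative e s) (at s within {0..<1})" if "s \<in> {0..<1}" for s
    unfolding \<theta>_def[abs_def] using d\<eta>0[OF that] by (auto intro!: derivative_eq_intros)
  have D\<theta>: "deriv1 \<theta> s = e s" if "s \<in> {0..<1}" for s by (rule deriv1_eqI[OF that d\<theta>[OF that]])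
  have \<theta>X: "\<theta> \<in> X_space"
    unfolding X_space_def
  proof (intro CollectI conjI ballI)
    show "(\<theta> has_real_derivative deriv1 \<theta> s) (at s within {0..<1})" if "s \<in> {0..<1}" for s
      using d\<theta>[OF that] D\<theta>[OF that] by simp
    show "continuous_on {0..<1} (deriv1 \<theta>)" using ce D\<theta> by (metis (no_types, lifting) continuous_on_cong)
    show "local_lipschitz {0::real} {0..<1} (\<lambda>_. deriv1 \<theta>)"
    proof (rule local_lipschitzI)
      fix x :: real assume x: "x \<in> {0..<1}"
      define b where "b = (1 + x) / 2"
      have b: "x < b" "b < 1" "0 \<le> b" using x by (auto simp: b_def)
      have sub: "cball x ((1 - x) / 2) \<inter> {0..<1} \<subseteq> {0..b}"
      proof
        fix y assume "y \<in> cball x ((1 - x) / 2) \<inter> {0..<1}"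
        then have "\<bar>x - y\<bar> \<le> (1 - x) / 2" and "0 \<le> y" by (simp_all add: dist_real_def)
        then have "y \<le> (1 + x) / 2" using abs_ge_minus_self[of "x - y"] by (simp add: field_simps)
        then show "y \<in> {0..b}" using \<open>0 \<le> y\<close> by (simp add: b_def)
      qed
      have \<phi>b: "0 < phi_ext \<mu> b" using pos b by auto
      have "(k b)-lipschitz_on {0..b} e"
      proof (rule lipschitz_onI)
        show "0 \<le> k b" by (simp add: k_def)
        fix y z assume yz: "y \<in> {0..b}" "z \<in> {0..b}"
        have "norm (e y - e z) \<le> k b * norm (y - z)"
        proof (rule field_differentiable_bound[OF convex_real_interval(5)[of 0 b] _ _ yz])
          fix s assume s: "s \<in> {0..b}"
          then show "(e has_field_derivative k s) (at s within {0..b})"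
            using de[of s] b by (auto simp: has_field_derivative_def intro: has_derivative_subset)
          show "norm (k s) \<le> k b" unfolding k_def
            using phi_ext_props(4)[OF \<mu>, of s b] s \<phi>b by (auto intro!: divide_left_mono power_mono mult_pos_pos)
        qed
        then show "dist (e y) (e z) \<le> k b * dist y z" by (simp add: dist_norm)
      qed
      then have "(k b)-lipschitz_on (cball x ((1 - x) / 2) \<inter> {0..<1}) e"
        using sub by (rule lipschitz_on_subset)
      then have "(k b)-lipschitz_on (cball x ((1 - x) / 2) \<inter> {0..<1}) (deriv1 \<theta>)"
        by (simp add: lipschitz_on_def D\<theta>)
      then show "\<exists>u>0. \<exists>L. \<forall>t\<in>cball t u \<inter> {0}. L-lipschitz_on (cball x u \<inter> {0..<1}) (deriv1 \<theta>)" for t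
        using x by (intro exI[of _ "(1 - x) / 2"] conjI exI[of _ "k b"]) auto
    qed
  qed
  define k1 where "k1 s = indicator {0..<1} s * k s" for s
  note [measurable] = borel_measurable_phi_ext[OF \<mu>]
  have k1m: "k1 \<in> borel_measurable borel" unfolding k1_def[abs_def] k_def by measurable
  have "is_distr_deriv2 \<theta> k1"
  proof (rule is_distr_deriv2I[OF k1m _ d\<theta> ce])
    fix \<delta> :: real assume "\<delta> > 0"
    have "\<bar>k1 s\<bar> \<le> k (1 - \<delta>)" if s: "s \<in> {0..1 - \<delta>}" for s
    proof -
      have "0 < phi_ext \<mu> (1 - \<delta>)" using pos s \<open>\<delta> > 0\<close> by auto
      moreover have "phi_ext \<mu> (1 - \<delta>) \<le> phi_ext \<mu> s" using phi_ext_props(4)[OF \<mu>, of s "1 - \<delta>"] s by simp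
      ultimately have "k s \<le> k (1 - \<delta>)" unfolding k_def
        by (intro divide_left_mono power_mono) (auto intro!: mult_pos_pos)
      moreover have "0 \<le> k s" by (simp add: k_def)
      ultimately show ?thesis by (auto simp: k1_def split: split_indicator)
    qed
    then show "\<exists>C. AE s in lborel. s \<in> {0..1 - \<delta>} \<longrightarrow> \<bar>k1 s\<bar> \<le> C" by (intro exI AE_I2) blast
  next
    fix a b :: real assume ab: "0 \<le> a" "a \<le> b" "b < 1"
    have "(LBINT s:{a..b}. k s) = (LBINT s:{a..b}. k1 s)"
      by (rule set_lebesgue_integral_cong) (use ab in \<open>auto simp: k1_def\<close>)
    then show "e b - e a = (LBINT s:{a..b}. k1 s)" using krep[OF ab] by simp
  qed
  from distr_deriv2_unique[OF X_space_distr_deriv2(1)[OF \<theta>X] this]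
  have g\<theta>: "AE s in lborel. s \<in> {0..<1} \<longrightarrow> distr_deriv2 \<theta> s = k s"
    by eventually_elim (auto simp: k1_def)
  have \<theta>L: "\<theta> \<in> Lambda \<xi> h"
    unfolding Lambda_def
  proof (intro CollectI conjI ballI \<theta>X)
    show "\<xi> s \<le> \<theta> s" if "s \<in> {0..<1}" for s using bspec[OF Ym that] by (simp add: \<theta>_def Y_def)
    show "deriv1 \<theta> 0 = - h\<^sup>2" using D\<theta>[of 0] e0 by simp
    show "AE s in lborel. s \<in> {0..<1} \<longrightarrow> 0 \<le> distr_deriv2 \<theta> s"
      using g\<theta> by eventually_elim (auto simp: k_def)
  qed
  have \<xi>_taylor: "\<forall>r\<in>{0..1}. (LBINT s:{0..r}. \<xi>2 s * (r - s)) = \<xi> r" using \<xi>T by auto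
  note gap = duality_gap[OF \<mu> pos int dd c2 \<xi>_taylor c\<xi> q aeq]
  have \<theta>gap: "dual_functional \<xi> h \<theta> = crisanti_sommers \<xi> h \<mu>"
  proof -
    have "(\<integral>\<^sup>+s\<in>{0..<1}. ennreal (phi_ext \<mu> s * (sqrt (distr_deriv2 \<theta> s) - 1 / phi_ext \<mu> s)\<^sup>2) \<partial>lborel)
       = (\<integral>\<^sup>+s. 0 \<partial>(lborel :: real measure))"
    proof (rule nn_integral_cong_AE)
      show "AE s in lborel. ennreal (phi_ext \<mu> s * (sqrt (distr_deriv2 \<theta> s) - 1 / phi_ext \<mu> s)\<^sup>2) * indicator {0..<1} s = 0"
        using g\<theta>
      proof eventually_elim
        case (elim s)
        show ?case
        proof (cases "s \<in> {0..<1}")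
          case True
          then have "0 < phi_ext \<mu> s" using pos by auto
          then show ?thesis using elim True by (simp add: k_def real_sqrt_divide)
        qed simp
      qed
    qed
    moreover have "(\<integral>r. \<theta> (min r q) - \<xi> (min r q) \<partial>\<mu>) = (\<integral>r. 0 \<partial>\<mu>)"
    proof (rule integral_cong_AE)
      show "AE r in \<mu>. \<theta> (min r q) - \<xi> (min r q) = 0"
        using aeq aeY by eventually_elim (simp add: \<theta>_def Y_def)
    qed (use gap(2)[OF \<theta>L] in auto)
    ultimately show ?thesis unfolding gap(1)[OF \<theta>L]
      by (simp add: zero_ereal_def[symmetric] zero_ennreal.rep_eq)
  qed
  let ?E = "\<integral>\<^sup>+s\<in>{0..<1}. ennreal (phi_ext \<mu> s * (sqrt (distr_deriv2 \<eta> s) - 1 / phi_ext \<mu> s)\<^sup>2) \<partial>lborel"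
  let ?I = "\<integral>r. \<eta> (min r q) - \<xi> (min r q) \<partial>\<mu>"
  have \<eta>\<xi>: "\<forall>s\<in>{0..<1}. \<xi> s \<le> \<eta> s" and \<eta>X: "\<eta> \<in> X_space" and \<eta>0: "deriv1 \<eta> 0 = - h\<^sup>2"
    and g0: "AE s in lborel. s \<in> {0..<1} \<longrightarrow> 0 \<le> distr_deriv2 \<eta> s"
    using \<eta> by (auto simp: Lambda_def)
  have Inn: "AE r in \<mu>. 0 \<le> \<eta> (min r q) - \<xi> (min r q)"
    using ae0 aeq by eventually_elim (use \<eta>\<xi> q in auto)
  have I0: "0 \<le> ?I" by (rule integral_nonneg_AE[OF Inn])
  obtain p where p: "crisanti_sommers \<xi> h \<mu> = ereal p"
    using crisanti_sommers_eq_real[OF \<mu> pos int dd] by blast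
  \<comment> \<open>maximality against \<open>\<theta>\<close>, whose value is that of the minimum\<close>
  have "ereal p \<le> ereal p - ereal (1/2) * (enn2ereal ?E + ereal ?I)"
    using bspec[OF max \<theta>L] unfolding \<theta>gap gap(1)[OF \<eta>] p .
  then have E0: "?E = 0" and I0': "?I = 0"
    using I0 by (cases ?E; simp add: ennreal_eq_0_iff)+
  have gm[measurable]: "distr_deriv2 \<eta> \<in> borel_measurable borel"
    using X_space_distr_deriv2(1)[OF \<eta>X] by (simp add: is_distr_deriv2_def)
  have "AE s in lborel. ennreal (phi_ext \<mu> s * (sqrt (distr_deriv2 \<eta> s) - 1 / phi_ext \<mu> s)\<^sup>2) * indicator {0..<1} s = 0"
    using E0 by (subst (asm) nn_integral_0_iff_AE) auto
  with g0 have g\<eta>: "AE s in lborel. s \<in> {0..<1} \<longrightarrow> distr_deriv2 \<eta> s = k s"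
  proof eventually_elim
    case (elim s)
    show ?case
    proof
      assume s: "s \<in> {0..<1}"
      have "0 < phi_ext \<mu> s" using pos s by auto
      then have "sqrt (distr_deriv2 \<eta> s) = 1 / phi_ext \<mu> s"
        using elim(2) s by (auto simp: ennreal_eq_0_iff mult_le_0_iff)
      then have "(sqrt (distr_deriv2 \<eta> s))\<^sup>2 = (1 / phi_ext \<mu> s)\<^sup>2" by simp
      then show "distr_deriv2 \<eta> s = k s" using elim(1) s by (simp add: k_def power_divide)
    qed
  qed
  have D\<eta>: "deriv1 \<eta> s = e s" if s: "s \<in> {0..<1}" for s
  proof -
    have "deriv1 \<eta> s - deriv1 \<eta> 0 = (LBINT r:{0..s}. distr_deriv2 \<eta> r)"
      by (rule X_space_distr_deriv2(2)[OF \<eta>X]) (use s in auto)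
    also have "\<dots> = (LBINT r:{0..s}. k r)"
      by (rule set_lebesgue_integral_cong_AE)
         (use s in \<open>auto intro!: eventually_mono[OF g\<eta>] simp: k_def[abs_def]\<close>)
    also have "\<dots> = e s - e 0" using krep[of 0 s] s by simp
    finally show ?thesis using \<eta>0 e0 by simp
  qed
  have d\<eta>: "(\<eta> has_real_derivative e s) (at s within {0..<1})" if "s \<in> {0..<1}" for s
  proof -
    have "(\<eta> has_real_derivative deriv1 \<eta> s) (at s within {0..<1})"
      using \<eta>X that by (auto simp: X_space_def)
    then show ?thesis by (simp only: D\<eta>[OF that])
  qed
  have T\<eta>: "(LBINT s:{0..r}. k s * (r - s)) = \<eta> r - \<eta> 0 + h\<^sup>2 * r" if r: "0 \<le> r" "r < 1" for r
    using taylor_weak[OF d\<eta> ce krep r ki[OF r(2)]] r by (simp add: e0)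
  have "AE r in \<mu>. \<eta> (min r q) - \<xi> (min r q) = 0"
    using integral_nonneg_eq_0_iff_AE[OF gap(2)[OF \<eta>] Inn] I0' by simp
  then have aeC: "AE r in \<mu>. r \<in> contact_set \<xi> \<eta>"
    using aeq ae0 by eventually_elim (use q in \<open>auto simp: contact_set_def\<close>)
  have bd: "\<exists>q<1. \<forall>r\<in>contact_set \<xi> \<eta>. r \<le> q"
  proof -
    obtain q where q: "q < 1" "\<And>r. q \<le> r \<Longrightarrow> r < 1 \<Longrightarrow> 0 < \<eta> r - \<xi> r"
      using coercive[OF T\<eta>, of 0] by blast
    have "r \<le> q" if "r \<in> contact_set \<xi> \<eta>" for r
      using q(2)[of r] that by (cases "r \<le> q") (auto simp: contact_set_def)
    then show ?thesis using q(1) by blast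
  qed
  show thesis
    by (rule that[OF \<mu> pos \<eta>\<xi> e0 d\<eta> de[unfolded k_def] aeC bd])
qed

section \<open>The contact set\<close>

text \<open>
  The zero is a minimum.  At the boundary point $0$ the assumption \<open>e 0 \<le> 0\<close> complements the one-sided
  condition.  If \<open>k\<close> were negative at the zero, then \<open>e\<close> and hence \<open>G\<close> would be negative just to the right of it.
\<close>

lemma conditions_at_zero_of_nonneg:
  fixes G e k :: "real \<Rightarrow> real"
  assumes dG: "\<And>s. s \<in> {0..<1} \<Longrightarrow> (G has_real_derivative e s) (at s within {0..<1})"
    and de: "\<And>s. s \<in> {0..<1} \<Longrightarrow> (e has_real_derivative k s) (at s within {0..<1})"
    and G0: "\<forall>s\<in>{0..<1}. 0 \<le> G s" and e0: "e 0 \<le> 0"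
    and s: "s \<in> {0..<1}" "G s = 0"
  shows "e s = 0" "0 \<le> k s"
proof -
  show es: "e s = 0"
  proof (cases "s = 0")
    case True
    have "0 \<le> e 0"
    proof (rule ccontr)
      assume "\<not> 0 \<le> e 0"
      then obtain d where d: "0 < d" "\<forall>h>0. 0 + h \<in> {0..<1} \<longrightarrow> h < d \<longrightarrow> G (0 + h) < G 0"
        using has_real_derivative_neg_dec_right[OF dG[of 0]] by auto
      define h where "h = min (d / 2) (1 / 2)"
      have "0 < h" "h < d" "h < 1" using d(1) by (auto simp: h_def)
      then have "G h < G 0" using d(2) by auto
      moreover have "0 \<le> G h" using G0 \<open>0 < h\<close> \<open>h < 1\<close> by auto
      ultimately show False using s True by simp
    qed
    then show ?thesis using e0 True by simp
  next
    case False
    then have "s \<in> interior {0..<1}" using s by simp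
    then have D: "(G has_real_derivative e s) (at s)" using dG[OF s(1)] at_within_interior by metis
    define d where "d = min s (1 - s)"
    have "0 < d" using False s by (auto simp: d_def)
    moreover have "\<forall>y. \<bar>s - y\<bar> < d \<longrightarrow> G s \<le> G y"
    proof (intro allI impI)
      fix y assume "\<bar>s - y\<bar> < d"
      then have "y \<in> {0..<1}" unfolding d_def abs_less_iff by auto
      then show "G s \<le> G y" using G0 s(2) by simp
    qed
    ultimately show ?thesis by (rule DERIV_local_min[OF D])
  qed
  show "0 \<le> k s"
  proof (rule ccontr)
    assume "\<not> 0 \<le> k s"
    then obtain d where d: "0 < d" "\<forall>h>0. s + h \<in> {0..<1} \<longrightarrow> h < d \<longrightarrow> e (s + h) < e s"
      using has_real_derivative_neg_dec_right[OF de[OF s(1)]] by auto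
    define h where "h = min (d / 2) ((1 - s) / 2)"
    have h: "0 < h" "h < d" "s + h < 1" using d(1) s by (auto simp: h_def min_def field_simps)
    have "G (s + h) < G s"
    proof (rule DERIV_neg_imp_decreasing_open[where f=G and a=s])
      show "s < s + h" using h by simp
    next
      fix x assume x: "s < x" "x < s + h"
      then have "x \<in> interior {0..<1}" using s h by simp
      then have "(G has_real_derivative e x) (at x)"
        using dG[of x] at_within_interior[of x "{0..<1}"] x s h by auto
      moreover have "e x < 0" using d(2)[rule_format, of "x - s"] x h s es by auto
      ultimately show "\<exists>y. (G has_real_derivative y) (at x) \<and> y < 0" by blast
    next
      have "continuous_on {0..<1} G" by (rule DERIV_continuous_on[OF dG])
      then show "continuous_on {s..s + h} G" by (rule continuous_on_subset) (use s h in auto)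
    qed
    moreover have "0 \<le> G (s + h)" using G0 s h by auto
    ultimately show False using s by simp
  qed
qed

lemma null_neighbourhood_if_not_in_supp:
  assumes \<mu>: "\<mu> \<in> Pr01" and s: "s \<in> {0..1}" "s \<notin> supp \<mu>"
  obtains d where "0 < d" "AE r in \<mu>. \<not> (s - d < r \<and> r < s + d)"
proof -
  interpret prob_space \<mu> by (rule Pr01D(1)[OF \<mu>])
  obtain U where U: "open U" "s \<in> U" "emeasure \<mu> (U \<inter> space \<mu>) = 0"
    using s Pr01D(3)[OF \<mu>] by (auto simp: supp_def not_less)
  have "U \<inter> space \<mu> \<in> sets \<mu>"
    using U(1) by (simp add: Pr01D(2,3)[OF \<mu>] sets_restrict_space_iff)
  then have N: "AE r in \<mu>. r \<notin> U \<inter> space \<mu>" using U(3) by (intro AE_not_in null_setsI)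
  obtain d where d: "0 < d" "ball s d \<subseteq> U" using U openE by blast
  show thesis
  proof (rule that[OF d(1)])
    have "AE r in \<mu>. r \<in> space \<mu>" by (rule AE_space)
    with N show "AE r in \<mu>. \<not> (s - d < r \<and> r < s + d)"
    proof eventually_elim
      case (elim r)
      then have "r \<notin> ball s d" using d(2) by blast
      then show ?case by (auto simp: dist_real_def abs_less_iff)
    qed
  qed
qed

theorem proposition1p8:
  fixes \<beta> h :: real and b :: "nat \<Rightarrow> real" and \<xi> :: "real \<Rightarrow> real"
    and \<mu> :: "real measure" and \<eta> :: "real \<Rightarrow> real"
  assumes xi: "\<xi> = model \<beta> b"
    and conv: "\<exists>\<epsilon>>0. summable (\<lambda>p. (if 2 \<le> p then (b p)\<^sup>2 else 0) * (1 + \<epsilon>) ^ p)"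
    and nonzero: "\<exists>t\<in>{0..1}. \<xi> t \<noteq> 0"
    and h: "h \<ge> 0"
    and mu: "is_arg_min (crisanti_sommers \<xi> h) (\<lambda>\<nu>. \<nu> \<in> Pr01) \<mu>"
    and eta: "is_arg_max (dual_functional \<xi> h) (\<lambda>\<theta>. \<theta> \<in> Lambda \<xi> h) \<eta>"
  shows "((\<exists>t\<in>frakd_dom \<xi>. frakd \<xi> t \<noteq> 0) \<longrightarrow>
            (\<forall>s\<in>contact_set \<xi> \<eta> - supp \<mu>. s isolated_in contact_set \<xi> \<eta>))
       \<and> ((\<forall>t\<in>frakd_dom \<xi>. frakd \<xi> t = 0) \<longrightarrow>
            (\<exists>m\<in>{0..1}. \<exists>r1\<in>{0..1}. \<exists>r2\<in>{0..1}. r1 \<le> r2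
               \<and> (\<forall>A\<in>sets \<mu>. emeasure \<mu> A = ennreal m * emeasure (return borel01 r1) A
                                          + ennreal (1 - m) * emeasure (return borel01 r2) A)
               \<and> contact_set \<xi> \<eta> = {r1..r2}))"
proof -
  obtain R \<xi>1 \<xi>2 Z where R: "1 < R" and \<xi>0: "\<xi> 0 = 0" "\<xi>1 0 = 0"
    and d1: "\<And>x. \<bar>x\<bar> < R \<Longrightarrow> (\<xi> has_real_derivative \<xi>1 x) (at x)"
    and d2: "\<And>x. \<bar>x\<bar> < R \<Longrightarrow> (\<xi>1 has_real_derivative \<xi>2 x) (at x)"
    and dd: "\<And>x. \<bar>x\<bar> < R \<Longrightarrow> deriv (deriv \<xi>) x = \<xi>2 x"
    and \<xi>2pos: "\<And>x. 0 < x \<Longrightarrow> x < R \<Longrightarrow> 0 < \<xi>2 x"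
    and Z: "Z holomorphic_on ball 0 R" and Zr: "\<And>x. \<bar>x\<bar> < R \<Longrightarrow> Z (complex_of_real x) = complex_of_real (\<xi>2 x)"
    by (rule model_power_series[OF xi conv nonzero]) blast
  have dd01: "\<forall>x\<in>{0..1}. deriv (deriv \<xi>) x = \<xi>2 x" using dd R by auto
  have c2: "continuous_on {0..1} \<xi>2"
  proof -
    have "continuous_on {0..1} (\<lambda>x. Re (Z (complex_of_real x)))"
      by (intro continuous_intros continuous_on_compose2[OF holomorphic_on_imp_continuous_on[OF Z]])
         (use R in auto)
    moreover have "Re (Z (complex_of_real x)) = \<xi>2 x" if "x \<in> {0..1}" for x using Zr[of x] R that by auto
    ultimately show ?thesis by (metis (no_types, lifting) continuous_on_cong)
  qed
  let ?\<phi> = "phi_ext \<mu>" and ?C = "contact_set \<xi> \<eta>"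
  obtain e where \<mu>: "\<mu> \<in> Pr01" and pos: "\<forall>s\<in>{0..<1}. 0 < ?\<phi> s"
    and \<eta>\<xi>: "\<forall>s\<in>{0..<1}. \<xi> s \<le> \<eta> s" and e0: "e 0 = - h\<^sup>2"
    and d\<eta>: "\<And>s. s \<in> {0..<1} \<Longrightarrow> (\<eta> has_real_derivative e s) (at s within {0..<1})"
    and de: "\<And>s. s \<in> {0..<1} \<Longrightarrow> (e has_real_derivative 1 / (?\<phi> s)\<^sup>2) (at s within {0..<1})"
    and aeC: "AE r in \<mu>. r \<in> ?C" and bd: "\<exists>q<1. \<forall>r\<in>?C. r \<le> q"
    by (rule optimality_conditions[OF R \<xi>0 d1 d2 dd01 c2 mu eta]; blast)
  interpret prob_space \<mu> by (rule Pr01D(1)[OF \<mu>])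
  define G where "G s = \<eta> s - \<xi> s" for s
  define g where "g s = e s - \<xi>1 s" for s
  define k where "k s = 1 / (?\<phi> s)\<^sup>2 - \<xi>2 s" for s
  have C_G: "s \<in> ?C \<longleftrightarrow> s \<in> {0..<1} \<and> G s = 0" for s by (auto simp: contact_set_def G_def)
  have dG: "(G has_real_derivative g s) (at s within {0..<1})" if "s \<in> {0..<1}" for s
    unfolding G_def[abs_def] g_def
    by (intro derivative_intros d\<eta> that has_field_derivative_at_within[OF d1]) (use that R in auto)
  have dg: "(g has_real_derivative k s) (at s within {0..<1})" if "s \<in> {0..<1}" for s
    unfolding g_def[abs_def] k_def
    by (intro derivative_intros de that has_field_derivative_at_within[OF d2]) (use that R in auto)
  have G0: "\<forall>s\<in>{0..<1}. 0 \<le> G s" using \<eta>\<xi> by (simp add: G_def)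
  have g0: "g 0 \<le> 0" by (simp add: g_def e0 \<xi>0)
  have Cg: "g s = 0" "0 \<le> k s" if "s \<in> ?C" for s
    using conditions_at_zero_of_nonneg[OF dG dg G0 g0] that C_G by auto
  have cG: "continuous_on {0..<1} G" by (rule DERIV_continuous_on[OF dG])
  have cg: "continuous_on {0..<1} g" by (rule DERIV_continuous_on[OF dg])
  have dG': "(G has_real_derivative g s) (at s)" and dg': "(g has_real_derivative k s) (at s)" if "0 < s" "s < 1" for s
  proof -
    have "at s within {0..<1} = at s" by (rule at_within_interior) (use that in simp)
    then show "(G has_real_derivative g s) (at s)" "(g has_real_derivative k s) (at s)"
      using dG[of s] dg[of s] that by auto
  qed
  \<comment> \<open>contact points accumulate at \<open>s\<close>, where \<open>\<phi>\<close> is affine: Rolle's theorem and analytic continuation\<close>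
  have "s isolated_in ?C" if nz: "\<exists>t\<in>frakd_dom \<xi>. frakd \<xi> t \<noteq> 0" and s: "s \<in> ?C - supp \<mu>" for s
  proof (rule ccontr)
    assume "\<not> s isolated_in ?C"
    then have lim: "s islimpt ?C" using s by (simp add: isolated_in_islimpt_iff)
    have s01: "s \<in> {0..<1}" using s C_G by auto
    obtain d where d: "0 < d" "AE r in \<mu>. \<not> (s - d < r \<and> r < s + d)"
      by (rule null_neighbourhood_if_not_in_supp[OF \<mu>, of s]) (use s s01 in auto)
    obtain a c where ac: "\<forall>x. s - d \<le> x \<longrightarrow> x \<le> s + d \<longrightarrow> stop_loss \<mu> x = a - c * x"
      using stop_loss_affine[OF \<mu> d(2)] by blast
    have \<phi>: "?\<phi> x = (1 - a) - (1 - c) * x" if "s - d \<le> x" "x \<le> s + d" for x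
    proof -
      have "stop_loss \<mu> x = a - c * x" using ac that by blast
      then show ?thesis by (simp add: phi_ext_def algebra_simps)
    qed
    have root: "\<exists>z. x < z \<and> z < y \<and> k z = 0" if xy: "x < y" "x \<in> ?C" "y \<in> ?C" for x y
    proof -
      have x: "0 \<le> x" "y < 1" using xy C_G by auto
      have "\<exists>z. x < z \<and> z < y \<and> (g has_real_derivative 0) (at z)"
      proof (rule Rolle[OF xy(1)])
        show "g x = g y" using Cg xy by simp
        show "continuous_on {x..y} g" by (rule continuous_on_subset[OF cg]) (use x in auto)
        show "g differentiable at z" if "x < z" "z < y" for z
          using dg'[of z] that x by (auto simp: real_differentiable_def)
      qed
      then obtain z where z: "x < z" "z < y" "(g has_real_derivative 0) (at z)" by blast
      then have "k z = 0" using dg'[of z] x DERIV_unique by auto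
      then show ?thesis using z by blast
    qed
    have "s islimpt {x \<in> {0..<1}. \<xi>2 x * ((1 - a) - (1 - c) * x)\<^sup>2 = 1}"
      unfolding islimpt_approachable
    proof (intro allI impI)
      fix \<epsilon> :: real assume "\<epsilon> > 0"
      then obtain y where y: "y \<in> ?C" "y \<noteq> s" "dist y s < min \<epsilon> d"
        using lim d(1) unfolding islimpt_approachable by (meson min_less_iff_conj)
      have y01: "y \<in> {0..<1}" using y C_G by auto
      have "min s y < max s y" "min s y \<in> ?C" "max s y \<in> ?C" using y s by (auto simp: min_def max_def)
      from root[OF this] obtain z where z: "min s y < z" "z < max s y" "k z = 0" by blast
      have z': "z \<in> {0..<1}" "z \<noteq> s" using z y01 s01 by auto
      have zd: "dist z s < min \<epsilon> d"
      proof (rule le_less_trans[OF _ y(3)])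
        show "dist z s \<le> dist y s" using z unfolding dist_real_def by linarith
      qed
      have \<phi>z: "?\<phi> z = (1 - a) - (1 - c) * z"
        by (rule \<phi>) (use zd in \<open>auto simp: dist_real_def abs_less_iff\<close>)
      have "0 < ?\<phi> z" using pos z' by auto
      then have "\<xi>2 z * (?\<phi> z)\<^sup>2 = 1" using z(3) by (simp add: k_def field_simps)
      then have "\<xi>2 z * ((1 - a) - (1 - c) * z)\<^sup>2 = 1" unfolding \<phi>z .
      then show "\<exists>x'\<in>{x \<in> {0..<1}. \<xi>2 x * ((1 - a) - (1 - c) * x)\<^sup>2 = 1}. x' \<noteq> s \<and> dist x' s < \<epsilon>"
        using z' zd by (intro bexI[of _ z]) auto
    qed
    from frakd_zero_if_roots_accumulate[OF R dd Z Zr s01 this] nz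
    show False by blast
  qed
  moreover have "\<exists>m\<in>{0..1}. \<exists>r1\<in>{0..1}. \<exists>r2\<in>{0..1}. r1 \<le> r2
               \<and> (\<forall>A\<in>sets \<mu>. emeasure \<mu> A = ennreal m * emeasure (return borel01 r1) A
                                          + ennreal (1 - m) * emeasure (return borel01 r2) A)
               \<and> ?C = {r1..r2}" if zero: "\<forall>t\<in>frakd_dom \<xi>. frakd \<xi> t = 0"
  proof -
    obtain p c where \<psi>pos: "\<And>x. x \<in> {0..1} \<Longrightarrow> 0 < p - c * x"
      and \<psi>: "\<And>x. x \<in> {0..1} \<Longrightarrow> \<xi>2 x = 1 / (p - c * x)\<^sup>2"
      by (rule reciprocal_sqrt_affine_if_frakd_zero[OF R dd \<xi>2pos Z Zr zero]; blast)
    have k_iff: "0 \<le> k s \<longleftrightarrow> ?\<phi> s \<le> p - c * s" "k s = 0 \<longleftrightarrow> ?\<phi> s = p - c * s" if s: "s \<in> {0..<1}" for s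
    proof -
      have P: "0 < ?\<phi> s" "0 < p - c * s" using pos \<psi>pos[of s] s by auto
      have K: "k s = 1 / (?\<phi> s)\<^sup>2 - 1 / (p - c * s)\<^sup>2" using \<psi>[of s] s by (simp add: k_def)
      have le: "1 / y\<^sup>2 \<le> 1 / x\<^sup>2 \<longleftrightarrow> x \<le> y" if "0 < x" "0 < y" for x y :: real
      proof -
        have "1 / y\<^sup>2 \<le> 1 / x\<^sup>2 \<longleftrightarrow> x\<^sup>2 \<le> y\<^sup>2" using that by (simp add: field_simps)
        then show ?thesis using that by simp
      qed
      show "0 \<le> k s \<longleftrightarrow> ?\<phi> s \<le> p - c * s" unfolding K using le[OF P] by simp
      show "k s = 0 \<longleftrightarrow> ?\<phi> s = p - c * s" unfolding K using le[OF P] le[OF P(2,1)] by argo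
    qed
    obtain q where q: "q < 1" "\<forall>r\<in>?C. r \<le> q" using bd by blast
    have compact_C: "compact (?C \<inter> {x..y})" for x y
    proof -
      have eq: "?C \<inter> {x..y} = {s \<in> {max 0 x..min y q}. G s = 0}"
        using q C_G by auto
      have "continuous_on {max 0 x..min y q} G" by (rule continuous_on_subset[OF cG]) (use q in auto)
      then have "closed ({max 0 x..min y q} \<inter> G -` {0})"
        by (intro continuous_closed_preimage) auto
      then have "compact ({max 0 x..min y q} \<inter> ({max 0 x..min y q} \<inter> G -` {0}))"
        by (intro compact_Int_closed) auto
      moreover have "{max 0 x..min y q} \<inter> ({max 0 x..min y q} \<inter> G -` {0}) = {s \<in> {max 0 x..min y q}. G s = 0}" by auto
      ultimately show ?thesis unfolding eq by simp
    qed
    \<comment> \<open>a missing point \<open>z\<close> would lie in a maximal gap \<open>(u,v)\<close> of the contact set\<close>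
    have convex: "z \<in> ?C" if x: "x \<in> ?C" and y: "y \<in> ?C" and z: "x \<le> z" "z \<le> y" for x y z
    proof (rule ccontr)
      assume zC: "z \<notin> ?C"
      obtain u where u: "u \<in> ?C \<inter> {x..z}" "\<forall>r\<in>?C \<inter> {x..z}. r \<le> u"
      proof -
        have "?C \<inter> {x..z} \<noteq> {}" using x z by auto
        from compact_attains_sup[OF compact_C this] that show ?thesis by blast
      qed
      obtain v where v: "v \<in> ?C \<inter> {z..y}" "\<forall>r\<in>?C \<inter> {z..y}. v \<le> r"
      proof -
        have "?C \<inter> {z..y} \<noteq> {}" using y z by auto
        from compact_attains_inf[OF compact_C this] that show ?thesis by blast
      qed
      have uz: "u < z" "z < v" using u v zC by (auto simp: less_le)
      have u01: "0 \<le> u" "v < 1" using u v C_G by auto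
      have "AE r in \<mu>. \<not> (u < r \<and> r < v)"
        using aeC
      proof eventually_elim
        case (elim r)
        show ?case
        proof
          assume r: "u < r \<and> r < v"
          show False
          proof (cases "r \<le> z")
            case True then show False using u(2) u(1) elim r by (auto dest!: bspec[where x=r])
          next
            case False then show False using v(2) v(1) elim r by (auto dest!: bspec[where x=r])
          qed
        qed
      qed
      from stop_loss_affine[OF \<mu> this] obtain a d where
        ad: "\<forall>s. u \<le> s \<longrightarrow> s \<le> v \<longrightarrow> stop_loss \<mu> s = a - d * s" by blast
      have aff: "(p - c * s) - ?\<phi> s = (p - 1 + a) + (1 - c - d) * s" if "u \<le> s" "s \<le> v" for s
      proof -
        have "stop_loss \<mu> s = a - d * s" using ad that by blast
        then show ?thesis by (simp add: phi_ext_def algebra_simps)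
      qed
      have ends: "0 \<le> (p - 1 + a) + (1 - c - d) * u" "0 \<le> (p - 1 + a) + (1 - c - d) * v"
        using k_iff(1)[of u] k_iff(1)[of v] Cg(2)[of u] Cg(2)[of v] u v u01 uz aff[of u] aff[of v] by auto
      have k0: "0 \<le> k s" if s: "u \<le> s" "s \<le> v" for s
      proof -
        have "0 \<le> (p - 1 + a) + (1 - c - d) * s"
        proof (cases "0 \<le> 1 - c - d")
          case True
          then have "(1 - c - d) * u \<le> (1 - c - d) * s" using s by (intro mult_left_mono)
          then show ?thesis using ends by simp
        next
          case False
          then have "(1 - c - d) * v \<le> (1 - c - d) * s" using s by (intro mult_left_mono_neg) auto
          then show ?thesis using ends by simp
        qed
        then show ?thesis using k_iff(1)[of s] aff[OF s] s u01 uz by auto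
      qed
      have mono: "g x \<le> g y" if "u \<le> x" "x \<le> y" "y \<le> v" for x y
      proof (cases "x < y")
        case True
        have "\<exists>l z. x < z \<and> z < y \<and> (g has_real_derivative l) (at z) \<and> g y - g x = (y - x) * l"
        proof (rule MVT[OF True])
          show "continuous_on {x..y} g" by (rule continuous_on_subset[OF cg]) (use that u01 in auto)
          show "g differentiable at r" if "x < r" "r < y" for r
            using dg'[of r] \<open>u \<le> x\<close> \<open>y \<le> v\<close> that u01 by (auto simp: real_differentiable_def)
        qed
        then obtain l z where z: "x < z" "z < y" "(g has_real_derivative l) (at z)" "g y - g x = (y - x) * l" by blast
        then have "l = k z" using dg'[of z] that u01 DERIV_unique by auto
        then have "0 \<le> (y - x) * l" using k0[of z] z that by (intro mult_nonneg_nonneg) auto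
        then show ?thesis using z(4) by simp
      next
        case False
        then show ?thesis using that by simp
      qed
      have gz: "g s = 0" if "u \<le> s" "s \<le> v" for s
        using mono[of u s] mono[of s v] Cg(1)[of u] Cg(1)[of v] u v that by auto
      have "G z = G u"
      proof (rule DERIV_isconst_end[OF uz(1)])
        show "continuous_on {u..z} G" by (rule continuous_on_subset[OF cG]) (use u01 uz in auto)
        show "DERIV G s :> 0" if "u < s" "s < z" for s
          using dG'[of s] gz[of s] that uz u01 by auto
      qed
      then show False using zC u C_G uz u01 by auto
    qed
    have "?C \<noteq> {}" using aeC emeasure_space_1 by (auto simp: AE_iff_measurable AE_False)
    moreover have "?C \<inter> {0..q} = ?C" using q C_G by auto
    ultimately obtain u v where u: "u \<in> ?C" "\<forall>r\<in>?C. u \<le> r" and v: "v \<in> ?C" "\<forall>r\<in>?C. r \<le> v"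
      using compact_attains_inf[OF compact_C[of 0 q]] compact_attains_sup[OF compact_C[of 0 q]] by auto
    have uv: "u \<le> v" using u v by blast
    have C: "?C = {u..v}"
    proof
      show "?C \<subseteq> {u..v}" using u(2) v(2) by (meson atLeastAtMost_iff subsetI)
      show "{u..v} \<subseteq> ?C" using convex[OF u(1) v(1)] by (meson atLeastAtMost_iff subsetI)
    qed
    have u01: "0 \<le> u" "v < 1" using u v C_G by auto
    \<comment> \<open>on the contact interval \<open>\<phi>\<close> coincides with an affine function\<close>
    have ae: "AE r in \<mu>. r = u \<or> r = v"
    proof (cases "u = v")
      case True
      show ?thesis using aeC unfolding C by eventually_elim (use True in auto)
    next
      case False
      have kz: "k s = 0" if s: "s \<in> {u<..<v}" for s
      proof -
        have "(g has_real_derivative 0) (at s)"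
        proof (rule has_field_derivative_transform_within_open[where S="{u<..<v}"])
          show "((\<lambda>_. 0) has_real_derivative 0) (at s)" by simp
          show "0 = g x" if "x \<in> {u<..<v}" for x using Cg(1)[of x] that unfolding C by auto
        qed (use s in auto)
        then show ?thesis using dg'[of s] s u01 DERIV_unique by auto
      qed
      have cl: "closure {u<..<v} = {u..v}" by (rule closure_greaterThanLessThan) (use uv False in auto)
      have eq: "(p - c * s) - ?\<phi> s = 0" if "s \<in> {u..v}" for s
      proof (rule continuous_constant_on_closure[where S="{u<..<v}" and f="\<lambda>s. (p - c * s) - ?\<phi> s"])
        show "continuous_on (closure {u<..<v}) (\<lambda>s. (p - c * s) - ?\<phi> s)"
          by (intro continuous_intros phi_ext_props(5)[OF \<mu>])
        show "(p - c * s) - ?\<phi> s = 0" if "s \<in> {u<..<v}" for s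
          using k_iff(2)[of s] kz[OF that] that u01 by auto
      qed (use that cl in auto)
      have sl: "stop_loss \<mu> s = 1 - s - (p - c * s)" if "s \<in> {u..v}" for s
        using eq[OF that] by (simp add: phi_ext_def)
      have "u \<in> {u..v}" "v \<in> {u..v}" "(u + v) / 2 \<in> {u..v}" using uv by auto
      from this[THEN sl] have "stop_loss \<mu> u + stop_loss \<mu> v = 2 * stop_loss \<mu> ((u + v) / 2)"
        by (simp add: field_simps)
      from gap_if_stop_loss_affine[OF \<mu> this] aeC show ?thesis
        unfolding C by eventually_elim auto
    qed
    define m where "m = prob {u}"
    have su: "{u} \<in> sets \<mu>" using u01 uv by (simp add: Pr01D(2)[OF \<mu>] sets_restrict_space_iff)
    have m: "m \<in> {0..1}" by (simp add: m_def)
    have "emeasure \<mu> A = ennreal m * emeasure (return borel01 u) A + ennreal (1 - m) * emeasure (return borel01 v) A"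
      if A: "A \<in> sets \<mu>" for A
    proof -
      have A': "A \<in> sets borel01" using A Pr01D(2)[OF \<mu>] by simp
      have "prob A = (\<integral>r. indicator A r \<partial>\<mu>)" using A by simp
      also have "\<dots> = (\<integral>r. indicator A u * indicator {u} r + indicator A v * (1 - indicator {u} r) \<partial>\<mu>)"
      proof (rule integral_cong_AE)
        show "AE r in \<mu>. indicator A r = indicator A u * indicator {u} r + indicator A v * (1 - indicator {u} r :: real)"
          using ae by eventually_elim (auto split: split_indicator)
      qed (use A su in measurable)
      also have "\<dots> = indicator A u * m + indicator A v * (1 - m)"
        using su by (simp add: m_def prob_space emeasure_eq_measure)
      finally have "emeasure \<mu> A = ennreal (indicator A u * m + indicator A v * (1 - m))"
        by (simp add: emeasure_eq_measure)
      also have "\<dots> = ennreal m * indicator A u + ennreal (1 - m) * indicator A v"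
        using m by (auto split: split_indicator simp: ennreal_plus[symmetric] simp del: ennreal_plus)
      finally show ?thesis using A' by simp
    qed
    then show ?thesis using m u01 uv C
      by (intro bexI[of _ m] bexI[of _ u] bexI[of _ v] conjI ballI) auto
  qed
  ultimately show ?thesis by blast
qed

end
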